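(* For every positive integer $n$ and every cyclic permutation $\sigma$ of $[n]=\{0,1,\ldots,n-1\}$, $$\mu(\sigma)=n+\operatorname{jcr}(\sigma),$$ where $\mu(\sigma)$ is the meander number and $\operatorname{jcr}(\sigma)$ is the PL Jordan crossing number of $\sigma$.
   Context: A cyclic permutation $\sigma$ of $[n]=\{0,1,\ldots,n-1\}$ is a permutation consisting of a single $n$-cycle; it is written in cycle notation $\sigma=(\sigma_0,\sigma_1,\ldots,\sigma_{n-1})$, a listing of all elements of $[n]$ understood up to cyclic rotation. Meander number. A set of pairs of elements of $[N]$ is non-crossing if it does not contain two pairs $\{a_1,b_1\},\{a_2,b_2\}$ with $a_1<a_2<b_1<b_2$. For $N$ even and positive, a cyclic permutation $\tau=(\tau_0,\ldots,\tau_{N-1})$ of $[N]$ is cyclic meandric if the two alternating matchings $\{\{\tau_0,\tau_1\},\{\tau_2,\tau_3\},\ldots,\{\tau_{N-2},\tau_{N-1}\}\}$ and $\{\{\tau_1,\tau_2\},\{\tau_3,\tau_4\},\ldots,\{\tau_{N-1},\tau_0\}\}$ are both non-crossing. For $S\subset[N]$, the first-return permutation of $\tau$ on $S$ is obtained by reading $\tau$ cyclically, deleting all letters outside $S$, and relabelling the elements of $S$ increasingly by $0,\ldots,|S|-1$; it is a cyclic permutation of $[|S|]$. The meander number $\mu(\sigma)$ of a cyclic permutation $\sigma$ of $[n]$ is the least even $N$ for which there is a cyclic meandric permutation of $[N]$ whose first-return permutation on some $n$-element subset of $[N]$ is $\sigma$. PL Jordan crossing number. A PL Jordan realization of $\sigma$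 is a triple $(A,B,S)$ where $A,B\subset\mathbb{S}^2$ are oriented piecewise-linear Jordan curves meeting transversely in finitely many points and $S\subset A\cap B$ is an $n$-element set such that, after labelling the points of $S$ by $0,1,\ldots,n-1$ in their cyclic order along $A$ (for some choice of starting point), their cyclic order along $B$ is $\sigma$. Then $\operatorname{jcr}(\sigma)=\min\{|A\cap B|-n:\ (A,B,S)\text{ is a PL Jordan realization of }\sigma\}$. *)

theory Defs
  imports "HOL-Analysis.Analysis" "HOL-Combinatorics.Cycles" "HOL-Combinatorics.Orbits"
begin

section \<open>Cyclic permutations and the meander number\<close>

definition cyclic_permutation :: "nat \<Rightarrow> (nat \<Rightarrow> nat) \<Rightarrow> bool" where
  "cyclic_permutation n \<sigma> \<longleftrightarrow> \<sigma> permutes {..<n} \<and> cyclic_on \<sigma> {..<n}"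

text \<open>The cycle notation of a cyclic permutation is normalised to start at \<open>0\<close>. The notions
  below do not depend on the starting letter; the inverse translation is
  \<^const>\<open>cycle_of_list\<close>.\<close>

definition cycle_word :: "nat \<Rightarrow> (nat \<Rightarrow> nat) \<Rightarrow> nat list" where
  "cycle_word n \<sigma> = map (\<lambda>i. (\<sigma> ^^ i) 0) [0..<n]"

definition non_crossing :: "nat set set \<Rightarrow> bool" where
  "non_crossing M \<longleftrightarrow>
     \<not> (\<exists>a1 b1 a2 b2. {a1, b1} \<in> M \<and> {a2, b2} \<in> M \<and> a1 < a2 \<and> a2 < b1 \<and> b1 < b2)"

text \<open>In the second matching the last pair is \<open>{\<tau>\<^sub>N\<^sub>-\<^sub>1, \<tau>\<^sub>0}\<close>, because the \<open>N\<close>-th iterate of \<open>\<tau>\<close>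
  is the identity.\<close>

definition cyclic_meandric :: "nat \<Rightarrow> (nat \<Rightarrow> nat) \<Rightarrow> bool" where
  "cyclic_meandric N \<tau> \<longleftrightarrow>
     even N \<and> N > 0 \<and> cyclic_permutation N \<tau> \<and>
     non_crossing {{(\<tau> ^^ (2 * i)) 0, (\<tau> ^^ (2 * i + 1)) 0} |i. i < N div 2} \<and>
     non_crossing {{(\<tau> ^^ (2 * i + 1)) 0, (\<tau> ^^ (2 * i + 2)) 0} |i. i < N div 2}"

definition first_return :: "nat \<Rightarrow> (nat \<Rightarrow> nat) \<Rightarrow> nat set \<Rightarrow> nat \<Rightarrow> nat" where
  "first_return N \<tau> S =
     cycle_of_list (map (\<lambda>x. card {y \<in> S. y < x}) (filter (\<lambda>x. x \<in> S) (cycle_word N \<tau>)))"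

definition meander_number :: "nat \<Rightarrow> (nat \<Rightarrow> nat) \<Rightarrow> nat" where
  "meander_number n \<sigma> =
     (LEAST N. \<exists>\<tau> S. cyclic_meandric N \<tau> \<and> S \<subseteq> {..<N} \<and> card S = n \<and> first_return N \<tau> S = \<sigma>)"


section \<open>The PL Jordan crossing number\<close>

text \<open>The piecewise-linear structure on the unit sphere is the one obtained by radial
  projection \<^const>\<open>sgn\<close> from the boundary of any convex polytope with the origin in its interior.
  The projection turns straight segments in the faces into great-circle arcs of length less
  than \<open>\<pi>\<close>, and conversely such an arc is cut by the cones over the faces into finitely many
  projected segments. So PL curves are the finite concatenations of such arcs. An oriented
  curve is given by a parametrisation on \<open>[0,1]\<close>, of which only the image is required to be PL:
  each piece traces its arc, but not necessarily at any prescribed speed.\<close>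

definition geodesic_arc :: "real^3 \<Rightarrow> real^3 \<Rightarrow> (real^3) set" where
  "geodesic_arc u v = sgn ` closed_segment u v"

definition pl_path :: "(real \<Rightarrow> real^3) \<Rightarrow> bool" where
  "pl_path g \<longleftrightarrow>
     (\<exists>(m::nat) t. t 0 = 0 \<and> t m = 1 \<and>
        (\<forall>i<m. t i < t (Suc i) \<and>
               0 \<notin> closed_segment (g (t i)) (g (t (Suc i))) \<and>
               g ` {t i..t (Suc i)} = geodesic_arc (g (t i)) (g (t (Suc i)))))"

definition pl_jordan_curve :: "(real \<Rightarrow> real^3) \<Rightarrow> bool" where
  "pl_jordan_curve g \<longleftrightarrow>
     simple_path g \<and> pathfinish g = pathstart g \<and> path_image g \<subseteq> sphere 0 1 \<and> pl_path g"

text \<open>Transversality at \<open>p\<close>: in a chart of the sphere around \<open>p\<close> the two curves become the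
  coordinate axes. For PL curves with finite intersection a topological chart exists if and
  only if a PL chart does: both say that the two germs of \<open>B\<close> at \<open>p\<close> lie on different sides
  of \<open>A\<close>.\<close>

definition transverse_at :: "(real^3) set \<Rightarrow> (real^3) set \<Rightarrow> real^3 \<Rightarrow> bool" where
  "transverse_at A B p \<longleftrightarrow>
     (\<exists>U (V :: (real \<times> real) set) h k.
        openin (top_of_set (sphere 0 1)) U \<and> p \<in> U \<and> open V \<and> homeomorphism U V h k \<and> h p = 0 \<and>
        h ` (U \<inter> A) = {v \<in> V. snd v = 0} \<and> h ` (U \<inter> B) = {v \<in> V. fst v = 0})"

text \<open>The points of \<open>xs\<close> are pairwise distinct and are met by the closed curve \<open>g\<close> in this
  order, up to the choice of the starting point. The parameter \<open>1\<close> is excluded since it gives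
  the same point as \<open>0\<close>.\<close>

definition in_cyclic_order :: "(real \<Rightarrow> real^3) \<Rightarrow> (real^3) list \<Rightarrow> bool" where
  "in_cyclic_order g xs \<longleftrightarrow>
     (\<exists>r ts. sorted_wrt (<) ts \<and> set ts \<subseteq> {0..<1} \<and> rotate r xs = map g ts)"

definition pl_jordan_realization ::
  "nat \<Rightarrow> (nat \<Rightarrow> nat) \<Rightarrow> (real \<Rightarrow> real^3) \<Rightarrow> (real \<Rightarrow> real^3) \<Rightarrow> (real^3) set \<Rightarrow> bool" where
  "pl_jordan_realization n \<sigma> a b S \<longleftrightarrow>
     pl_jordan_curve a \<and> pl_jordan_curve b \<and>
     finite (path_image a \<inter> path_image b) \<and>
     (\<forall>p \<in> path_image a \<inter> path_image b. transverse_at (path_image a) (path_image b) p) \<and>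
     S \<subseteq> path_image a \<inter> path_image b \<and> card S = n \<and>
     (\<exists>x. bij_betw x {..<n} S \<and>
          in_cyclic_order a (map x [0..<n]) \<and>
          in_cyclic_order b (map x (cycle_word n \<sigma>)))"

definition jordan_crossing_number :: "nat \<Rightarrow> (nat \<Rightarrow> nat) \<Rightarrow> nat" where
  "jordan_crossing_number n \<sigma> =
     (LEAST k. \<exists>a b S. pl_jordan_realization n \<sigma> a b S \<and>
                       k = card (path_image a \<inter> path_image b) - n)"

end

theory Submission
  imports Defs
begin

text \<open>Given two transverse Jordan curves, label the crossings along \<open>A\<close>. At each crossing \<open>B\<close> changes the
  side of \<open>A\<close>, so the number of crossings is even and the arcs of \<open>B\<close> lie alternately in the two
  components of the complement. Two arcs in the same component do not interleave: stereographic
  projection from a point of the other component moves them to the inside of a plane Jordan curve,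
  where a chord separates the two boundary arcs between its ends.

  Conversely, a meandric permutation is drawn on a cylinder over an arc of a parabola, seen from the
  origin: \<open>A\<close> is the equator, each crossing is a vertical segment of \<open>B\<close>, and the arcs of the two
  matchings are chords of the parabola in the top and in the bottom plane, which are disjoint because
  the matchings are non-crossing.

  Finally, every cyclic permutation is the first return of some meandric one: on a square grid take
  for \<open>A\<close> the snake through the columns and for \<open>B\<close> the snake through the rows, and mark one
  suitable crossing in each of the first \<open>n\<close> rows.\<close>

section \<open>Cycle words\<close>

text \<open>Both directions preserve the number of crossings, so the two minima differ by exactly n.
  The grid construction is there because a least element says nothing about an empty set: one
  witness makes both minima attained.

  In the first direction neither side of A is distinguished, while the planar argument speaks of the
  inside only; it is therefore run from two poles, one on each side. Curves carry only cyclic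
  orders, so both are first rebased at the same marked point.

  In the second direction the curves must remain simple after radial projection: no ray from the
  origin may meet the polygon twice. This dictates the parabola y = x^2 - 1. The origin lies inside
  its convex region, which a ray leaves only once; the height of a chord over the parabola is the
  product of the horizontal distances to its ends, which separates nested chords; and y < 0 on all
  vertical segments, so all crossings are visible in the plane y = -1.\<close>

lemma funpow_cycle_of_list_nth:
  assumes "distinct l" "l \<noteq> []"
  shows "(cycle_of_list l ^^ i) (l ! 0) = l ! (i mod length l)"
proof -
  have "map (cycle_of_list l ^^ i) l ! 0 = rotate i l ! 0"
    using cyclic_rotation[OF assms(1), of i] by simp
  then show ?thesis using assms by (simp add: nth_rotate)
qed

lemma cycle_word_cycle_of_list:
  assumes "distinct l" "length l = N" "N > 0" "l ! 0 = 0"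
  shows "cycle_word N (cycle_of_list l) = l"
proof (rule nth_equalityI)
  fix i assume "i < length (cycle_word N (cycle_of_list l))"
  then have "i < N" by (simp add: cycle_word_def)
  then show "cycle_word N (cycle_of_list l) ! i = l ! i"
    using funpow_cycle_of_list_nth[of l i] assms by (cases "l = []") (auto simp: cycle_word_def)
qed (use assms in \<open>simp add: cycle_word_def\<close>)

lemma cyclic_permutation_cycle_of_list:
  assumes "distinct l" "set l = {..<N}" "N > 0"
  shows "cyclic_permutation N (cycle_of_list l)"
proof -
  have len: "length l = N" using assms distinct_card[of l] by simp
  have mem: "l ! 0 \<in> {..<N}" using assms len by (metis nth_mem)
  have "{..<N} = orbit (cycle_of_list l) (l ! 0)"
  proof (intro set_eqI iffI)
    fix y assume "y \<in> {..<N}"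
    then obtain i where i: "i < N" "y = l ! i" using assms(2) len by (metis in_set_conv_nth)
    have ne: "l \<noteq> []" using assms(3) len by auto
    \<comment> \<open>\<open>orbit\<close> contains only strictly positive iterates; the extra full
      turn \<open>N\<close> covers \<open>i = 0\<close>.\<close>
    have "(cycle_of_list l ^^ (i + N)) (l ! 0) = y"
      using funpow_cycle_of_list_nth[OF assms(1) ne, of "i + N"] i len by simp
    then show "y \<in> orbit (cycle_of_list l) (l ! 0)"
      unfolding orbit_altdef using \<open>N > 0\<close> by (intro CollectI exI[of _ "i + N"]) simp
  next
    fix y assume "y \<in> orbit (cycle_of_list l) (l ! 0)"
    then obtain i where "y = (cycle_of_list l ^^ i) (l ! 0)" unfolding orbit_altdef by auto
    moreover have ne: "l \<noteq> []" using assms(3) len by auto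
    ultimately have "y = l ! (i mod length l)" using funpow_cycle_of_list_nth[OF assms(1)] by simp
    then have "y \<in> set l" using len assms(3) by simp
    then show "y \<in> {..<N}" using assms(2) by simp
  qed
  then show ?thesis unfolding cyclic_permutation_def cyclic_on_def
    using cycle_permutes[of l] assms(2) mem by auto
qed

lemma cycle_word_cyclic_permutation:
  assumes "cyclic_permutation n \<sigma>" "n > 0"
  shows "distinct (cycle_word n \<sigma>)" "set (cycle_word n \<sigma>) = {..<n}"
    "cycle_word n \<sigma> ! 0 = 0" "cycle_of_list (cycle_word n \<sigma>) = \<sigma>"
proof -
  have perm: "\<sigma> permutes {..<n}" and cyc: "cyclic_on \<sigma> {..<n}"
    using assms by (auto simp: cyclic_permutation_def)
  have orb: "orbit \<sigma> 0 = {..<n}" using orbit_cyclic_eq3[OF cyc] assms(2) by simp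
  \<comment> \<open>The return time of 0 counts its orbit, because the iterates before the first
    return are distinct.\<close>
  have dist: "funpow_dist1 \<sigma> 0 0 = n"
    using orbit_conv_funpow_dist1[of 0 \<sigma>] orb assms(2) inj_on_funpow_dist1[of 0 \<sigma>]
    by (metis card_atLeastLessThan card_image card_lessThan diff_zero lessThan_iff)
  have "{..<n} = (\<lambda>i. (\<sigma> ^^ i) 0) ` {0..<n}"
    using orbit_conv_funpow_dist1[of 0 \<sigma>] orb assms(2) dist by simp
  then show s: "set (cycle_word n \<sigma>) = {..<n}" by (simp add: cycle_word_def)
  then show d: "distinct (cycle_word n \<sigma>)"
    by (metis card_distinct card_lessThan cycle_word_def diff_zero length_map length_upt)
  show z: "cycle_word n \<sigma> ! 0 = 0" using assms(2) by (simp add: cycle_word_def)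
  have len: "length (cycle_word n \<sigma>) = n" by (simp add: cycle_word_def)
  have sn: "(\<sigma> ^^ n) 0 = 0"
    using funpow_dist1_prop[of 0 \<sigma> 0] orb assms(2) dist by simp
  show "cycle_of_list (cycle_word n \<sigma>) = \<sigma>"
  proof
    fix x
    show "cycle_of_list (cycle_word n \<sigma>) x = \<sigma> x"
    proof (cases "x < n")
      case True
      then obtain i where i: "i < n" "x = cycle_word n \<sigma> ! i"
        using s len by (metis in_set_conv_nth lessThan_iff)
      let ?c = "cycle_of_list (cycle_word n \<sigma>)"
      have ne: "cycle_word n \<sigma> \<noteq> []" using len assms(2) by auto
      note p = funpow_cycle_of_list_nth[OF d ne]
      have "?c x = (?c ^^ Suc i) (cycle_word n \<sigma> ! 0)"
        using p[of i] i len by simp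
      also have "\<dots> = cycle_word n \<sigma> ! (Suc i mod n)" using p[of "Suc i"] len by simp
      also have "\<dots> = (\<sigma> ^^ (Suc i mod n)) 0"
        using assms(2) by (simp add: cycle_word_def)
      also have "\<dots> = (\<sigma> ^^ Suc i) 0"
        using i sn by (cases "Suc i = n") auto
      also have "\<dots> = \<sigma> x" using i by (simp add: cycle_word_def)
      finally show ?thesis .
    next
      case False
      then show ?thesis using perm s id_outside_supp[of x "cycle_word n \<sigma>"]
        by (auto simp: permutes_def)
    qed
  qed
qed

text \<open>\<open>cycle_word\<close> starts at 0, whereas the ranks of the marked letters in a
  meandric word may start anywhere; this supplies the rotation between the two listings.\<close>

lemma rotate_cycle_word:
  assumes "distinct l" "set l = {..<n}" "n > 0"
  obtains r where "rotate r (cycle_word n (cycle_of_list l)) = l"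
proof -
  have len: "length l = n" using assms distinct_card[of l] by simp
  obtain j where j: "j < n" "l ! j = 0" using assms(2,3) len
    by (metis in_set_conv_nth lessThan_iff)
  have "cycle_word n (cycle_of_list (rotate j l)) = rotate j l"
    using assms j len by (intro cycle_word_cycle_of_list) (auto simp: nth_rotate)
  then have "rotate (n - j) (cycle_word n (cycle_of_list l)) = rotate (n - j + j) l"
    using cycle_of_list_rotate_independent[OF assms(1), of j] by (simp add: rotate_rotate)
  then have "rotate (n - j) (cycle_word n (cycle_of_list l)) = l"
    using j len by (simp add: rotate_id)
  then show ?thesis using that by blast
qed

text \<open>Lists turn the iterates at 0 into entries, and the closing pair of the second matching
  becomes an explicit \<open>mod N\<close>. The condition \<open>w ! 0 = 0\<close> matches the
  normalisation of \<open>cycle_word\<close>, so that \<open>cycle_of_list\<close> and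
  \<open>cycle_word\<close> translate in both directions.\<close>

definition meandric_word :: "nat \<Rightarrow> nat list \<Rightarrow> bool" where
  "meandric_word N w \<longleftrightarrow> even N \<and> N > 0 \<and> distinct w \<and> set w = {..<N} \<and> w ! 0 = 0 \<and>
     non_crossing {{w ! (2 * i), w ! (2 * i + 1)} |i. i < N div 2} \<and>
     non_crossing {{w ! (2 * i + 1), w ! ((2 * i + 2) mod N)} |i. i < N div 2}"

lemma cyclic_meandric_cycle_of_list:
  assumes "meandric_word N w"
  shows "cyclic_meandric N (cycle_of_list w)" "cycle_word N (cycle_of_list w) = w"
proof -
  let ?c = "cycle_of_list w"
  have w: "even N" "N > 0" "distinct w" "set w = {..<N}" "w ! 0 = 0"
    using assms by (auto simp: meandric_word_def)
  have len: "length w = N" using w distinct_card[of w] by simp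
  then have ne: "w \<noteq> []" using w by auto
  have p: "(?c ^^ i) 0 = w ! (i mod N)" for i
    using funpow_cycle_of_list_nth[OF w(3) ne, of i] w(5) len by simp
  have e1: "{{(?c ^^ (2 * i)) 0, (?c ^^ (2 * i + 1)) 0} |i. i < N div 2} =
        {{w ! (2 * i), w ! (2 * i + 1)} |i. i < N div 2}"
    unfolding p using w(1) by (intro Collect_cong ex_cong1 rev_conj_cong refl) (auto elim!: evenE)
  have e2: "{{(?c ^^ (2 * i + 1)) 0, (?c ^^ (2 * i + 2)) 0} |i. i < N div 2} =
        {{w ! (2 * i + 1), w ! ((2 * i + 2) mod N)} |i. i < N div 2}"
    unfolding p using w(1) by (intro Collect_cong ex_cong1 rev_conj_cong refl) (auto elim!: evenE)
  show "cyclic_meandric N ?c"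
    unfolding cyclic_meandric_def e1 e2
    using assms cyclic_permutation_cycle_of_list[of w N] by (auto simp: meandric_word_def)
  show "cycle_word N ?c = w" using cycle_word_cycle_of_list[of w N] w len by simp
qed

lemma meandric_word_cycle_word:
  assumes "cyclic_meandric N \<tau>"
  shows "meandric_word N (cycle_word N \<tau>)"
proof -
  have m: "even N" "N > 0" "cyclic_permutation N \<tau>" using assms by (auto simp: cyclic_meandric_def)
  note c = cycle_word_cyclic_permutation[OF m(3,2)]
  have len: "length (cycle_word N \<tau>) = N" by (simp add: cycle_word_def)
  then have ne: "cycle_word N \<tau> \<noteq> []" using m by auto
  have p: "(\<tau> ^^ i) 0 = cycle_word N \<tau> ! (i mod N)" for i
    using funpow_cycle_of_list_nth[OF c(1) ne, of i] c(3,4) len by simp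
  have e1: "{{(\<tau> ^^ (2 * i)) 0, (\<tau> ^^ (2 * i + 1)) 0} |i. i < N div 2} =
        {{cycle_word N \<tau> ! (2 * i), cycle_word N \<tau> ! (2 * i + 1)} |i. i < N div 2}"
    unfolding p using m(1) by (intro Collect_cong ex_cong1 rev_conj_cong refl) (auto elim!: evenE)
  have e2: "{{(\<tau> ^^ (2 * i + 1)) 0, (\<tau> ^^ (2 * i + 2)) 0} |i. i < N div 2} =
        {{cycle_word N \<tau> ! (2 * i + 1), cycle_word N \<tau> ! ((2 * i + 2) mod N)} |i. i < N div 2}"
    unfolding p using m(1) by (intro Collect_cong ex_cong1 rev_conj_cong refl) (auto elim!: evenE)
  show ?thesis using assms c unfolding meandric_word_def cyclic_meandric_def e1 e2 by auto
qed

section \<open>Every cyclic permutation is a first return\<close>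

text \<open>\<open>p\<close> is a position along B: its row is \<open>p div m\<close>, and odd rows
  run through the columns backwards. \<open>snake m p\<close> is the position of the same crossing
  along A, which runs through the odd columns backwards.\<close>

definition snake_col :: "nat \<Rightarrow> nat \<Rightarrow> nat" where
  "snake_col m p = (if even (p div m) then p mod m else m - 1 - p mod m)"

definition snake :: "nat \<Rightarrow> nat \<Rightarrow> nat" where
  "snake m p = snake_col m p * m + (if even (snake_col m p) then p div m else m - 1 - p div m)"

text \<open>The pairs that occur in the two matchings of the snake word: arcs between two adjacent columns,
  nested around their common boundary; arcs from one row to the next; and the arc that closes the loop.\<close>

definition nested_pair :: "nat \<Rightarrow> nat \<Rightarrow> nat \<Rightarrow> nat \<Rightarrow> bool" where
  "nested_pair m c x y \<longleftrightarrow>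
     (\<exists>j. j mod 2 = c \<and> j * m \<le> x \<and> j * m \<le> y \<and> x < (j + 2) * m \<and> y < (j + 2) * m \<and>
          x + y + 1 = (2 * j + 2) * m) \<or>
     x = Suc y \<or> y = Suc x \<or> c = 1 \<and> (x = 0 \<and> y = m - 1 \<or> x = m - 1 \<and> y = 0)"

lemma nested_pair_commute: "nested_pair m c x y \<longleftrightarrow> nested_pair m c y x"
  unfolding nested_pair_def by (auto simp: add.commute)

text \<open>Two-column blocks starting at \<open>j * m\<close> and \<open>i * m\<close> with
  \<open>i\<close>, \<open>j\<close> of one parity are equal or disjoint, and within a block the
  equal sums force nesting. Neighbouring labels leave no room between them. The closing pair spans
  the labels below \<open>m\<close>, hence below every block with odd \<open>j\<close>.\<close>

lemma non_crossing_nested_pairs: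
  assumes "\<And>e. e \<in> M \<Longrightarrow> \<exists>x y. e = {x, y} \<and> nested_pair m c x y"
  shows "non_crossing M"
  unfolding non_crossing_def
proof (intro notI, elim exE conjE)
  fix a1 b1 a2 b2 assume e: "{a1, b1} \<in> M" "{a2, b2} \<in> M" and lt: "a1 < a2" "a2 < b1" "b1 < b2"
  have n1: "nested_pair m c a1 b1"
    using assms[OF e(1)] nested_pair_commute by (auto simp: doubleton_eq_iff)
  have n2: "nested_pair m c a2 b2"
    using assms[OF e(2)] nested_pair_commute by (auto simp: doubleton_eq_iff)
  consider (a) j where "j mod 2 = c" "j * m \<le> a1" "b1 < (j + 2) * m" "a1 + b1 + 1 = (2 * j + 2) * m"
    | (b) "c = 1" "a1 = 0" "b1 = m - 1"
    using n1 lt unfolding nested_pair_def by auto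
  note c1 = this
  consider (a) j where "j mod 2 = c" "j * m \<le> a2" "b2 < (j + 2) * m" "a2 + b2 + 1 = (2 * j + 2) * m"
    using n2 lt unfolding nested_pair_def by auto
  then obtain j where j: "j mod 2 = c" "j * m \<le> a2" "b2 < (j + 2) * m" "a2 + b2 + 1 = (2 * j + 2) * m" .
  show False
  proof (cases rule: c1)
    case (a i)
    have "i = j \<or> i + 2 \<le> j \<or> j + 2 \<le> i" using a(1) j(1) by presburger
    then consider "i = j" | "i + 2 \<le> j" | "j + 2 \<le> i" by blast
    then show False
    proof cases
      case 1 then show False using a j lt by simp
    next
      case 2
      then have "(i + 2) * m \<le> j * m" by (rule mult_le_mono1)
      then show False using a j lt by linarith
    next
      case 3
      then have "(j + 2) * m \<le> i * m" by (rule mult_le_mono1)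
      then show False using a j lt by linarith
    qed
  next
    case b
    then have "1 \<le> j" using j(1) by presburger
    then have "m \<le> j * m" by simp
    then show False using b j(2) lt by linarith
  qed
qed

context
  fixes m :: nat assumes m: "even m" "m > 0"
begin

lemma snake_col_less: "snake_col m p < m"
  using m by (auto simp: snake_col_def)

lemma snake_div_mod:
  assumes "p < m * m"
  shows "snake m p div m = snake_col m p"
    "snake m p mod m = (if even (snake_col m p) then p div m else m - 1 - p div m)"
    "snake m p < m * m"
proof -
  have k: "p div m < m" using assms by (simp add: less_mult_imp_div_less)
  define r where "r = (if even (snake_col m p) then p div m else m - 1 - p div m)"
  have r: "r < m" using k by (auto simp: r_def)
  have s: "snake m p = snake_col m p * m + r" by (simp add: snake_def r_def)
  show "snake m p div m = snake_col m p" "snake m p mod m = (if even (snake_col m p) then p div m else m - 1 - p div m)"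
    using r unfolding s r_def[symmetric] by auto
  have "snake m p < (snake_col m p + 1) * m" using r by (simp add: s)
  also have "\<dots> \<le> m * m" using snake_col_less[of p] by (intro mult_le_mono1) simp
  finally show "snake m p < m * m" .
qed

lemma inj_on_snake: "inj_on (snake m) {..<m * m}"
proof (rule inj_onI)
  fix p q assume pq: "p \<in> {..<m * m}" "q \<in> {..<m * m}" and eq: "snake m p = snake m q"
  have k: "p div m < m" "q div m < m" using pq by (auto simp: less_mult_imp_div_less)
  have c: "snake_col m p = snake_col m q" using snake_div_mod(1) eq pq by (metis lessThan_iff)
  then have d: "p div m = q div m"
    using snake_div_mod(2)[of p] snake_div_mod(2)[of q] eq pq k
    by (cases "even (snake_col m p)") auto
  have flip: "a = b" if "a < m" "b < m" "m - 1 - a = m - 1 - b" for a b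
    using that by arith
  have "p mod m < m" "q mod m < m" using m by auto
  then have "p mod m = q mod m" using c d flip[of "p mod m" "q mod m"] unfolding snake_col_def
    by (cases "even (q div m)") simp_all
  then show "p = q" using d by (metis div_mult_mod_eq)
qed

text \<open>A step inside a row passes between adjacent columns, where A has turned round, so the
  offsets in the two columns add up to \<open>m - 1\<close>. A step between rows stays in an outer
  column and joins neighbouring labels; the closing step runs back along column 0. Since
  \<open>m\<close> is even, every row ends at an odd position, so these steps all fall into the
  second matching.\<close>

lemma nested_pair_snake:
  assumes "p < m * m"
  shows "nested_pair m (p mod 2) (snake m p) (snake m (Suc p mod (m * m)))"
proof -
  define k i where "k = p div m" and "i = p mod m"
  have p: "p = k * m + i" by (simp add: k_def i_def)
  have i: "i < m" using m by (simp add: i_def)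
  have k: "k < m" using assms by (simp add: k_def less_mult_imp_div_less)
  have par: "p mod 2 = i mod 2" using m(1) unfolding p by (simp add: mod2_eq_if)
  show ?thesis
  proof (cases "Suc i < m")
    case True
    have sp: "Suc p div m = k" "Suc p mod m = Suc i"
      using True unfolding p by (auto simp flip: add_Suc_right)
    have "Suc p < (k + 1) * m" using True p by simp
    also have "\<dots> \<le> m * m" using k by (intro mult_le_mono1) simp
    finally have spm: "Suc p mod (m * m) = Suc p" by simp
    \<comment> \<open>\<open>j\<close> is the left one of the two columns, in either direction of
      travel.\<close>
    define j where "j = (if even k then i else m - 2 - i)"
    have jm: "Suc j < m" using True m by (auto simp: j_def)
    have jpar: "j mod 2 = i mod 2" 
    proof -
      obtain b where b: "m = 2 * b" using m(1) by (elim evenE)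
      have "even (2 * b - 2 - i) = even i" using True b by simp
      then show ?thesis unfolding j_def b by (simp add: mod2_eq_if)
    qed
    have cols: "snake_col m p = (if even k then j else Suc j)" "snake_col m (Suc p) = (if even k then Suc j else j)"
      using True unfolding snake_col_def sp k_def[symmetric] i_def[symmetric] j_def by auto
    define u where "u = (if even j then k else m - 1 - k)"
    have u: "u < m" using k by (auto simp: u_def)
    have vals: "snake m p = (if even k then j * m + u else Suc j * m + (m - 1 - u))"
        "snake m (Suc p) = (if even k then Suc j * m + (m - 1 - u) else j * m + u)"
      using k unfolding snake_def cols sp k_def[symmetric] u_def by auto
    have "snake m p + snake m (Suc p) + 1 = (2 * j + 2) * m"
      using u m unfolding vals by (auto simp: algebra_simps)
    moreover have "j * m \<le> snake m p" "j * m \<le> snake m (Suc p)"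
      "snake m p < (j + 2) * m" "snake m (Suc p) < (j + 2) * m"
      using u m unfolding vals by (auto simp: algebra_simps)
    ultimately show ?thesis unfolding nested_pair_def spm using jpar par by auto
  next
    case False
    then have im: "i = m - 1" using i by simp
    have odd: "p mod 2 = 1" using par im m by (simp add: mod2_eq_if)
    have c0: "snake_col m p = (if even k then m - 1 else 0)"
      unfolding snake_col_def k_def[symmetric] i_def[symmetric] im by simp
    show ?thesis
    proof (cases "Suc k < m")
      case True
      have spe: "Suc p = Suc k * m" using p im m by simp
      have sp: "Suc p div m = Suc k" "Suc p mod m = 0" unfolding spe using m by auto
      have "Suc k * m < m * m" using mult_less_mono1[OF True m(2)] .
      then have spm: "Suc p mod (m * m) = Suc p" using spe by simp
      have c1: "snake_col m (Suc p) = (if even k then m - 1 else 0)"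
        unfolding snake_col_def sp by simp
      have "odd (m - 1)" using m by simp
      then show ?thesis unfolding nested_pair_def spm using True
        by (auto simp: snake_def c0 c1 sp k_def[symmetric])
    next
      case False
      then have km: "k = m - 1" using k by simp
      have "Suc p = m * m" using p im km m by (cases m) (auto simp: algebra_simps)
      then have spm: "Suc p mod (m * m) = 0" by simp
      \<comment> \<open>The last row is odd and hence ends in column 0, where A starts.\<close>
      have ok: "odd k" using km m by simp
      have "snake m p = m - 1" using ok km by (simp add: snake_def c0 k_def[symmetric])
      moreover have "snake m 0 = 0" by (simp add: snake_def snake_col_def)
      ultimately show ?thesis unfolding nested_pair_def spm odd by auto
    qed
  qed
qed

lemma meandric_word_snake: "meandric_word (m * m) (map (snake m) [0..<m * m])"
  unfolding meandric_word_def
proof (intro conjI)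
  have inj: "inj_on (snake m) {0..<m * m}" using inj_on_snake by (simp add: lessThan_atLeast0)
  then show "distinct (map (snake m) [0..<m * m])" by (simp add: distinct_map)
  have "snake m ` {..<m * m} = {..<m * m}"
    using inj_on_snake snake_div_mod(3) by (intro endo_inj_surj) auto
  then show "set (map (snake m) [0..<m * m]) = {..<m * m}" by (simp add: lessThan_atLeast0)
  show "map (snake m) [0..<m * m] ! 0 = 0" using m by (simp add: snake_def snake_col_def)
  show ev: "even (m * m)" "m * m > 0" using m by auto
  have half: "2 * i < m * m" "2 * i + 1 < m * m" if "i < m * m div 2" for i
    using that ev by (auto elim!: evenE)
  show "non_crossing {{map (snake m) [0..<m * m] ! (2 * i), map (snake m) [0..<m * m] ! (2 * i + 1)} |i. i < m * m div 2}"
  proof (rule non_crossing_nested_pairs[where m = m and c = 0], elim CollectE exE conjE)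
    fix e i assume e: "e = {map (snake m) [0..<m * m] ! (2 * i), map (snake m) [0..<m * m] ! (2 * i + 1)}" "i < m * m div 2"
    show "\<exists>x y. e = {x, y} \<and> nested_pair m 0 x y"
      using nested_pair_snake[of "2 * i"] half[OF e(2)] e(1) by auto
  qed
  show "non_crossing {{map (snake m) [0..<m * m] ! (2 * i + 1), map (snake m) [0..<m * m] ! ((2 * i + 2) mod (m * m))} |i. i < m * m div 2}"
  proof (rule non_crossing_nested_pairs[where m = m and c = 1], elim CollectE exE conjE)
    fix e i assume e: "e = {map (snake m) [0..<m * m] ! (2 * i + 1), map (snake m) [0..<m * m] ! ((2 * i + 2) mod (m * m))}" "i < m * m div 2"
    have "(2 * i + 2) mod (m * m) < m * m" using ev by simp
    then show "\<exists>x y. e = {x, y} \<and> nested_pair m 1 x y"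
      using nested_pair_snake[of "2 * i + 1"] half[OF e(2)] e(1) by auto
  qed
qed

end

text \<open>Reduces reading off a first-return word to listing the times of the marked letters in
  increasing order.\<close>

lemma filter_upt_sorted_wrt:
  assumes "sorted_wrt (<) xs" "set xs = {i. i < (N::nat) \<and> P i}"
  shows "filter P [0..<N] = xs"
proof (rule sorted_distinct_set_unique)
  show "sorted xs" "distinct xs" using assms strict_sorted_iff by auto
  show "sorted (filter P [0..<N])" using sorted_filter[of id "[0..<N]" P] by simp
qed (use assms in auto)

text \<open>In row \<open>k\<close> the cell in column \<open>v ! k\<close> is marked. B visits the
  rows in order and A the columns in order, and every column below \<open>n\<close> carries exactly
  one mark, so the ranks along A, read along B, are \<open>v ! 0\<close>, \<open>v ! 1\<close>, and
  so on.\<close>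

lemma exists_meandric_first_return:
  assumes "cyclic_permutation n \<sigma>" "n > 0"
  shows "\<exists>N \<tau> S. cyclic_meandric N \<tau> \<and> S \<subseteq> {..<N} \<and> card S = n \<and> first_return N \<tau> S = \<sigma>"
proof -
  \<comment> \<open>An even side with room for \<open>n\<close> rows and \<open>n\<close>
    columns.\<close>
  define m where "m = 2 * n"
  have m: "even m" "m > 0" "n \<le> m" using assms by (auto simp: m_def)
  define w where "w = map (snake m) [0..<m * m]"
  define v where "v = cycle_word n \<sigma>"
  have mw: "meandric_word (m * m) w" unfolding w_def using meandric_word_snake m by blast
  note v = cycle_word_cyclic_permutation[OF assms, folded v_def]
  have lv: "length v = n" by (simp add: v_def cycle_word_def)
  have vi: "v ! k < n" if "k < n" for k using v(2) lv that by (metis lessThan_iff nth_mem)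
  \<comment> \<open>The time at which B is in row \<open>k\<close> and column
    \<open>v ! k\<close>.\<close>
  define idx where "idx k = k * m + (if even k then v ! k else m - 1 - v ! k)" for k
  have idx: "idx k div m = k" "idx k < m * m" "snake_col m (idx k) = v ! k"
     "k * m \<le> idx k" "idx k < (k + 1) * m" if "k < n" for k
  proof -
    have r: "(if even k then v ! k else m - 1 - v ! k) < m" using vi[OF that] m by auto
    then show d: "idx k div m = k" unfolding idx_def by simp
    show l: "k * m \<le> idx k" "idx k < (k + 1) * m" using r by (auto simp: idx_def)
    have "(k + 1) * m \<le> m * m" using that m by (intro mult_le_mono1) simp
    then show "idx k < m * m" using l by linarith
    have mo: "idx k mod m = (if even k then v ! k else m - 1 - v ! k)" unfolding idx_def using r by simp
    show "snake_col m (idx k) = v ! k" unfolding snake_col_def d mo using vi[OF that] m by auto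
  qed
  define S where "S = (\<lambda>k. snake m (idx k)) ` {..<n}"
  have sub: "S \<subseteq> {..<m * m}" using snake_div_mod(3) m idx by (auto simp: S_def)
  have col: "snake m (idx k) div m = v ! k" if "k < n" for k
    using snake_div_mod(1)[of m "idx k"] m idx that by simp
  have inj: "inj_on (\<lambda>k. snake m (idx k)) {..<n}"
    by (rule inj_onI) (metis col lessThan_iff lv nth_eq_iff_index_eq v(1))
  \<comment> \<open>Labels in different columns compare as the columns do, so the rank counts the
    smaller entries of \<open>v\<close>, a listing of all numbers below \<open>n\<close>.\<close>
  have rank: "card {y \<in> S. y < snake m (idx k)} = v ! k" if k: "k < n" for k
  proof -
    have less: "snake m (idx l) < snake m (idx k) \<longleftrightarrow> v ! l < v ! k" if l: "l < n" for l
      using col[OF k] col[OF l] v(1) lv k l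
      by (metis div_le_mono linorder_not_less nat_less_le nth_eq_iff_index_eq)
    have "{y \<in> S. y < snake m (idx k)} = (\<lambda>k. snake m (idx k)) ` {l. l < n \<and> v ! l < v ! k}"
      unfolding S_def using less by auto
    then have "card {y \<in> S. y < snake m (idx k)} = card {l. l < n \<and> v ! l < v ! k}"
      using inj by (metis (no_types, lifting) card_image inj_on_subset lessThan_iff mem_Collect_eq subsetI)
    also have "\<dots> = card ((!) v ` {l. l < n \<and> v ! l < v ! k})"
      using v(1) lv by (intro card_image[symmetric]) (auto simp: inj_on_def nth_eq_iff_index_eq)
    also have "(!) v ` {l. l < n \<and> v ! l < v ! k} = {..<v ! k}"
    proof
      show "{..<v ! k} \<subseteq> (!) v ` {l. l < n \<and> v ! l < v ! k}"
      proof
        fix y assume y: "y \<in> {..<v ! k}"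
        then have "y \<in> set v" using v(2) vi[OF k] by auto
        then show "y \<in> (!) v ` {l. l < n \<and> v ! l < v ! k}" using y lv by (auto simp: in_set_conv_nth)
      qed
    qed auto
    finally show ?thesis by simp
  qed
  have "sorted_wrt (<) (map idx [0..<n])"
  proof -
    have "idx i < idx j" if "i < j" "j < n" for i j
    proof -
      have "idx i < (i + 1) * m" using idx that by simp
      also have "\<dots> \<le> j * m" using that by (intro mult_le_mono1) simp
      also have "\<dots> \<le> idx j" using idx that by simp
      finally show ?thesis .
    qed
    then show ?thesis by (auto simp: sorted_wrt_iff_nth_less)
  qed
  moreover have "set (map idx [0..<n]) = {p. p < m * m \<and> snake m p \<in> S}"
  proof -
    have "p \<in> idx ` {..<n}" if "p < m * m" "snake m p \<in> S" for p
    proof -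
      obtain k where k: "k < n" "snake m p = snake m (idx k)" using \<open>snake m p \<in> S\<close> by (auto simp: S_def)
      then have "p = idx k" using inj_onD[OF inj_on_snake[OF m(1,2)]] that(1) idx(2) by simp
      then show ?thesis using k(1) by simp
    qed
    then show ?thesis using idx by (auto simp: S_def lessThan_atLeast0)
  qed
  ultimately have "filter (\<lambda>p. snake m p \<in> S) [0..<m * m] = map idx [0..<n]"
    by (rule filter_upt_sorted_wrt)
  then have "filter (\<lambda>x. x \<in> S) w = map (snake m) (map idx [0..<n])"
    by (simp add: w_def filter_map o_def)
  then have "map (\<lambda>x. card {y \<in> S. y < x}) (filter (\<lambda>x. x \<in> S) w) = v"
    using rank lv by (intro nth_equalityI) auto
  then have "first_return (m * m) (cycle_of_list w) S = \<sigma>"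
    unfolding first_return_def using cyclic_meandric_cycle_of_list(2)[OF mw] v(4) by simp
  moreover have "card S = n" unfolding S_def using inj by (simp add: card_image)
  ultimately show ?thesis using cyclic_meandric_cycle_of_list(1)[OF mw] sub by blast
qed

section \<open>Sides of a Jordan curve on the sphere\<close>

text \<open>The chord cuts the inside into two regions, each bounded by the chord and one arc of
  \<open>c\<close>. A connected \<open>T\<close> off the chord lies in one region, whose closure
  does not reach the interior points of the other arc.\<close>

lemma inside_chord_separates:
  fixes c d :: "real \<Rightarrow> complex"
  assumes c: "simple_path c" "pathfinish c = pathstart c"
    and v: "0 < v" "v < 1"
    and d: "simple_path d" "pathstart d = c 0" "pathfinish d = c v"
      "path_image d - {c 0, c v} \<subseteq> inside (path_image c)"
    and T: "connected T" "T \<subseteq> inside (path_image c)" "T \<inter> path_image d = {}"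
    and w: "0 < w" "w < v" "v < w'" "w' < 1" "c w \<in> closure T" "c w' \<in> closure T"
  shows False
proof -
  have c01: "c 1 = c 0" using c(2) by (simp add: pathfinish_def pathstart_def)
  have inj: "x = y \<or> x = 0 \<and> y = 1 \<or> x = 1 \<and> y = 0" if "c x = c y" "x \<in> {0..1}" "y \<in> {0..1}" for x y
    using c(1) that unfolding simple_path_def loop_free_def by blast
  have ne: "c 0 \<noteq> c v" using inj[of 0 v] v by auto
  define c1 where "c1 = subpath 0 v c"
  \<comment> \<open>Reversed, so that \<open>c1\<close>, \<open>c2\<close> and \<open>d\<close> form
    a theta curve with common start and common finish.\<close>
  define c2 where "c2 = reversepath (subpath v 1 c)"
  have i1: "path_image c1 = c ` {0..v}" using v by (simp add: c1_def path_image_subpath)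
  have i2: "path_image c2 = c ` {v..1}" using v by (simp add: c2_def path_image_subpath)
  have un: "path_image c1 \<union> path_image c2 = path_image c"
  proof -
    have "{0..v} \<union> {v..1} = {0..1}" using v by auto
    then show ?thesis unfolding i1 i2 image_Un[symmetric] by (simp add: path_image_def)
  qed
  have s1: "simple_path c1" using v c(1) by (simp add: c1_def simple_path_subpath)
  have s2: "simple_path c2" using v c(1) by (simp add: c2_def simple_path_reversepath simple_path_subpath)
  have e1: "pathstart c1 = c 0" "pathfinish c1 = c v" by (simp_all add: c1_def)
  have e2: "pathstart c2 = c 0" "pathfinish c2 = c v" by (simp_all add: c2_def c01)
  have c1c2: "path_image c1 \<inter> path_image c2 = {c 0, c v}"
  proof
    show "path_image c1 \<inter> path_image c2 \<subseteq> {c 0, c v}"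
    proof
      fix z assume "z \<in> path_image c1 \<inter> path_image c2"
      then have "z \<in> c ` {0..v}" "z \<in> c ` {v..1}" unfolding i1 i2 by auto
      then obtain x y where xy: "z = c x" "z = c y" "x \<in> {0..v}" "y \<in> {v..1}" by blast
      then show "z \<in> {c 0, c v}" using inj[of x y] v c01 by auto
    qed
    show "{c 0, c v} \<subseteq> path_image c1 \<inter> path_image c2"
      using e1 e2 by (metis Int_iff empty_subsetI insert_subset pathfinish_in_path_image pathstart_in_path_image)
  qed
  have dends: "c 0 \<in> path_image d" "c v \<in> path_image d"
    using d(2,3) pathstart_in_path_image[of d] pathfinish_in_path_image[of d] by auto
  have dc: "path_image d \<inter> path_image c = {c 0, c v}"
  proof -
    have "inside (path_image c) \<inter> path_image c = {}" by (rule inside_no_overlap)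
    moreover have "{c 0, c v} \<subseteq> path_image c" using c1c2 un by blast
    ultimately show ?thesis using d(4) dends by blast
  qed
  have c1d: "path_image c1 \<inter> path_image d = {c 0, c v}" and c2d: "path_image c2 \<inter> path_image d = {c 0, c v}"
    using dc c1c2 un dends by blast+
  have injd: "x = y \<or> x = 0 \<and> y = 1 \<or> x = 1 \<and> y = 0" if "d x = d y" "x \<in> {0..1}" "y \<in> {0..1}" for x y
    using d(1) that unfolding simple_path_def loop_free_def by blast
  \<comment> \<open>An interior point of the chord, as witness that the chord passes through the
    inside.\<close>
  have "d (1/2) \<noteq> d 0" "d (1/2) \<noteq> d 1" using injd[of "1/2" 0] injd[of "1/2" 1] by auto
  then have "d (1/2) \<in> path_image d - {c 0, c v}"
    using d(2,3) by (auto simp: path_image_def pathstart_def pathfinish_def)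
  then have ne12: "path_image d \<inter> inside (path_image c1 \<union> path_image c2) \<noteq> {}"
    using d(4) un by auto
  have cl: "closed (path_image c1 \<union> path_image d)" "closed (path_image c2 \<union> path_image d)"
    using s1 s2 d(1) by (auto intro!: closed_Un closed_path_image simple_path_imp_path)
  define I1 where "I1 = inside (path_image c1 \<union> path_image d)"
  define I2 where "I2 = inside (path_image c2 \<union> path_image d)"
  have disj: "I1 \<inter> I2 = {}" and split: "I1 \<union> I2 \<union> (path_image d - {c 0, c v}) = inside (path_image c)"
    using split_inside_simple_closed_curve[OF s1 e1 s2 e2 d(1-3) ne c1c2 c1d c2d ne12]
    unfolding I1_def I2_def un by blast+
  have op: "open I1" "open I2" using cl by (simp_all add: I1_def I2_def open_inside)
  have off: "I1 \<inter> path_image c = {}" "I2 \<inter> path_image c = {}"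
    using split inside_no_overlap[of "path_image c"] by blast+
  have cT: "closure T \<subseteq> path_image c1 \<union> path_image d \<union> I1" if "T \<subseteq> I1"
    using closure_mono[OF that] closure_inside_subset[OF cl(1)] unfolding I1_def by (rule order_trans)
  have cT': "closure T \<subseteq> path_image c2 \<union> path_image d \<union> I2" if "T \<subseteq> I2"
    using closure_mono[OF that] closure_inside_subset[OF cl(2)] unfolding I2_def by (rule order_trans)
  have cw: "c w \<in> path_image c" "c w \<notin> path_image d" "c w' \<in> path_image c" "c w' \<notin> path_image d"
  proof -
    show pc: "c w \<in> path_image c" "c w' \<in> path_image c" using w v by (auto simp: path_image_def)
    have "c w \<noteq> c 0" "c w \<noteq> c v" "c w' \<noteq> c 0" "c w' \<noteq> c v"
      using inj[of w 0] inj[of w v] inj[of w' 0] inj[of w' v] w v by auto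
    then show "c w \<notin> path_image d" "c w' \<notin> path_image d" using pc dc by blast+
  qed
  have n2: "c w \<notin> path_image c2"
  proof
    assume "c w \<in> path_image c2"
    then obtain y where "y \<in> {v..1}" "c w = c y" unfolding i2 by blast
    then show False using inj[of w y] w v by auto
  qed
  have n1: "c w' \<notin> path_image c1"
  proof
    assume "c w' \<in> path_image c1"
    then obtain y where "y \<in> {0..v}" "c w' = c y" unfolding i1 by blast
    then show False using inj[of w' y] w v by auto
  qed
  have "T \<subseteq> I1 \<union> I2" using T(2,3) unfolding split[symmetric] by blast
  then have "I1 \<inter> T = {} \<or> I2 \<inter> T = {}" using connectedD[OF T(1) op] disj by blast
  then have "T \<subseteq> I2 \<or> T \<subseteq> I1" using \<open>T \<subseteq> I1 \<union> I2\<close> by blast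
  then show False
  proof
    assume "T \<subseteq> I1"
    then show False using cT w(6) cw n1 off by blast
  next
    assume "T \<subseteq> I2"
    then show False using cT' w(5) cw n2 off by blast
  qed
qed

text \<open>The form in which the planar separation reaches the sphere: \<open>T\<close> will be an
  open arc of B with ends \<open>a w\<close> and \<open>a w'\<close>, on the same side
  \<open>D\<close> as the chord. Parameters below 1 keep the base point from being counted
  twice.\<close>

definition chords_separate :: "(real \<Rightarrow> 'a::topological_space) \<Rightarrow> 'a set \<Rightarrow> bool" where
  "chords_separate a D \<longleftrightarrow>
     (\<forall>d T u v w w'. simple_path d \<longrightarrow> pathstart d = a u \<longrightarrow> pathfinish d = a v \<longrightarrow>
        path_image d - {a u, a v} \<subseteq> D \<longrightarrow> connected T \<longrightarrow> T \<subseteq> D \<longrightarrow> T \<inter> path_image d = {} \<longrightarrow>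
        0 \<le> u \<longrightarrow> u < w \<longrightarrow> w < v \<longrightarrow> v < w' \<longrightarrow> w' < 1 \<longrightarrow>
        \<not> (a w \<in> closure T \<and> a w' \<in> closure T))"

text \<open>Deleting the pole \<open>q\<close> leaves a plane; \<open>D\<close> is the image of the
  inside of the planar curve. The rest is the outside together with \<open>q\<close>, which is open
  because the closed inside is compact. Connectedness and chord separation are stated for
  \<open>D\<close> alone, so the other side calls for another pole.\<close>

lemma sphere_jordan_side:
  fixes a :: "real \<Rightarrow> real^3"
  assumes a: "simple_path a" "pathfinish a = pathstart a" "path_image a \<subseteq> sphere 0 1"
    and q: "q \<in> sphere 0 1" "q \<notin> path_image a"
  obtains D where "openin (top_of_set (sphere 0 1)) D"
    "openin (top_of_set (sphere 0 1)) (sphere 0 1 - path_image a - D)"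
    "D \<inter> path_image a = {}" "connected D" "D \<noteq> {}" "q \<notin> D"
    "path_image a \<subseteq> closure D" "path_image a \<subseteq> closure (sphere 0 1 - path_image a - D)"
    "chords_separate a D"
proof -
  let ?S = "sphere (0::real^3) 1"
  have "(?S - {q}) homeomorphic (UNIV :: complex set)"
    using q by (intro homeomorphic_punctured_sphere_affine) auto
  then obtain f g where fg: "homeomorphism (?S - {q}) (UNIV :: complex set) f g"
    by (auto simp: homeomorphic_def)
  note fgD = homeomorphism_apply1[OF fg] homeomorphism_apply2[OF fg] homeomorphism_cont1[OF fg] homeomorphism_cont2[OF fg]
  have gS: "g z \<in> ?S - {q}" for z using homeomorphism_image2[OF fg] by blast
  have pa: "path_image a \<subseteq> ?S - {q}" using a q by auto
  define c where "c = f \<circ> a"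
  have injf: "inj_on f (?S - {q})" using fgD(1) by (metis inj_on_inverseI)
  have ca: "simple_path c" unfolding c_def
    using a(1) pa fgD(3) injf by (intro simple_path_continuous_image) (auto intro: continuous_on_subset inj_on_subset)
  have cb: "pathfinish c = pathstart c" using a(2) by (simp add: c_def pathfinish_def pathstart_def)
  note J = Jordan_inside_outside[OF ca cb]
  have Ji: "inside (path_image c) \<noteq> {}" "open (inside (path_image c))" "connected (inside (path_image c))"
    "bounded (inside (path_image c))" "frontier (inside (path_image c)) = path_image c"
    "frontier (outside (path_image c)) = path_image c"
    "outside (path_image c) \<inter> (path_image c \<union> inside (path_image c)) = {}"
    using J by blast+
  have gsub: "continuous_on X g" for X using fgD(4) continuous_on_subset subset_UNIV by blast
  have ic: "path_image c = f ` path_image a" by (simp add: c_def path_image_compose)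
  have gic: "g ` path_image c = path_image a" using pa fgD(1) unfolding ic by force
  define D where "D = g ` inside (path_image c)"
  have injg: "g x = g y \<longleftrightarrow> x = y" for x y using fgD(2) by (metis UNIV_I)
  have Dmem: "x \<in> D \<longleftrightarrow> x \<in> ?S - {q} \<and> f x \<in> inside (path_image c)" for x
    using gS fgD(1,2) unfolding D_def by (auto simp: image_iff) metis
  have opS: "openin (top_of_set ?S) (?S - {q})" by (simp add: openin_delete)
  have "openin (top_of_set (?S - {q})) D"
    unfolding D_def using homeomorphism_imp_open_map[OF homeomorphism_symD[OF fg], of "inside (path_image c)"] Ji(2)
    by simp
  then have 1: "openin (top_of_set ?S) D" using openin_trans[OF _ opS] by blast
  have cl_in: "path_image c \<union> inside (path_image c) = closure (inside (path_image c))"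
    using closure_Un_frontier[of "inside (path_image c)"] unfolding Ji(5) by blast
  then have com: "compact (path_image c \<union> inside (path_image c))" using Ji(4) by (simp add: compact_closure)
  have eE: "?S - path_image a - D = ?S - g ` (path_image c \<union> inside (path_image c))"
    unfolding image_Un gic D_def by blast
  have "closed (g ` (path_image c \<union> inside (path_image c)))"
    using compact_continuous_image[OF gsub com] compact_imp_closed by blast
  then have "openin (top_of_set ?S) (?S \<inter> - g ` (path_image c \<union> inside (path_image c)))"
    by (intro openin_open_Int open_Compl)
  then have 2: "openin (top_of_set ?S) (?S - path_image a - D)"
    unfolding eE by (subst Diff_eq)
  have gdisj: "g ` X \<inter> g ` Y = {}" if "X \<inter> Y = {}" for X Y
  proof -
    have "inj g" using injg by (simp add: inj_def)
    then show ?thesis using image_Int[of g X Y] that by simp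
  qed
  have 3: "D \<inter> path_image a = {}"
    unfolding D_def gic[symmetric] by (rule gdisj[OF inside_no_overlap])
  have 4: "connected D" unfolding D_def using Ji(3) gsub by (intro connected_continuous_image)
  have 5: "D \<noteq> {}" "q \<notin> D" using Ji(1) Dmem unfolding D_def by blast+
  have cl: "g ` closure X \<subseteq> closure (g ` X)" for X
    by (rule image_closure_subset[OF gsub closed_closure closure_subset])
  have 6: "path_image a \<subseteq> closure D"
  proof -
    have "path_image c \<subseteq> closure (inside (path_image c))" using cl_in by blast
    then show ?thesis unfolding D_def gic[symmetric] using cl by blast
  qed
  have 7: "path_image a \<subseteq> closure (?S - path_image a - D)"
  proof -
    have "path_image c \<subseteq> closure (outside (path_image c))"
      using closure_Un_frontier[of "outside (path_image c)"] unfolding Ji(6) by blast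
    then have "path_image a \<subseteq> closure (g ` outside (path_image c))" unfolding gic[symmetric] using cl by blast
    moreover have "g ` outside (path_image c) \<subseteq> ?S - path_image a - D"
      unfolding eE using gdisj[OF Ji(7)] gS by blast
    ultimately show ?thesis using closure_mono by blast
  qed
  \<comment> \<open>\<open>f\<close> is continuous only on the punctured sphere, so closure points
    are transferred along sequences.\<close>
  have fcl: "f x \<in> closure (f ` T)" if x: "x \<in> closure T" "T \<subseteq> ?S - {q}" "x \<in> ?S - {q}" for x T
  proof -
    obtain X where X: "\<And>n. X n \<in> T" "X \<longlonglongrightarrow> x" using x(1) unfolding closure_sequential by blast
    have "(\<lambda>n. f (X n)) \<longlonglongrightarrow> f x"
      using X x by (intro continuous_on_tendsto_compose[OF fgD(3)]) (auto simp: subset_iff)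
    then show ?thesis unfolding closure_sequential using X(1)
      by (intro exI[of _ "\<lambda>n. f (X n)"]) simp
  qed
  have 8: False
    if d: "simple_path d" "pathstart d = a u" "pathfinish d = a v" "path_image d - {a u, a v} \<subseteq> D"
      and T: "connected T" "T \<subseteq> D" "T \<inter> path_image d = {}"
      and w: "0 \<le> u" "u < w" "w < v" "v < w'" "w' < 1" "a w \<in> closure T" "a w' \<in> closure T"
    for d T u w v w'
  proof -
    \<comment> \<open>Rebased at \<open>u\<close>, because the planar chord starts at parameter
      0.\<close>
    define c' where "c' = shiftpath u c"
    have u: "u \<in> {0..1}" using w by auto
    have c': "simple_path c'" "pathfinish c' = pathstart c'" "path_image c' = path_image c"
      unfolding c'_def using ca cb u w
      by (auto simp: simple_path_shiftpath path_image_shiftpath pathfinish_shiftpath pathstart_shiftpath)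
    have val: "c' (x - u) = f (a x)" if "x < 1" "u \<le> x" for x
      using that by (simp add: c'_def shiftpath_def c_def)
    have sub: "path_image d \<subseteq> ?S - {q}"
    proof -
      have "a u \<in> path_image a" "a v \<in> path_image a" using w by (auto simp: path_image_def)
      then show ?thesis using d(4) pa Dmem by blast
    qed
    have amem: "a x \<in> ?S - {q}" if "0 \<le> x" "x \<le> 1" for x
    proof -
      have "a x \<in> path_image a" using that by (auto simp: path_image_def)
      then show ?thesis using pa by blast
    qed
    have TS: "T \<subseteq> ?S - {q}" using T Dmem by blast
    show False
    proof (rule inside_chord_separates[OF c'(1,2), of "v - u" "f \<circ> d" "f ` T" "w - u" "w' - u"])
      show "simple_path (f \<circ> d)"
        by (rule simple_path_continuous_image[OF d(1) continuous_on_subset[OF fgD(3) sub] inj_on_subset[OF injf sub]])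
      show "pathstart (f \<circ> d) = c' 0" "pathfinish (f \<circ> d) = c' (v - u)"
        using d val[of u] val[of v] w by (simp_all add: pathstart_compose pathfinish_compose)
      have "path_image (f \<circ> d) - {f (a u), f (a v)} \<subseteq> f ` (path_image d - {a u, a v})"
        by (auto simp: path_image_compose)
      also have "\<dots> \<subseteq> inside (path_image c)" using d(4) Dmem by blast
      finally show "path_image (f \<circ> d) - {c' 0, c' (v - u)} \<subseteq> inside (path_image c')"
        using val[of u] val[of v] w unfolding c'(3) by simp
      show "connected (f ` T)" by (rule connected_continuous_image[OF continuous_on_subset[OF fgD(3) TS] T(1)])
      show "f ` T \<subseteq> inside (path_image c')" using T(2) Dmem unfolding c'(3) by blast
      show "f ` T \<inter> path_image (f \<circ> d) = {}"
        using T(3) inj_on_image_Int[OF injf TS sub] unfolding path_image_compose by simp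
      show "c' (w - u) \<in> closure (f ` T)" "c' (w' - u) \<in> closure (f ` T)"
        using val[of w] val[of w'] w fcl[OF _ TS amem] by simp_all
    qed (use w in auto)
  qed
  have "chords_separate a D" unfolding chords_separate_def using 8 by blast
  then show thesis by (rule that[OF 1 2 3 4 5 6 7])
qed

section \<open>Transverse crossings\<close>

lemma connected_subset_separation:
  assumes "connected T" "openin (top_of_set S) D" "openin (top_of_set S) E" "D \<inter> E = {}" "T \<subseteq> D \<union> E"
  shows "T \<subseteq> D \<or> T \<subseteq> E"
proof -
  obtain D' E' where o: "open D'" "D = S \<inter> D'" "open E'" "E = S \<inter> E'"
    using assms(2,3) by (auto simp: openin_open)
  have T: "T \<subseteq> S" "T \<subseteq> D' \<union> E'" using assms(5) o by blast+
  have "D' \<inter> E' \<inter> T = {}" using assms(4) o T by blast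
  then have "D' \<inter> T = {} \<or> E' \<inter> T = {}" using connectedD[OF assms(1) o(1,3)] T by blast
  then show ?thesis using T o by blast
qed

text \<open>In the chart, each of the two half-discs off A is connected and so lies on one side.
  Both sides accumulate at the crossing, hence the half-discs lie on different sides. B runs along
  the other axis; its coordinate is continuous and injective near \<open>t\<close>, thus monotone,
  and changes sign at \<open>t\<close>.\<close>

lemma transverse_crossing_sides:
  fixes A :: "(real^3) set"
  assumes tr: "transverse_at A (path_image b) (b t)"
    and b: "simple_path b" "path_image b \<subseteq> sphere 0 1" and t: "0 < t" "t < 1"
    and D: "openin (top_of_set (sphere 0 1)) D" "openin (top_of_set (sphere 0 1)) E"
      "D \<inter> E = {}" "D \<union> E = sphere 0 1 - A" "b t \<in> closure D" "b t \<in> closure E"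
  obtains e where "e > 0" "e \<le> t" "t + e \<le> 1"
    "b ` {t-e<..<t} \<subseteq> D \<and> b ` {t<..<t+e} \<subseteq> E \<or> b ` {t-e<..<t} \<subseteq> E \<and> b ` {t<..<t+e} \<subseteq> D"
proof -
  let ?S = "sphere (0::real^3) 1"
  obtain U V h k where U: "openin (top_of_set ?S) U" "b t \<in> U" and V: "open V"
    and hk: "homeomorphism U V h k" and h0: "h (b t) = 0"
    and hA: "h ` (U \<inter> A) = {v \<in> V. snd v = (0::real)}"
    and hB: "h ` (U \<inter> path_image b) = {v \<in> V. fst v = (0::real)}"
    using tr unfolding transverse_at_def by blast
  note hk1 = homeomorphism_apply1[OF hk] and hk2 = homeomorphism_apply2[OF hk]
    and conth = homeomorphism_cont1[OF hk] and contk = homeomorphism_cont2[OF hk]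
    and hU = homeomorphism_image1[OF hk] and kV = homeomorphism_image2[OF hk]
  have "0 \<in> V" using hU U(2) h0 by (metis imageI)
  then obtain r where r: "r > 0" "ball 0 r \<subseteq> V" using V by (auto simp: open_contains_ball)
  have US: "U \<subseteq> ?S" using U(1) openin_imp_subset by blast
  define H where "H s = ball 0 r \<inter> {v :: real \<times> real. s * snd v > 0}" for s :: real
  have snd_lin: "linear (\<lambda>v :: real \<times> real. s * snd v)" for s by (intro linearI) (auto simp: algebra_simps)
  have Hconn: "connected (k ` H s)" for s
  proof -
    have "{v :: real \<times> real. s * snd v > 0} = (\<lambda>v. s * snd v) -` {0<..}" by auto
    then have "convex (H s)" unfolding H_def
      using convex_linear_vimage[OF snd_lin, of "{0<..}" s] by (intro convex_Int convex_ball) auto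
    moreover have "H s \<subseteq> V" using r(2) by (auto simp: H_def)
    ultimately show ?thesis
      by (intro connected_continuous_image continuous_on_subset[OF contk] convex_connected)
  qed
  have HDE: "k ` H s \<subseteq> D \<union> E" for s
  proof
    fix x assume "x \<in> k ` H s"
    then obtain v where v: "v \<in> H s" "x = k v" by blast
    then have vV: "v \<in> V" using r(2) by (auto simp: H_def)
    then have xU: "x \<in> U" using v kV by blast
    have "x \<notin> A"
    proof
      assume "x \<in> A"
      then have "h x \<in> {v \<in> V. snd v = 0}" using xU hA by blast
      then show False using v hk2[OF vV] by (auto simp: H_def)
    qed
    then show "x \<in> D \<union> E" using xU US D(4) by blast
  qed
  have Hside: "k ` H s \<subseteq> D \<or> k ` H s \<subseteq> E" for s
    by (rule connected_subset_separation[OF Hconn D(1,2,3) HDE])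
  define W where "W = k ` ball 0 r"
  have W: "openin (top_of_set ?S) W"
  proof -
    have "openin (top_of_set V) (ball 0 r)" using r(2) by (intro open_subset open_ball)
    then have "openin (top_of_set U) W"
      unfolding W_def using homeomorphism_imp_open_map[OF homeomorphism_symD[OF hk]] by blast
    then show ?thesis using openin_trans U(1) by blast
  qed
  have pW: "b t \<in> W" using hk1[OF U(2)] r(1) unfolding h0 W_def by (metis centre_in_ball imageI)
  obtain W' where W': "open W'" "W = ?S \<inter> W'" using W by (auto simp: openin_open)
  have WH: "x \<in> k ` H 1 \<or> x \<in> k ` H (-1)" if x: "x \<in> W" "x \<notin> A" for x
  proof -
    obtain v where v: "v \<in> ball 0 r" "x = k v" using x(1) by (auto simp: W_def)
    have "snd v \<noteq> 0"
    proof
      assume "snd v = 0"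
      then have "v \<in> h ` (U \<inter> A)" using v(1) r(2) unfolding hA by auto
      then show False using hk1 v(2) x(2) by auto
    qed
    then have "v \<in> H 1 \<or> v \<in> H (-1)" using v(1) by (auto simp: H_def)
    then show ?thesis using v(2) by blast
  qed
  \<comment> \<open>A point of \<open>F\<close> close to the crossing lies in one of the half-discs
    and pulls it wholly into \<open>F\<close>.\<close>
  have meet: "\<exists>s\<in>{1,-1}. k ` H s \<subseteq> F" if F: "F = D \<or> F = E" for F
  proof -
    have "b t \<in> closure F" using F D(5,6) by blast
    then obtain x where x: "x \<in> F" "x \<in> W'"
      using W' pW closure_iff_nhds_not_empty[of "b t" F] by (metis IntE disjoint_iff order_refl)
    have "x \<in> ?S" "x \<notin> A" using x F D(4) by blast+
    then have "x \<in> k ` H 1 \<or> x \<in> k ` H (-1)" using WH x(2) W'(2) by blast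
    then obtain s where s: "s \<in> {1,-1}" "x \<in> k ` H s" by blast
    then have "k ` H s \<subseteq> F" using Hside[of s] F D(3) x(1) by blast
    then show ?thesis using s by blast
  qed
  have Hne: "k ` H s \<noteq> {}" if "s \<in> {1,-1}" for s
  proof -
    have "(0, s * (r/2)) \<in> H s" using r(1) that by (auto simp: H_def norm_Pair)
    then show ?thesis by blast
  qed
  have "\<exists>s. (s = 1 \<or> s = -1) \<and> k ` H s \<subseteq> D \<and> k ` H (-s) \<subseteq> E"
  proof -
    obtain s1 where s1: "s1 \<in> {1,-1}" "k ` H s1 \<subseteq> D" using meet[of D] by blast
    obtain s2 where s2: "s2 \<in> {1,-1}" "k ` H s2 \<subseteq> E" using meet[of E] by blast
    have "s1 \<noteq> s2" using s1 s2 Hne[of s1] D(3) by blast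
    then have "s2 = - s1" using s1(1) s2(1) by auto
    then show ?thesis using s1 s2 by blast
  qed
  then obtain s where s: "s = 1 \<or> s = -1" "k ` H s \<subseteq> D" "k ` H (-s) \<subseteq> E" by blast
  have contb: "continuous_on {0..1} b" using b(1) by (simp add: simple_path_def path_def)
  have injb: "inj_on b {0<..<1}" by (rule simple_path_inj_on[OF b(1)])
  have "continuous (at t) b" using continuous_on_interior[OF contb, of t] t by simp
  then have "\<forall>\<^sub>F x in at t. b x \<in> W'"
    using W' pW unfolding continuous_at by (auto simp: tendsto_def)
  then obtain e0 where e0: "e0 > 0" "\<And>x. x \<noteq> t \<Longrightarrow> dist x t < e0 \<Longrightarrow> b x \<in> W'"
    unfolding eventually_at by blast
  \<comment> \<open>Small enough to stay in the chart, and strictly inside the unit interval, where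
    \<open>b\<close> is injective.\<close>
  define e where "e = min (e0 / 2) (min (t / 2) ((1 - t) / 2))"
  have e: "e > 0" "e < e0" "e < t" "t + e < 1" using e0 t by (auto simp: e_def min_def field_simps)
  have bW: "b x \<in> W" if "x \<in> {t-e..t+e}" for x
  proof (cases "x = t")
    case False
    then have "b x \<in> W'" using e0(2)[of x] that e by (auto simp: dist_real_def)
    moreover have "b x \<in> path_image b" using that e by (auto simp: path_image_def)
    then have "b x \<in> ?S" using b(2) by blast
    ultimately show ?thesis using W' by blast
  qed (use pW in simp)
  have WU: "W \<subseteq> U" using r(2) kV unfolding W_def by blast
  \<comment> \<open>The coordinate along B, with the sign chosen so that positive values mean
    \<open>D\<close>.\<close>
  define \<phi> where "\<phi> x = s * snd (h (b x))" for x
  have hb: "h (b x) = (0, s * \<phi> x)" "h (b x) \<in> ball 0 r" "k (h (b x)) = b x" if x: "x \<in> {t-e..t+e}" for x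
  proof -
    have "b x \<in> U" using bW[OF x] WU by blast
    moreover have "b x \<in> path_image b" using x e by (auto simp: path_image_def)
    ultimately have "h (b x) \<in> {v \<in> V. fst v = 0}" using hB by blast
    then show "h (b x) = (0, s * \<phi> x)" using s(1) unfolding \<phi>_def by (auto simp: prod_eq_iff)
    show "k (h (b x)) = b x" using hk1 \<open>b x \<in> U\<close> by blast
    obtain v where v: "v \<in> ball 0 r" "b x = k v" using bW[OF x] unfolding W_def by blast
    then show "h (b x) \<in> ball 0 r" using hk2[of v] r(2) by auto
  qed
  have \<phi>t: "\<phi> t = 0" by (simp add: \<phi>_def h0)
  have cont\<phi>: "continuous_on {t-e..t+e} \<phi>"
  proof -
    have "continuous_on (b ` {t-e..t+e}) h" using bW WU by (intro continuous_on_subset[OF conth]) blast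
    moreover have "continuous_on {t-e..t+e} b" using e t by (intro continuous_on_subset[OF contb]) auto
    ultimately have "continuous_on {t-e..t+e} (h \<circ> b)" using continuous_on_compose by blast
    then show ?thesis unfolding \<phi>_def o_def by (intro continuous_intros)
  qed
  have inj\<phi>: "inj_on \<phi> {t-e..t+e}"
  proof (rule inj_onI)
    fix x y assume xy: "x \<in> {t-e..t+e}" "y \<in> {t-e..t+e}" "\<phi> x = \<phi> y"
    then have "b x = b y" using hb(1,3)[of x] hb(1,3)[of y] by metis
    then show "x = y" using inj_onD[OF injb] xy e t by auto
  qed
  have pos: "b x \<in> D" if "x \<in> {t-e..t+e}" "\<phi> x > 0" for x
  proof -
    have "h (b x) \<in> H s" using hb(1,2)[OF that(1)] that(2) s(1) by (auto simp: H_def)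
    then show ?thesis using hb(3)[OF that(1)] s(2) by (metis imageI subsetD)
  qed
  have neg: "b x \<in> E" if "x \<in> {t-e..t+e}" "\<phi> x < 0" for x
  proof -
    have "h (b x) \<in> H (-s)" using hb(1,2)[OF that(1)] that(2) s(1) by (auto simp: H_def)
    then show ?thesis using hb(3)[OF that(1)] s(3) by (metis imageI subsetD)
  qed
  have mono: "\<phi> x < 0 \<and> 0 < \<phi> y \<or> \<phi> y < 0 \<and> 0 < \<phi> x"
    if "x \<in> {t-e..<t}" "y \<in> {t<..t+e}" for x y
  proof -
    have "{x..y} \<subseteq> {t-e..t+e}" using that by auto
    then show ?thesis
      using continuous_inj_imp_mono[of x t y \<phi>] continuous_on_subset[OF cont\<phi>] inj_on_subset[OF inj\<phi>] that
      unfolding \<phi>t by auto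
  qed
  have "b ` {t-e<..<t} \<subseteq> D \<and> b ` {t<..<t+e} \<subseteq> E \<or> b ` {t-e<..<t} \<subseteq> E \<and> b ` {t<..<t+e} \<subseteq> D"
  proof (cases "\<phi> (t + e) > 0")
    case True
    then have l: "\<phi> x < 0" if "x \<in> {t-e..<t}" for x using mono[of x "t+e"] that e by auto
    have "\<phi> (t - e) < 0" using l[of "t - e"] e by simp
    then have r: "\<phi> y > 0" if "y \<in> {t<..t+e}" for y using mono[of "t-e" y] that e by auto
    have "b ` {t-e<..<t} \<subseteq> E" using neg l by auto
    moreover have "b ` {t<..<t+e} \<subseteq> D" using pos r by auto
    ultimately show ?thesis by blast
  next
    case False
    then have l: "\<phi> x > 0" if "x \<in> {t-e..<t}" for x using mono[of x "t+e"] that e by auto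
    have "\<phi> (t - e) > 0" using l[of "t - e"] e by simp
    then have r: "\<phi> y < 0" if "y \<in> {t<..t+e}" for y using mono[of "t-e" y] that e by auto
    have "b ` {t-e<..<t} \<subseteq> D" using pos l by auto
    moreover have "b ` {t<..<t+e} \<subseteq> E" using neg r by auto
    ultimately show ?thesis by blast
  qed
  then show thesis using that[of e] e by auto
qed

text \<open>Which parity goes with \<open>D\<close> depends on which side was named
  \<open>D\<close>; the boolean \<open>c\<close> records it. Comparing the last arc with arc 0
  across the base point is what makes \<open>N\<close> even.\<close>

lemma alternating_arcs:
  fixes a b :: "real \<Rightarrow> real^3" and t :: "nat \<Rightarrow> real"
  assumes b: "simple_path b" "pathfinish b = pathstart b" "path_image b \<subseteq> sphere 0 1"
    and t: "t 0 = 0" "t N = 1" "\<And>i. i < N \<Longrightarrow> t i < t (Suc i)"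
    and meet: "\<And>s. s \<in> {0..1} \<Longrightarrow> b s \<in> A \<longleftrightarrow> s \<in> t ` {..N}"
    and tr: "\<And>i. i < N \<Longrightarrow> transverse_at A (path_image b) (b (t i))"
    and D: "openin (top_of_set (sphere 0 1)) D" "openin (top_of_set (sphere 0 1)) E"
      "D \<inter> E = {}" "D \<union> E = sphere 0 1 - A" "A \<subseteq> closure D" "A \<subseteq> closure E"
  shows "\<And>i. i < N \<Longrightarrow> b ` {t i<..<t (Suc i)} \<subseteq> D \<or> b ` {t i<..<t (Suc i)} \<subseteq> E"
    and "even N" and "\<exists>c. \<forall>i<N. b ` {t i<..<t (Suc i)} \<subseteq> (if even i = c then D else E)"
proof -
  have N: "N > 0" using t(1,2) by (cases N) auto
  have tm: "t i < t j" if "i < j" "j \<le> N" for i j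
    using that
  proof (induction j)
    case (Suc j)
    then show ?case using t(3)[of j] by (cases "i = j") auto
  qed simp
  have t01: "0 \<le> t i" "t i \<le> 1" if "i \<le> N" for i
    using tm[of 0 i] tm[of i N] that t(1,2) by (cases "i = 0"; cases "i = N"; simp)+
  define arc where "arc i = {t i<..<t (Suc i)}" for i
  have contb: "continuous_on {0..1} b" using b(1) by (simp add: simple_path_def path_def)
  have arc01: "arc i \<subseteq> {0..1}" if "i < N" for i using t01[of i] t01[of "Suc i"] that by (auto simp: arc_def)
  have offA: "b ` arc i \<subseteq> D \<union> E" if i: "i < N" for i
  proof
    fix z assume "z \<in> b ` arc i"
    then obtain x where x: "x \<in> arc i" "z = b x" by blast
    have x01: "x \<in> {0..1}" using x arc01[OF i] by blast
    have "x \<noteq> t j" if "j \<le> N" for j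
    proof -
      have "j < i \<or> j = i \<or> j = Suc i \<or> Suc i < j" by linarith
      then show ?thesis using tm[of j i] tm[of "Suc i" j] x(1) i that unfolding arc_def by auto
    qed
    then have "z \<notin> A" using meet[OF x01] x by blast
    moreover have "z \<in> path_image b" using x x01 by (auto simp: path_image_def)
    ultimately show "z \<in> D \<union> E" using b(3) D(4) by blast
  qed
  have sides: "b ` arc i \<subseteq> D \<or> b ` arc i \<subseteq> E" if "i < N" for i
  proof (rule connected_subset_separation[OF _ D(1,2,3) offA[OF that]])
    show "connected (b ` arc i)"
      using arc01[OF that] by (intro connected_continuous_image continuous_on_subset[OF contb]) (auto simp: arc_def)
  qed
  then show "b ` {t i<..<t (Suc i)} \<subseteq> D \<or> b ` {t i<..<t (Suc i)} \<subseteq> E" if "i < N" for i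
    using that by (simp add: arc_def)
  have side_mem: "b ` arc i \<subseteq> F" if "i < N" "x \<in> arc i" "b x \<in> F" "F = D \<or> F = E" for i x F
  proof -
    have "b x \<in> b ` arc i" using that(2) by blast
    then show ?thesis using sides[OF that(1)] that(3,4) D(3) by blast
  qed
  have opp: "b ` arc i \<subseteq> D \<and> b ` arc j \<subseteq> E \<or> b ` arc i \<subseteq> E \<and> b ` arc j \<subseteq> D"
    if "i < N" "j < N" "x \<in> arc i" "y \<in> arc j" "b x \<in> D \<and> b y \<in> E \<or> b x \<in> E \<and> b y \<in> D" for i j x y
    using that(5)
  proof
    assume "b x \<in> D \<and> b y \<in> E"
    then show ?thesis using side_mem[OF that(1,3), of D] side_mem[OF that(2,4), of E] by simp
  next
    assume "b x \<in> E \<and> b y \<in> D"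
    then show ?thesis using side_mem[OF that(1,3), of E] side_mem[OF that(2,4), of D] by simp
  qed
  have step: "b ` arc i \<subseteq> D \<and> b ` arc (Suc i) \<subseteq> E \<or> b ` arc i \<subseteq> E \<and> b ` arc (Suc i) \<subseteq> D"
    if i: "Suc i < N" for i
  proof -
    have ti: "0 < t (Suc i)" "t (Suc i) < 1" using tm[of 0 "Suc i"] tm[of "Suc i" N] i t(1,2) by auto
    have "b (t (Suc i)) \<in> A" using meet[of "t (Suc i)"] ti i by auto
    then have cl: "b (t (Suc i)) \<in> closure D" "b (t (Suc i)) \<in> closure E" using D(5,6) by blast+
    obtain e where e: "e > 0" "b ` {t (Suc i)-e<..<t (Suc i)} \<subseteq> D \<and> b ` {t (Suc i)<..<t (Suc i)+e} \<subseteq> E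
        \<or> b ` {t (Suc i)-e<..<t (Suc i)} \<subseteq> E \<and> b ` {t (Suc i)<..<t (Suc i)+e} \<subseteq> D"
      using transverse_crossing_sides[OF tr[OF i] b(1,3) ti D(1-4) cl] by metis
    obtain x where x: "max (t i) (t (Suc i) - e) < x" "x < t (Suc i)"
      using dense[of "max (t i) (t (Suc i) - e)" "t (Suc i)"] e(1) t(3)[of i] i by auto
    obtain y where y: "y < min (t (Suc (Suc i))) (t (Suc i) + e)" "t (Suc i) < y"
      using dense[of "t (Suc i)" "min (t (Suc (Suc i))) (t (Suc i) + e)"] e(1) t(3)[of "Suc i"] i by auto
    have "x \<in> {t (Suc i)-e<..<t (Suc i)}" "y \<in> {t (Suc i)<..<t (Suc i)+e}" using x y by auto
    then have "b x \<in> D \<and> b y \<in> E \<or> b x \<in> E \<and> b y \<in> D" using e(2) by blast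
    then show ?thesis using x y i by (intro opp[of i "Suc i" x y]) (auto simp: arc_def)
  qed
  have wrap: "b ` arc (N - 1) \<subseteq> D \<and> b ` arc 0 \<subseteq> E \<or> b ` arc (N - 1) \<subseteq> E \<and> b ` arc 0 \<subseteq> D"
  proof -
    \<comment> \<open>the shift makes the base point an interior parameter\<close>
    define b' where "b' = shiftpath (1/2) b"
    have b': "simple_path b'" "path_image b' = path_image b"
      unfolding b'_def using b by (simp_all add: simple_path_shiftpath path_image_shiftpath)
    have b01: "b 1 = b 0" using b(2) by (simp add: pathfinish_def pathstart_def)
    have half: "b' (1/2) = b (t 0)" using b01 t(1) by (simp add: b'_def shiftpath_def)
    have "b 0 \<in> A" using meet[of 0] t(1) by force
    then have cl: "b' (1/2) \<in> closure D" "b' (1/2) \<in> closure E" using D(5,6) t(1) unfolding half by auto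
    have tr': "transverse_at A (path_image b') (b' (1/2))" using tr[OF N] unfolding half b'(2) .
    have sub: "path_image b' \<subseteq> sphere 0 1" using b(3) b'(2) by simp
    obtain e where e: "e > 0" "e \<le> 1/2" "b' ` {1/2-e<..<1/2} \<subseteq> D \<and> b' ` {1/2<..<1/2+e} \<subseteq> E
        \<or> b' ` {1/2-e<..<1/2} \<subseteq> E \<and> b' ` {1/2<..<1/2+e} \<subseteq> D"
    proof -
      have "0 < (1/2 :: real)" "(1/2 :: real) < 1" by simp_all
      from transverse_crossing_sides[OF tr' b'(1) sub this D(1-4) cl] that show ?thesis by metis
    qed
    obtain x where x: "max (t (N - 1)) (1 - e) < x" "x < 1"
      using dense[of "max (t (N - 1)) (1 - e)" 1] e(1) t(2) t(3)[of "N - 1"] N by auto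
    obtain y where y: "y < min (t (Suc 0)) e" "0 < y"
      using dense[of 0 "min (t (Suc 0)) e"] e(1) t(1) t(3)[OF N] by auto
    have "b' (x - 1/2) = b x" "b' (y + 1/2) = b y"
      using x y e by (auto simp: b'_def shiftpath_def)
    moreover have "x - 1/2 \<in> {1/2-e<..<1/2}" "y + 1/2 \<in> {1/2<..<1/2+e}" using x y by auto
    ultimately have "b x \<in> D \<and> b y \<in> E \<or> b x \<in> E \<and> b y \<in> D" using e(3) by (metis image_subset_iff)
    then show ?thesis using x y N t(1,2) by (intro opp[of "N - 1" 0 x y]) (auto simp: arc_def)
  qed
  have ne: "b ` arc i \<noteq> {}" if "i < N" for i using t(3)[OF that] by (simp add: arc_def)
  have excl: "\<not> (b ` arc i \<subseteq> D \<and> b ` arc i \<subseteq> E)" if "i < N" for i using ne[OF that] D(3) by blast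
  define c where "c \<longleftrightarrow> b ` arc 0 \<subseteq> D"
  have par: "b ` arc i \<subseteq> (if even i = c then D else E)" if "i < N" for i
    using that
  proof (induction i)
    case 0 then show ?case using sides[of 0] by (auto simp: c_def)
  next
    case (Suc i)
    then have "b ` arc i \<subseteq> (if even i = c then D else E)" by simp
    then show ?case using step[OF Suc.prems] excl[of i] Suc.prems by (auto split: if_splits)
  qed
  then show "\<exists>c. \<forall>i<N. b ` {t i<..<t (Suc i)} \<subseteq> (if even i = c then D else E)"
    unfolding arc_def by blast
  have "even (N - 1) \<noteq> even (0::nat)"
    using wrap par[of 0] par[of "N - 1"] excl[of 0] excl[of "N - 1"] N by (auto split: if_splits)
  then show "even N" using N by simp
qed

section \<open>The meandric word of two transverse loops\<close>

text \<open>With the base point in \<open>X\<close> the enumeration starts at 0, and the additional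
  value \<open>s (card X) = 1\<close> returns to that point, so that consecutive parameters bound
  all arcs of the loop.\<close>

lemma simple_loop_enumerate:
  fixes g :: "real \<Rightarrow> 'a::topological_space"
  assumes g: "simple_path g" "pathfinish g = pathstart g"
    and X: "finite X" "X \<subseteq> path_image g" "g 0 \<in> X"
  obtains s :: "nat \<Rightarrow> real" where "s 0 = 0" "s (card X) = 1" "strict_mono_on {..card X} s"
    "bij_betw (\<lambda>i. g (s i)) {..<card X} X" "{u \<in> {0..1}. g u \<in> X} = s ` {..card X}"
proof -
  define P where "P = {u \<in> {0..<1}. g u \<in> X}"
  have g01: "g 1 = g 0" using g(2) by (simp add: pathfinish_def pathstart_def)
  have inj: "inj_on g {0..<1}"
    using g(1) unfolding simple_path_def loop_free_def inj_on_def by fastforce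
  have injP: "inj_on g P" by (rule inj_on_subset[OF inj]) (auto simp: P_def)
  have gP: "g ` P = X"
  proof
    show "X \<subseteq> g ` P"
    proof
      fix p assume p: "p \<in> X"
      then obtain u where u: "u \<in> {0..1}" "p = g u" using X(2) by (auto simp: path_image_def)
      show "p \<in> g ` P"
      proof (cases "u = 1")
        case True
        then have "p = g 0" "0 \<in> P" using u g01 X(3) by (auto simp: P_def)
        then show ?thesis by blast
      qed (use u p in \<open>auto simp: P_def\<close>)
    qed
  qed (auto simp: P_def)
  have finP: "finite P" using finite_imageD[OF _ injP] gP X(1) by simp
  have cardP: "card P = card X" using card_image[OF injP] gP by simp
  define l where "l = sorted_list_of_set P"
  have l: "sorted_wrt (<) l" "set l = P" "length l = card X"
    using finP cardP by (simp_all add: l_def strict_sorted_list_of_set)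
  have N: "card X > 0" using X(1,3) by (auto simp: card_gt_0_iff)
  define s where "s i = (if i < card X then l ! i else 1)" for i
  have sP: "s i \<in> P" if "i < card X" for i using that l(2,3) by (auto simp: s_def)
  have mono: "s i < s j" if "i < j" "j \<le> card X" for i j
  proof (cases "j < card X")
    case True then show ?thesis using that l(1,3) by (simp add: s_def sorted_wrt_nth_less)
  next
    case False
    then show ?thesis using that sP[of i] by (simp add: s_def P_def)
  qed
  have img: "s ` {..<card X} = P"
    using l(2,3) by (force simp: s_def in_set_conv_nth image_iff)
  have "0 \<in> P" using X(3) by (simp add: P_def)
  then obtain i where i: "i < card X" "s i = 0" using img by (metis imageE lessThan_iff)
  have "i = 0"
    using mono[of 0 i] i sP[of 0] N by (cases "i = 0") (auto simp: P_def)
  then have s0: "s 0 = 0" using i by simp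
  have bij: "bij_betw (\<lambda>i. g (s i)) {..<card X} X"
  proof -
    have "inj_on s {..<card X}"
      by (rule inj_onI) (metis lessThan_iff less_imp_le linorder_neqE_nat mono order_less_irrefl)
    then have "bij_betw s {..<card X} P" using img by (simp add: bij_betw_def)
    then have "bij_betw (g \<circ> s) {..<card X} X" using injP gP by (metis bij_betw_def bij_betw_trans)
    then show ?thesis by (simp add: o_def)
  qed
  have "{..card X} = insert (card X) {..<card X}" by auto
  then have "s ` {..card X} = insert (s (card X)) (s ` {..<card X})" by simp
  then have "s ` {..card X} = insert 1 P" unfolding img by (simp add: s_def)
  moreover have "{u \<in> {0..1}. g u \<in> X} = insert 1 P" using g01 X(3) by (auto simp: P_def)
  ultimately have "{u \<in> {0..1}. g u \<in> X} = s ` {..card X}" by simp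
  moreover have "strict_mono_on {..card X} s" using mono by (auto intro: strict_mono_onI)
  ultimately show thesis using that[of s] s0 bij by (simp add: s_def)
qed

lemma endpoints_in_closure_image:
  fixes b :: "real \<Rightarrow> 'a::topological_space"
  assumes "continuous_on {x..y} b" "x < y"
  shows "b x \<in> closure (b ` {x<..<y})" "b y \<in> closure (b ` {x<..<y})"
proof -
  have "b ` closure {x<..<y} \<subseteq> closure (b ` {x<..<y})"
    using assms by (intro image_closure_subset closed_closure closure_subset) simp
  then show "b x \<in> closure (b ` {x<..<y})" "b y \<in> closure (b ` {x<..<y})"
    using assms(2) by auto
qed

text \<open>\<open>w ! i\<close> is the position along A of the \<open>i\<close>-th crossing along
  B. A pole off A forbids interleaving for the arcs on the side away from it, which are those of one
  parity; a pole on the other side handles the other parity.\<close>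

lemma meandric_word_of_transverse_loops:
  fixes a b :: "real \<Rightarrow> real^3" and s t :: "nat \<Rightarrow> real"
  assumes a: "simple_path a" "pathfinish a = pathstart a" "path_image a \<subseteq> sphere 0 1"
    and b: "simple_path b" "pathfinish b = pathstart b" "path_image b \<subseteq> sphere 0 1"
    and tr: "\<And>p. p \<in> path_image a \<inter> path_image b \<Longrightarrow> transverse_at (path_image a) (path_image b) p"
    and s: "s 0 = 0" "s N = 1" "\<And>i j. i < j \<Longrightarrow> j \<le> N \<Longrightarrow> s i < s j"
    and t: "t 0 = 0" "t N = 1" "\<And>i j. i < j \<Longrightarrow> j \<le> N \<Longrightarrow> t i < t j"
    and meet: "\<And>u. u \<in> {0..1} \<Longrightarrow> b u \<in> path_image a \<longleftrightarrow> u \<in> t ` {..N}"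
    and w: "distinct w" "set w = {..<N}" "\<And>i. i < N \<Longrightarrow> a (s (w ! i)) = b (t i)" "w ! 0 = 0"
  shows "meandric_word N w"
proof -
  let ?S = "sphere (0::real^3) 1" and ?A = "path_image a"
  have N: "N > 0" using t(1,2) by (cases N) auto
  have lw: "length w = N" using w(1,2) distinct_card by fastforce
  have wlt: "w ! i < N" if "i < N" for i using that lw w(2) by (metis lessThan_iff nth_mem)
  have s01: "0 \<le> s i" "s i \<le> 1" if "i \<le> N" for i
    using s(3)[of 0 i] s(3)[of i N] that s(1,2) by (cases "i = 0"; cases "i = N"; simp)+
  have t01: "0 \<le> t i" "t i \<le> 1" if "i \<le> N" for i
    using t(3)[of 0 i] t(3)[of i N] that t(1,2) by (cases "i = 0"; cases "i = N"; simp)+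
  have contb: "continuous_on {0..1} b" using b(1) by (simp add: simple_path_def path_def)
  have b01: "b 1 = b 0" using b(2) by (simp add: pathfinish_def pathstart_def)
  define e where "e i = w ! (Suc i mod N)" for i
  have ei: "a (s (e i)) = b (t (Suc i))" if "i < N" for i
    using w(3)[of "Suc i mod N"] N that t(1,2) b01 unfolding e_def by (cases "Suc i = N") auto
  define arc where "arc i = {t i<..<t (Suc i)}" for i
  \<comment> \<open>Interleaving of the end labels, the ends of each arc being taken in either
    order.\<close>
  define cross where "cross i j \<longleftrightarrow> (\<exists>a1 b1 a2 b2. {a1, b1} = {w ! i, e i} \<and> {a2, b2} = {w ! j, e j} \<and>
      a1 < a2 \<and> a2 < b1 \<and> b1 < b2)" for i j
  have side: "\<exists>D c. q \<notin> D \<and> connected D \<and> D \<subseteq> ?S - ?A \<and> D \<noteq> {} \<and> openin (top_of_set ?S) D \<and>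
      openin (top_of_set ?S) (?S - ?A - D) \<and> even N \<and>
      (\<forall>i<N. b ` arc i \<subseteq> (if even i = c then D else ?S - ?A - D)) \<and>
      (\<forall>i<N. \<forall>j<N. even i = c \<longrightarrow> even j = c \<longrightarrow> \<not> cross i j)"
    if q: "q \<in> ?S" "q \<notin> ?A" for q
  proof -
    obtain D where D: "openin (top_of_set ?S) D" "openin (top_of_set ?S) (?S - ?A - D)"
      "D \<inter> ?A = {}" "connected D" "D \<noteq> {}" "q \<notin> D" "?A \<subseteq> closure D" "?A \<subseteq> closure (?S - ?A - D)"
      and chord: "chords_separate a D"
      using sphere_jordan_side[OF a q] by blast
    have DS: "D \<subseteq> ?S - ?A" using openin_imp_subset[OF D(1)] D(3) by blast
    have tS: "t i < t (Suc i)" if "i < N" for i using t(3)[of i "Suc i"] that by simp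
    have trt: "transverse_at ?A (path_image b) (b (t i))" if i: "i < N" for i
    proof (rule tr)
      have "t i \<in> {0..1}" using t01[of i] i by simp
      then show "b (t i) \<in> ?A \<inter> path_image b" using meet[of "t i"] i by (auto simp: path_image_def)
    qed
    have un: "D \<inter> (?S - ?A - D) = {}" "D \<union> (?S - ?A - D) = ?S - ?A" using DS by auto
    note alt = alternating_arcs[OF b t(1,2) tS meet trt D(1,2) un D(7,8)]
    obtain c where c: "\<And>i. i < N \<Longrightarrow> b ` arc i \<subseteq> (if even i = c then D else ?S - ?A - D)"
      using alt(3) unfolding arc_def by blast
    have nocross: "\<not> cross i j" if ij: "i < N" "j < N" "even i = c" "even j = c" for i j
    proof
      assume "cross i j"
      then obtain a1 b1 a2 b2 where ab: "{a1, b1} = {w ! i, e i}" "{a2, b2} = {w ! j, e j}"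
        "a1 < a2" "a2 < b1" "b1 < b2" unfolding cross_def by blast
      have neq: "i \<noteq> j" using ab by (auto simp: doubleton_eq_iff)
      have inD: "b ` arc i \<subseteq> D" "b ` arc j \<subseteq> D" using c[of i] c[of j] ij by auto
      have enN: "e i < N" "e j < N" using wlt N unfolding e_def by auto
      then have b2N: "b2 < N" using ab(2) wlt[OF ij(2)] by (auto simp: doubleton_eq_iff)
      define d where "d = subpath (t i) (t (Suc i)) b"
      have ti: "t i \<in> {0..1}" "t (Suc i) \<in> {0..1}" "t j \<in> {0..1}" "t (Suc j) \<in> {0..1}"
        using t01 ij by auto
      have d: "simple_path d" "pathstart d = a (s (w ! i))" "pathfinish d = a (s (e i))"
        unfolding d_def using b(1) ti tS[OF ij(1)] w(3)[OF ij(1)] ei[OF ij(1)]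
        by (auto intro: simple_path_subpath)
      have pd: "path_image d = b ` {t i..t (Suc i)}"
        unfolding d_def using tS[OF ij(1)] by (simp add: path_image_subpath)
      have "{t i..t (Suc i)} = arc i \<union> {t i, t (Suc i)}" using tS[OF ij(1)] by (auto simp: arc_def)
      then have "path_image d = b ` arc i \<union> {a (s (w ! i)), a (s (e i))}"
        unfolding pd using w(3)[OF ij(1)] ei[OF ij(1)] by auto
      then have pdD: "path_image d - {a (s (w ! i)), a (s (e i))} \<subseteq> D" using inD by blast
      have disj: "b ` arc j \<inter> path_image d = {}"
      proof (rule ccontr)
        assume "b ` arc j \<inter> path_image d \<noteq> {}"
        then obtain z where "z \<in> b ` arc j" "z \<in> b ` {t i..t (Suc i)}" unfolding pd by blast
        then obtain x y where xy: "x \<in> {t i..t (Suc i)}" "y \<in> arc j" "b x = b y" by (metis imageE)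
        \<comment> \<open>\<open>loop_free\<close> identifies only the two ends of the unit
          interval, and \<open>y\<close> is in its interior.\<close>
        have "x \<in> {0..1}" "y \<in> {0<..<1}" using xy(1,2) ti by (auto simp: arc_def)
        then have "x = y" using xy(3) b(1) unfolding simple_path_def loop_free_def by fastforce
        moreover have "t (Suc i) \<le> t j" if "i < j" using t(3)[of "Suc i" j] that ij by (cases "Suc i = j") auto
        moreover have "t (Suc j) \<le> t i" if "j < i" using t(3)[of "Suc j" i] that ij by (cases "Suc j = i") auto
        ultimately show False using neq xy(1,2) by (cases "i < j") (auto simp: arc_def)
      qed
      have "continuous_on {t j..t (Suc j)} b" using ti by (intro continuous_on_subset[OF contb]) auto
      then have "a (s (w ! j)) \<in> closure (b ` arc j)" "a (s (e j)) \<in> closure (b ` arc j)"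
        using endpoints_in_closure_image[of "t j" "t (Suc j)" b] tS[OF ij(2)] w(3)[OF ij(2)] ei[OF ij(2)]
        unfolding arc_def by auto
      then have cl: "a (s a2) \<in> closure (b ` arc j)" "a (s b2) \<in> closure (b ` arc j)"
        using ab(2) by (auto simp: doubleton_eq_iff)
      have conn: "connected (b ` arc j)"
        using ti by (intro connected_continuous_image continuous_on_subset[OF contb]) (auto simp: arc_def)
      have ss: "0 \<le> s a1" "s a1 < s a2" "s a2 < s b1" "s b1 < s b2" "s b2 < 1"
        using s01[of a1] s(3)[of a1 a2] s(3)[of a2 b1] s(3)[of b1 b2] s(3)[of b2 N] s(2) ab b2N by auto
      \<comment> \<open>The chord is turned round if necessary, to run from the smaller label to the
        larger.\<close>
      have "\<exists>d'. simple_path d' \<and> pathstart d' = a (s a1) \<and> pathfinish d' = a (s b1) \<and> path_image d' = path_image d"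
      proof (cases "a1 = w ! i")
        case True
        then have "b1 = e i" using ab(1) by (auto simp: doubleton_eq_iff)
        then show ?thesis using d True by blast
      next
        case False
        then have "a1 = e i" "b1 = w ! i" using ab(1) by (auto simp: doubleton_eq_iff)
        then show ?thesis using d by (intro exI[of _ "reversepath d"]) (auto simp: simple_path_reversepath)
      qed
      then obtain d' where d': "simple_path d'" "pathstart d' = a (s a1)" "pathfinish d' = a (s b1)"
        "path_image d' = path_image d" by blast
      have "{a (s a1), a (s b1)} = {a (s (w ! i)), a (s (e i))}"
        using ab(1) by (auto simp: doubleton_eq_iff)
      then have "path_image d' - {a (s a1), a (s b1)} \<subseteq> D" using pdD d'(4) by simp
      moreover have "b ` arc j \<inter> path_image d' = {}" using disj d'(4) by simp
      ultimately show False using chord d'(1-3) conn inD(2) ss cl unfolding chords_separate_def by blast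
    qed
    show ?thesis
      using D(1,2,4,5,6) DS c nocross alt(2) by (intro exI[of _ D] exI[of _ c]) auto
  qed
  \<comment> \<open>The midpoint of the first parameter interval gives the first pole: a point of
    the sphere off A.\<close>
  define u where "u = (t 0 + t (Suc 0)) / 2"
  have u: "u \<in> arc 0" using t(3)[of 0 "Suc 0"] N by (auto simp: u_def arc_def)
  have u01: "u \<in> {0..1}" using u t01[of 0] t01[of "Suc 0"] N by (auto simp: arc_def)
  have "u \<noteq> t j" if "j \<le> N" for j
    using u t(1) t(3)[of "Suc 0" j] that by (cases "j = 0 \<or> j = 1") (auto simp: arc_def)
  then have buA: "b u \<notin> ?A" using meet[OF u01] by blast
  have "b u \<in> path_image b" using u01 by (auto simp: path_image_def)
  then have buS: "b u \<in> ?S" using b(3) by blast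
  obtain D c where D: "connected D" "D \<subseteq> ?S - ?A" "D \<noteq> {}"
    "even N" "\<forall>i<N. b ` arc i \<subseteq> (if even i = c then D else ?S - ?A - D)"
    and nc: "\<forall>i<N. \<forall>j<N. even i = c \<longrightarrow> even j = c \<longrightarrow> \<not> cross i j"
    using side[OF buS buA] by blast
  \<comment> \<open>A point of \<open>D\<close> as centre of projection gives the arcs on the other side.\<close>
  obtain q where q: "q \<in> D" using D(3) by blast
  then have qS: "q \<in> ?S" "q \<notin> ?A" using D(2) by auto
  obtain D' c' where D': "q \<notin> D'" "D' \<subseteq> ?S - ?A" "openin (top_of_set ?S) D'" "openin (top_of_set ?S) (?S - ?A - D')"
    "\<forall>i<N. b ` arc i \<subseteq> (if even i = c' then D' else ?S - ?A - D')"
    and nc': "\<forall>i<N. \<forall>j<N. even i = c' \<longrightarrow> even j = c' \<longrightarrow> \<not> cross i j"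
    using side[OF qS] by blast
  \<comment> \<open>\<open>D\<close> contains the new pole and \<open>D'\<close> does not, so
    connectedness puts \<open>D\<close> on the opposite side.\<close>
  have "D \<subseteq> D' \<or> D \<subseteq> ?S - ?A - D'"
    using D(2) by (intro connected_subset_separation[OF D(1) D'(3,4)]) auto
  then have DD': "D \<inter> D' = {}" using q D'(1) by blast
  have N2: "N \<ge> 2" using D(4) N by (auto elim!: evenE)
  have "c' \<noteq> c"
  proof
    assume "c' = c"
    \<comment> \<open>An arc whose parity is \<open>c\<close>, available because \<open>N\<close> is
      at least 2; it would lie in two disjoint sets.\<close>
    define i where "i = (if c then 0 else 1 :: nat)"
    have "i < N" "even i = c" using N2 by (auto simp: i_def)
    then have "b ` arc i \<subseteq> D \<inter> D'" using D(5) D'(5) \<open>c' = c\<close> by fastforce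
    moreover have "b ` arc i \<noteq> {}" using t(3)[of i "Suc i"] \<open>i < N\<close> by (simp add: arc_def)
    ultimately show False using DD' by blast
  qed
  then have nocross: "\<not> cross i j" if "i < N" "j < N" "even i = even j" for i j
    using nc nc' that by (cases "even i = c") auto
  have half: "2 * i + 1 < N" if "i < N div 2" for i using that D(4) by (auto elim!: evenE)
  have e_even: "e (2 * i) = w ! (2 * i + 1)" "e (2 * i + 1) = w ! ((2 * i + 2) mod N)" if "i < N div 2" for i
    using half[OF that] by (simp_all add: e_def)
  have ncM: "non_crossing M" if M: "M \<subseteq> {{w ! i, e i} |i. i < N \<and> even i = p}" for M p
    unfolding non_crossing_def
  proof (intro notI, elim exE conjE)
    fix a1 b1 a2 b2 assume h: "{a1, b1} \<in> M" "{a2, b2} \<in> M" "a1 < a2" "a2 < b1" "b1 < b2"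
    obtain i where i: "{a1, b1} = {w ! i, e i}" "i < N" "even i = p" using h(1) M by blast
    obtain j where j: "{a2, b2} = {w ! j, e j}" "j < N" "even j = p" using h(2) M by blast
    have "cross i j" unfolding cross_def using i j h by blast
    then show False using nocross i j by blast
  qed
  have "{{w ! (2 * i), w ! (2 * i + 1)} |i. i < N div 2} \<subseteq> {{w ! i, e i} |i. i < N \<and> even i = True}"
  proof clarify
    fix i assume i: "i < N div 2"
    show "\<exists>k. {w ! (2 * i), w ! (2 * i + 1)} = {w ! k, e k} \<and> k < N \<and> even k = True"
      using e_even(1)[OF i] half[OF i] by (intro exI[of _ "2 * i"]) simp
  qed
  then have n1: "non_crossing {{w ! (2 * i), w ! (2 * i + 1)} |i. i < N div 2}" by (rule ncM)
  have "{{w ! (2 * i + 1), w ! ((2 * i + 2) mod N)} |i. i < N div 2} \<subseteq> {{w ! i, e i} |i. i < N \<and> even i = False}"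
  proof clarify
    fix i assume i: "i < N div 2"
    show "\<exists>k. {w ! (2 * i + 1), w ! ((2 * i + 2) mod N)} = {w ! k, e k} \<and> k < N \<and> even k = False"
      using e_even(2)[OF i] half[OF i] by (intro exI[of _ "2 * i + 1"]) simp
  qed
  then have n2: "non_crossing {{w ! (2 * i + 1), w ! ((2 * i + 2) mod N)} |i. i < N div 2}" by (rule ncM)
  show ?thesis unfolding meandric_word_def using D(4) N w n1 n2 by blast
qed

section \<open>From realizations to meanders\<close>

text \<open>Starting the curve at the first listed point removes the rotation. Applied to both
  curves it gives them a common base point, which has label 0 along A and comes first along
  B.\<close>

lemma in_cyclic_order_rebase:
  assumes o: "in_cyclic_order g xs" "xs \<noteq> []"
    and g: "simple_path g" "pathfinish g = pathstart g"
  obtains g' ts where "simple_path g'" "pathfinish g' = pathstart g'" "path_image g' = path_image g"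
    "sorted_wrt (<) ts" "set ts \<subseteq> {0..<1}" "xs = map g' ts" "g' 0 = xs ! 0"
proof -
  obtain r ts where ts: "sorted_wrt (<) ts" "set ts \<subseteq> {0..<1}" "rotate r xs = map g ts"
    using o(1) by (auto simp: in_cyclic_order_def)
  define n where "n = length xs"
  have n: "n > 0" using o(2) by (simp add: n_def)
  have lts: "length ts = n" using arg_cong[OF ts(3), of length] by (simp add: n_def)
  \<comment> \<open>The number of places that undoes the rotation by \<open>r\<close>; the outer
    \<open>mod\<close> keeps it below \<open>n\<close> when \<open>n\<close> divides
    \<open>r\<close>.\<close>
  define k where "k = (n - r mod n) mod n"
  have k: "k < n" using n by (simp add: k_def)
  have "xs = rotate (n - r mod n) (rotate (r mod n) xs)"
    using n mod_less_divisor[OF n, of r] unfolding rotate_rotate by (simp add: n_def)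
  also have "\<dots> = rotate k (rotate r xs)"
    by (metis k_def length_rotate n_def rotate_conv_mod)
  also have "\<dots> = drop k (map g ts) @ take k (map g ts)"
    unfolding ts(3) using k lts by (simp add: rotate_drop_take)
  finally have xs: "xs = map g (drop k ts @ take k ts)" by (simp add: drop_map take_map)
  define u where "u = ts ! k"
  have tsn: "0 \<le> ts ! i \<and> ts ! i < 1" if "i < n" for i
  proof -
    have "ts ! i \<in> {0..<1}" using ts(2) lts that nth_mem by blast
    then show ?thesis by simp
  qed
  have u: "0 \<le> u" "u < 1" using tsn[OF k] by (auto simp: u_def)
  have dr: "\<And>z. z \<in> set (drop k ts) \<Longrightarrow> u \<le> z \<and> z < 1"
    and tk: "\<And>z. z \<in> set (take k ts) \<Longrightarrow> z < u \<and> 0 \<le> z"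
  proof -
    fix z assume "z \<in> set (drop k ts)"
    then obtain i where "i < length (drop k ts)" "z = drop k ts ! i" unfolding in_set_conv_nth by blast
    then have i: "k + i < n" "z = ts ! (k + i)" using lts by auto
    have "u \<le> z" using sorted_wrt_nth_less[OF ts(1), of k "k + i"] i lts by (cases "i = 0") (auto simp: u_def)
    moreover have "z < 1" using tsn[OF i(1)] i(2) by simp
    ultimately show "u \<le> z \<and> z < 1" by simp
  next
    fix z assume "z \<in> set (take k ts)"
    then obtain i where "i < length (take k ts)" "z = take k ts ! i" unfolding in_set_conv_nth by blast
    then have i: "i < k" "z = ts ! i" using k lts by auto
    have "z < u" using sorted_wrt_nth_less[OF ts(1), of i k] i lts k by (simp add: u_def)
    moreover have "0 \<le> z" using tsn[of i] i k by simp
    ultimately show "z < u \<and> 0 \<le> z" by simp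
  qed
  define g' where "g' = shiftpath u g"
  \<comment> \<open>Times before \<open>u\<close> are now reached only after the old base point,
    hence the added 1.\<close>
  define ts' where "ts' = map (\<lambda>z. z - u) (drop k ts) @ map (\<lambda>z. z - u + 1) (take k ts)"
  have g01: "g 1 = g 0" using g(2) by (simp add: pathfinish_def pathstart_def)
  have gd: "g' (z - u) = g z" if "z < 1" for z using that by (simp add: g'_def shiftpath_def)
  have gt: "g' (z - u + 1) = g z" if "0 \<le> z" for z
    using that g01 by (cases "z = 0") (auto simp: g'_def shiftpath_def)
  have "map g' ts' = xs" unfolding xs ts'_def using dr tk gd gt by simp
  moreover have "sorted_wrt (<) ts'"
  proof -
    have "sorted_wrt (<) (drop k ts)" "sorted_wrt (<) (take k ts)"
      using ts(1) by (simp_all add: sorted_wrt_drop sorted_wrt_take)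
    moreover have "z - u < z' - u + 1" if "z \<in> set (drop k ts)" "z' \<in> set (take k ts)" for z z'
      using dr[OF that(1)] tk[OF that(2)] by linarith
    ultimately show ?thesis unfolding ts'_def by (simp add: sorted_wrt_append sorted_wrt_map)
  qed
  moreover have "set ts' \<subseteq> {0..<1}" unfolding ts'_def using dr tk u by fastforce
  moreover have "g' 0 = xs ! 0"
    using gd[of u] u k lts unfolding xs by (simp add: nth_append u_def)
  ultimately show thesis
    using that[of g' ts'] g u by (simp add: g'_def simple_path_shiftpath path_image_shiftpath
      pathfinish_shiftpath pathstart_shiftpath)
qed

lemma strict_sorted_nth_mono_iff:
  assumes "sorted_wrt (<) (ts :: real list)" "i < length ts" "j < length ts"
  shows "ts ! i < ts ! j \<longleftrightarrow> i < j"
  using sorted_wrt_nth_less[OF assms(1)] assms(2,3)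
  by (metis linorder_neqE_nat not_less_iff_gr_or_eq)

text \<open>\<open>L\<close> gives the position of a crossing along A, \<open>w\<close> reads these
  positions along B, and \<open>S'\<close> holds those of the marked points. As the points
  \<open>x i\<close> occur along A in the order of \<open>i\<close>, the rank of
  \<open>L (x i)\<close> in \<open>S'\<close> is \<open>i\<close>, so the first return of
  \<open>w\<close> reads \<open>v\<close>.\<close>

lemma pl_jordan_realization_meandric:
  assumes real: "pl_jordan_realization n \<sigma> a b S" and n: "n > 0" and \<sigma>: "cyclic_permutation n \<sigma>"
  shows "\<exists>\<tau> S'. cyclic_meandric (card (path_image a \<inter> path_image b)) \<tau> \<and>
    S' \<subseteq> {..<card (path_image a \<inter> path_image b)} \<and> card S' = n \<and>
    first_return (card (path_image a \<inter> path_image b)) \<tau> S' = \<sigma>"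
proof -
  define X where "X = path_image a \<inter> path_image b"
  define N where "N = card X"
  define v where "v = cycle_word n \<sigma>"
  note v = cycle_word_cyclic_permutation[OF \<sigma> n, folded v_def]
  have lv: "length v = n" by (simp add: v_def cycle_word_def)
  from real obtain x where
    ca: "simple_path a" "pathfinish a = pathstart a" "path_image a \<subseteq> sphere 0 1" and
    cb: "simple_path b" "pathfinish b = pathstart b" "path_image b \<subseteq> sphere 0 1" and
    X: "finite X" "\<And>p. p \<in> X \<Longrightarrow> transverse_at (path_image a) (path_image b) p" and
    S: "S \<subseteq> X" "card S = n" and x: "bij_betw x {..<n} S" and
    oa: "in_cyclic_order a (map x [0..<n])" and ob: "in_cyclic_order b (map x v)"
    unfolding pl_jordan_realization_def pl_jordan_curve_def X_def v_def by blast
  obtain a' ta where a': "simple_path a'" "pathfinish a' = pathstart a'" "path_image a' = path_image a"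
    and ta: "sorted_wrt (<) ta" "set ta \<subseteq> {0..<1}" "map x [0..<n] = map a' ta" "a' 0 = map x [0..<n] ! 0"
    using in_cyclic_order_rebase[OF oa _ ca(1,2)] n by auto
  have "map x v \<noteq> []" using lv n by auto
  then obtain b' tb where b': "simple_path b'" "pathfinish b' = pathstart b'" "path_image b' = path_image b"
    and tb: "sorted_wrt (<) tb" "set tb \<subseteq> {0..<1}" "map x v = map b' tb" "b' 0 = map x v ! 0"
    by (rule in_cyclic_order_rebase[OF ob _ cb(1,2)])
  have a0: "a' 0 = x 0" and b0: "b' 0 = x 0" using ta(4) tb(4) n lv v(3) by auto
  have x0X: "x 0 \<in> X" using x S(1) n by (metis bij_betwE lessThan_iff subsetD)
  have lta: "length ta = n" using arg_cong[OF ta(3), of length] by simp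
  have ltb: "length tb = n" using arg_cong[OF tb(3), of length] lv by simp
  have xa: "x i = a' (ta ! i)" if "i < n" for i
    using arg_cong[OF ta(3), of "\<lambda>l. l ! i"] that lta by simp
  have xb: "x (v ! i) = b' (tb ! i)" if "i < n" for i
    using arg_cong[OF tb(3), of "\<lambda>l. l ! i"] that ltb lv by simp
  have Xa: "X \<subseteq> path_image a'" "a' 0 \<in> X" "X \<subseteq> path_image b'" "b' 0 \<in> X"
    using a'(3) b'(3) a0 b0 x0X by (auto simp: X_def)
  obtain s where s0: "s 0 = 0" "s N = 1" and s1: "strict_mono_on {..N} s"
    and s2: "bij_betw (\<lambda>i. a' (s i)) {..<N} X" and s3: "{u \<in> {0..1}. a' u \<in> X} = s ` {..N}"
    using simple_loop_enumerate[OF a'(1,2) X(1) Xa(1,2), folded N_def] by blast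
  have s: "s 0 = 0" "s N = 1" "\<And>i j. i < j \<Longrightarrow> j \<le> N \<Longrightarrow> s i < s j"
    "bij_betw (\<lambda>i. a' (s i)) {..<N} X" "\<And>u. u \<in> {0..1} \<Longrightarrow> a' u \<in> X \<longleftrightarrow> u \<in> s ` {..N}"
    using s0 strict_mono_onD[OF s1] s2 s3 by auto
  obtain t where t0: "t 0 = 0" "t N = 1" and t1: "strict_mono_on {..N} t"
    and t2: "bij_betw (\<lambda>i. b' (t i)) {..<N} X" and t3: "{u \<in> {0..1}. b' u \<in> X} = t ` {..N}"
    using simple_loop_enumerate[OF b'(1,2) X(1) Xa(3,4), folded N_def] by blast
  have t: "t 0 = 0" "t N = 1" "\<And>i j. i < j \<Longrightarrow> j \<le> N \<Longrightarrow> t i < t j"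
    "bij_betw (\<lambda>i. b' (t i)) {..<N} X" "\<And>u. u \<in> {0..1} \<Longrightarrow> b' u \<in> X \<longleftrightarrow> u \<in> t ` {..N}"
    using t0 strict_mono_onD[OF t1] t2 t3 by auto
  define L where "L = inv_into {..<N} (\<lambda>i. a' (s i))"
  have L: "L p < N" "a' (s (L p)) = p" if "p \<in> X" for p
    using bij_betw_inv_into_right[OF s(4) that] bij_betwE[OF bij_betw_inv_into[OF s(4)]] that
    unfolding L_def by auto
  have L': "L (a' (s i)) = i" if "i < N" for i
    using bij_betw_inv_into_left[OF s(4)] that unfolding L_def by simp
  have bijL: "bij_betw L X {..<N}" unfolding L_def by (rule bij_betw_inv_into[OF s(4)])
  have N: "N > 0" using X(1) x0X unfolding N_def by (auto simp: card_gt_0_iff)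
  define w where "w = map (\<lambda>i. L (b' (t i))) [0..<N]"
  have bijw: "bij_betw (\<lambda>i. L (b' (t i))) {..<N} {..<N}"
    using bij_betw_trans[OF t(4) bijL] by (simp add: o_def)
  have w: "distinct w" "set w = {..<N}" "w ! 0 = 0" "length w = N"
    "\<And>i. i < N \<Longrightarrow> w ! i = L (b' (t i))"
    using bijw N t(1) L'[OF N] s(1) a0 b0 unfolding w_def
    by (auto simp: distinct_map bij_betw_def lessThan_atLeast0)
  have btX: "b' (t i) \<in> X" if "i < N" for i using bij_betwE[OF t(4)] that by blast
  have mw: "meandric_word N w"
  proof (rule meandric_word_of_transverse_loops[OF a'(1,2) _ b'(1,2)])
    show "path_image a' \<subseteq> sphere 0 1" "path_image b' \<subseteq> sphere 0 1" using a'(3) b'(3) ca(3) cb(3) by auto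
    show "transverse_at (path_image a') (path_image b') p" if "p \<in> path_image a' \<inter> path_image b'" for p
      using X(2) that unfolding a'(3) b'(3) X_def by blast
    show "b' u \<in> path_image a' \<longleftrightarrow> u \<in> t ` {..N}" if "u \<in> {0..1}" for u
    proof -
      have "b' u \<in> path_image b'" using that by (auto simp: path_image_def)
      then show ?thesis using t(5)[OF that] unfolding a'(3) b'(3) X_def by blast
    qed
    show "a' (s (w ! i)) = b' (t i)" if "i < N" for i using w(5)[OF that] L(2)[OF btX[OF that]] by simp
  qed (use s(1-3) t(1-3) w(1-3) in blast)+
  define S' where "S' = L ` S"
  have S': "S' \<subseteq> {..<N}" using bijL S(1) unfolding S'_def by (auto dest: bij_betwE)
  have injL: "inj_on L X" using bijL by (simp add: bij_betw_def)
  have cS': "card S' = n" unfolding S'_def using card_image[OF inj_on_subset[OF injL S(1)]] S(2) by simp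
  have xS: "x i \<in> S" if "i < n" for i using bij_betwE[OF x] that by blast
  then have xX: "x i \<in> X" if "i < n" for i using S(1) that by blast
  have param: "\<exists>i<N. u = r i" if "u \<in> {0..<1}" "u \<in> r ` {..N}" "r N = 1" for u and r :: "nat \<Rightarrow> real"
    using that by (auto simp: le_less)
  \<comment> \<open>Links the enumeration \<open>s\<close> of all crossings along A with the given
    times \<open>ta\<close> of the marked ones.\<close>
  have sL: "s (L (x i)) = ta ! i" if i: "i < n" for i
  proof -
    have u: "ta ! i \<in> {0..<1}" using ta(2) lta i by (metis nth_mem subsetD)
    then have "ta ! i \<in> s ` {..N}" using s(5)[of "ta ! i"] xX[OF i] xa[OF i] by auto
    then obtain j where j: "j < N" "ta ! i = s j" using param[OF u, of s] s(2) by blast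
    then show ?thesis using L'[of j] xa[OF i] by simp
  qed
  have Lmono: "L (x i) < L (x j) \<longleftrightarrow> i < j" if "i < n" "j < n" for i j
  proof -
    have "L (x i) < L (x j) \<longleftrightarrow> s (L (x i)) < s (L (x j))"
      using s(3)[of "L (x i)" "L (x j)"] s(3)[of "L (x j)" "L (x i)"] L(1)[OF xX[OF that(1)]] L(1)[OF xX[OF that(2)]]
      by (metis less_imp_le linorder_neqE_nat not_less_iff_gr_or_eq)
    then show ?thesis using strict_sorted_nth_mono_iff[OF ta(1)] that lta by (simp add: sL)
  qed
  have S'x: "S' = (\<lambda>i. L (x i)) ` {..<n}" unfolding S'_def using x by (auto simp: bij_betw_def)
  have rank: "card {y \<in> S'. y < L (x i)} = i" if i: "i < n" for i
  proof -
    have "{y \<in> S'. y < L (x i)} = (\<lambda>i. L (x i)) ` {..<i}"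
      unfolding S'x using Lmono i by auto
    moreover have "inj_on (\<lambda>i. L (x i)) {..<i}"
      by (rule inj_onI) (metis Lmono i lessThan_iff less_trans linorder_neqE_nat order_less_irrefl)
    ultimately show ?thesis by (simp add: card_image)
  qed
  have "\<exists>j<N. tb ! k = t j" if k: "k < n" for k
  proof -
    have u: "tb ! k \<in> {0..<1}" using tb(2) ltb k by (metis nth_mem subsetD)
    have "v ! k < n" using v(2) lv k by (metis lessThan_iff nth_mem)
    then have "tb ! k \<in> t ` {..N}" using t(5)[of "tb ! k"] xX[of "v ! k"] xb[OF k] u by auto
    then show ?thesis using param[OF u, of t] t(2) by blast
  qed
  \<comment> \<open>Positions along B of the marked points, increasing because the times
    \<open>tb\<close> are.\<close>
  then obtain idx where idx: "\<And>k. k < n \<Longrightarrow> idx k < N" "\<And>k. k < n \<Longrightarrow> tb ! k = t (idx k)" by metis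
  have vk: "v ! k < n" if "k < n" for k using v(2) lv that by (metis lessThan_iff nth_mem)
  have widx: "w ! idx k = L (x (v ! k))" if "k < n" for k using w(5)[OF idx(1)] xb idx(2) that by simp
  have "sorted_wrt (<) (map idx [0..<n])"
  proof -
    have "idx i < idx j" if "i < j" "j < n" for i j
    proof -
      have "t (idx i) < t (idx j)" using sorted_wrt_nth_less[OF tb(1), of i j] that ltb idx(2)[of i] idx(2)[of j] by simp
      then show ?thesis using t(3)[of "idx j" "idx i"] idx(1)[of i] that
        by (metis less_imp_le less_trans linorder_neqE_nat not_less_iff_gr_or_eq)
    qed
    then show ?thesis by (auto simp: sorted_wrt_iff_nth_less)
  qed
  moreover have "set (map idx [0..<n]) = {i. i < N \<and> w ! i \<in> S'}"
  proof -
    have "i \<in> idx ` {..<n}" if i: "i < N" "w ! i \<in> S'" for i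
    proof -
      obtain l where l: "l < n" "w ! i = L (x l)" using i(2) unfolding S'x by blast
      have "l \<in> set v" using v(2) l(1) by simp
      then obtain k where k: "k < n" "v ! k = l" using lv by (auto simp: in_set_conv_nth)
      then have "w ! i = w ! idx k" using widx l(2) by simp
      then have "i = idx k" using w(1,4) i(1) idx(1)[OF k(1)] by (simp add: nth_eq_iff_index_eq)
      then show ?thesis using k(1) by simp
    qed
    then show ?thesis using idx(1) widx vk unfolding S'x by (auto simp: lessThan_atLeast0)
  qed
  ultimately have f: "filter (\<lambda>i. w ! i \<in> S') [0..<N] = map idx [0..<n]" by (rule filter_upt_sorted_wrt)
  have wm: "map ((!) w) [0..<N] = w" using w(4) map_nth[of w] by simp
  have "filter (\<lambda>y. y \<in> S') w = map ((!) w) (filter (\<lambda>i. w ! i \<in> S') [0..<N])"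
    using filter_map[of "\<lambda>y. y \<in> S'" "(!) w" "[0..<N]"] unfolding wm by (simp add: o_def)
  then have "map (\<lambda>y. card {z \<in> S'. z < y}) (filter (\<lambda>y. y \<in> S') w) = v"
    using rank vk widx lv unfolding f by (intro nth_equalityI) auto
  then have "first_return N (cycle_of_list w) S' = \<sigma>"
    unfolding first_return_def using cyclic_meandric_cycle_of_list(2)[OF mw] v(4) by simp
  then have "cyclic_meandric N (cycle_of_list w) \<and> S' \<subseteq> {..<N} \<and> card S' = n \<and> first_return N (cycle_of_list w) S' = \<sigma>"
    using cyclic_meandric_cycle_of_list(1)[OF mw] S' cS' by blast
  then show ?thesis unfolding N_def X_def by blast
qed

section \<open>Spherical polygons\<close>

text \<open>The clamped factor is the fraction of edge \<open>k\<close> covered by time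
  \<open>t\<close>. A single closed formula makes continuity immediate.\<close>

definition polygon :: "(nat \<Rightarrow> 'a::real_normed_vector) \<Rightarrow> nat \<Rightarrow> real \<Rightarrow> 'a" where
  "polygon v m t = v 0 + (\<Sum>k<m. max 0 (min 1 (t - real k)) *\<^sub>R (v (Suc k) - v k))"

lemma polygon_on_edge:
  assumes "k < m" "real k \<le> t" "t \<le> real k + 1"
  shows "polygon v m t = v k + (t - real k) *\<^sub>R (v (Suc k) - v k)"
  using assms(1)
proof (induction m)
  case (Suc m)
  show ?case
  proof (cases "k = m")
    case True
    have "(\<Sum>j<m. max 0 (min 1 (t - real j)) *\<^sub>R (v (Suc j) - v j)) = (\<Sum>j<m. v (Suc j) - v j)"
    proof (rule sum.cong)
      fix j assume "j \<in> {..<m}"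
      then have "real j + 1 \<le> real k" using True by simp
      then have "max 0 (min 1 (t - real j)) = 1" using assms(2) by simp
      then show "max 0 (min 1 (t - real j)) *\<^sub>R (v (Suc j) - v j) = v (Suc j) - v j" by simp
    qed simp
    also have "\<dots> = v m - v 0" by (rule sum_lessThan_telescope)
    finally show ?thesis using True assms(2,3) by (simp add: polygon_def)
  next
    case False
    then have "polygon v m t = v k + (t - real k) *\<^sub>R (v (Suc k) - v k)" using Suc by simp
    moreover have "real k + 1 \<le> real m" using False Suc.prems by simp
    then have "max 0 (min 1 (t - real m)) = 0" using assms(3) by simp
    ultimately show ?thesis by (simp add: polygon_def)
  qed
qed simp

lemma continuous_on_polygon: "continuous_on A (polygon v m)"
  unfolding polygon_def by (intro continuous_intros)

text \<open>Rescaling the ends keeps a segment in the same cone. This reconciles polygons with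
  vertices anywhere in space with \<open>pl_path\<close>, whose arcs join points of the curve
  itself.\<close>

lemma sgn_closed_segment_scale_subset:
  fixes u v :: "'a::real_normed_vector"
  assumes "\<alpha> > 0" "\<beta> > 0"
  shows "sgn ` closed_segment (\<alpha> *\<^sub>R u) (\<beta> *\<^sub>R v) \<subseteq> sgn ` closed_segment u v"
    "0 \<in> closed_segment (\<alpha> *\<^sub>R u) (\<beta> *\<^sub>R v) \<Longrightarrow> 0 \<in> closed_segment u v"
proof -
  have *: "\<exists>c y. c > 0 \<and> y \<in> closed_segment u v \<and> x = c *\<^sub>R y"
    if x: "x \<in> closed_segment (\<alpha> *\<^sub>R u) (\<beta> *\<^sub>R v)" for x
  proof -
    obtain s where s: "0 \<le> s" "s \<le> 1" "x = (1 - s) *\<^sub>R (\<alpha> *\<^sub>R u) + s *\<^sub>R (\<beta> *\<^sub>R v)"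
      using x by (auto simp: closed_segment_def)
    define c where "c = (1 - s) * \<alpha> + s * \<beta>"
    have c: "c > 0"
    proof (cases "s = 0")
      case True then show ?thesis using assms by (simp add: c_def)
    next
      case False
      then have "s * \<beta> > 0" "(1 - s) * \<alpha> \<ge> 0" using s assms by auto
      then show ?thesis by (simp add: c_def)
    qed
    define y where "y = (1 - s * \<beta> / c) *\<^sub>R u + (s * \<beta> / c) *\<^sub>R v"
    have "s * \<beta> \<le> c" using s assms by (simp add: c_def)
    then have "y \<in> closed_segment u v" unfolding closed_segment_def y_def using s assms c
      by (intro CollectI exI[of _ "s * \<beta> / c"]) auto
    moreover have "c * (1 - s * \<beta> / c) = (1 - s) * \<alpha>" "c * (s * \<beta> / c) = s * \<beta>"
      using c by (simp_all add: field_simps) (simp add: c_def algebra_simps)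
    then have "x = c *\<^sub>R y" unfolding y_def s(3) scaleR_add_right scaleR_scaleR by simp
    ultimately show ?thesis using c by blast
  qed
  show "sgn ` closed_segment (\<alpha> *\<^sub>R u) (\<beta> *\<^sub>R v) \<subseteq> sgn ` closed_segment u v"
  proof
    fix z assume "z \<in> sgn ` closed_segment (\<alpha> *\<^sub>R u) (\<beta> *\<^sub>R v)"
    then obtain x where x: "x \<in> closed_segment (\<alpha> *\<^sub>R u) (\<beta> *\<^sub>R v)" "z = sgn x" by blast
    then obtain c y where "c > 0" "y \<in> closed_segment u v" "x = c *\<^sub>R y" using * by blast
    then show "z \<in> sgn ` closed_segment u v" using x(2) by (simp add: sgn_scaleR)
  qed
  show "0 \<in> closed_segment u v" if "0 \<in> closed_segment (\<alpha> *\<^sub>R u) (\<beta> *\<^sub>R v)"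
    using *[OF that] by auto
qed

lemma geodesic_arc_sgn:
  assumes "0 \<notin> closed_segment u v"
  shows "geodesic_arc (sgn u) (sgn v) = sgn ` closed_segment u v" "0 \<notin> closed_segment (sgn u) (sgn v)"
proof -
  have uv: "u \<noteq> 0" "v \<noteq> 0" using assms by auto
  have s: "sgn u = inverse (norm u) *\<^sub>R u" "sgn v = inverse (norm v) *\<^sub>R v" by (simp_all add: sgn_div_norm)
  have r: "norm u *\<^sub>R sgn u = u" "norm v *\<^sub>R sgn v = v" using uv by (simp_all add: sgn_div_norm)
  show "geodesic_arc (sgn u) (sgn v) = sgn ` closed_segment u v"
    unfolding geodesic_arc_def
    using sgn_closed_segment_scale_subset(1)[of "inverse (norm u)" "inverse (norm v)" u v]
      sgn_closed_segment_scale_subset(1)[of "norm u" "norm v" "sgn u" "sgn v"] uv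
    unfolding r s[symmetric] by auto
  show "0 \<notin> closed_segment (sgn u) (sgn v)"
    using sgn_closed_segment_scale_subset(2)[of "inverse (norm u)" "inverse (norm v)" u v] uv assms
    unfolding s[symmetric] by auto
qed

text \<open>The vertices need not lie on the sphere, so the edges can be straight segments in
  convenient planes. Half-open edges assign each vertex to the edge that starts there; thus one
  condition covers adjacent edges as well, and says that no ray from the origin is met
  twice.\<close>

locale spherical_polygon =
  fixes v :: "nat \<Rightarrow> real^3" and m :: nat
  assumes m_pos: "m > 0" and closed: "v m = v 0"
    and nonzero: "\<And>k. k < m \<Longrightarrow> 0 \<notin> closed_segment (v k) (v (Suc k))"
    and inj: "\<And>k l s r. k < m \<Longrightarrow> l < m \<Longrightarrow> s \<in> {0..<1} \<Longrightarrow> r \<in> {0..<1} \<Longrightarrow>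
      sgn (v k + s *\<^sub>R (v (Suc k) - v k)) = sgn (v l + r *\<^sub>R (v (Suc l) - v l)) \<Longrightarrow> k = l \<and> s = r"
begin

definition curve :: "real \<Rightarrow> real^3" where
  "curve t = sgn (polygon v m (real m * t))"

lemma curve_edge:
  assumes "k < m" "s \<in> {0..1}"
  shows "curve ((real k + s) / real m) = sgn (v k + s *\<^sub>R (v (Suc k) - v k))"
  using polygon_on_edge[of k m "real k + s" v] assms m_pos by (simp add: curve_def)

lemma curve_edge_cases:
  assumes "t \<in> {0..<1}"
  obtains k s where "k < m" "s \<in> {0..<1}" "t = (real k + s) / real m"
proof -
  define k where "k = nat \<lfloor>real m * t\<rfloor>"
  define s where "s = real m * t - real k"
  have nn: "0 \<le> real m * t" using assms by simp
  have k: "real k \<le> real m * t" "real m * t < real k + 1"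
    unfolding k_def using nn by (simp_all add: of_nat_nat)
  have "real m * t < real m" using assms m_pos by simp
  then have "k < m" using k by linarith
  moreover have "s \<in> {0..<1}" "t = (real k + s) / real m" using k m_pos by (auto simp: s_def)
  ultimately show thesis using that by blast
qed

lemma edge_segment: "(\<lambda>s. v k + s *\<^sub>R (v (Suc k) - v k)) ` {0..1} = closed_segment (v k) (v (Suc k))"
  unfolding closed_segment_def by (auto simp: algebra_simps image_iff)

lemma curve_edge_image:
  assumes "k < m"
  shows "curve ` {real k / real m..real (Suc k) / real m} = sgn ` closed_segment (v k) (v (Suc k))"
proof -
  have "{real k / real m..real (Suc k) / real m} = (\<lambda>s. (real k + s) / real m) ` {0..1}"
  proof
    show "{real k / real m..real (Suc k) / real m} \<subseteq> (\<lambda>s. (real k + s) / real m) ` {0..1}"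
    proof
      fix x assume "x \<in> {real k / real m..real (Suc k) / real m}"
      then show "x \<in> (\<lambda>s. (real k + s) / real m) ` {0..1}" using m_pos
        by (intro image_eqI[of _ _ "real m * x - real k"]) (auto simp: field_simps)
    qed
  qed (use m_pos in \<open>auto simp: field_simps\<close>)
  then have "curve ` {real k / real m..real (Suc k) / real m} = (\<lambda>s. sgn (v k + s *\<^sub>R (v (Suc k) - v k))) ` {0..1}"
    using curve_edge[OF assms] by (simp add: image_image)
  then show ?thesis unfolding edge_segment[symmetric] image_image by simp
qed

lemma curve_vertex: "k \<le> m \<Longrightarrow> curve (real k / real m) = sgn (v k)"
  using curve_edge[of k 0] curve_edge[of "m - 1" 1] m_pos by (cases "k = m") (auto simp: of_nat_diff)

lemma path_image_curve: "path_image curve = (\<Union>k<m. sgn ` closed_segment (v k) (v (Suc k)))"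
proof
  show "path_image curve \<subseteq> (\<Union>k<m. sgn ` closed_segment (v k) (v (Suc k)))"
  proof
    fix z assume "z \<in> path_image curve"
    then obtain t where t: "t \<in> {0..1}" "z = curve t" by (auto simp: path_image_def)
    show "z \<in> (\<Union>k<m. sgn ` closed_segment (v k) (v (Suc k)))"
    proof (cases "t = 1")
      case True
      then have "z = sgn (v 0)" using t curve_vertex[of m] m_pos closed by simp
      then show ?thesis using m_pos by auto
    next
      case False
      then obtain k s where ks: "k < m" "s \<in> {0..<1}" "t = (real k + s) / real m"
        using curve_edge_cases[of t] t(1) by auto
      then have "z = sgn (v k + s *\<^sub>R (v (Suc k) - v k))" using curve_edge[of k s] t(2) by simp
      moreover have "v k + s *\<^sub>R (v (Suc k) - v k) \<in> closed_segment (v k) (v (Suc k))"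
        using ks(2) unfolding edge_segment[symmetric] by auto
      ultimately show ?thesis using ks(1) by blast
    qed
  qed
  show "(\<Union>k<m. sgn ` closed_segment (v k) (v (Suc k))) \<subseteq> path_image curve"
  proof clarify
    fix k y assume k: "k < m" and y: "y \<in> closed_segment (v k) (v (Suc k))"
    have "sgn y \<in> curve ` {real k / real m..real (Suc k) / real m}"
      unfolding curve_edge_image[OF k] using y by blast
    moreover have "{real k / real m..real (Suc k) / real m} \<subseteq> {0..1}" using k m_pos by (auto simp: field_simps)
    ultimately show "sgn y \<in> path_image curve" unfolding path_image_def by blast
  qed
qed

lemma pl_jordan_curve_curve: "pl_jordan_curve curve"
proof -
  have nz: "polygon v m (real m * t) \<noteq> 0" if "t \<in> {0..1}" for t
  proof (cases "t = 1")
    case True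
    then have "polygon v m (real m * t) = v m"
      using polygon_on_edge[of "m - 1" m "real m" v] m_pos by (simp add: of_nat_diff)
    then show ?thesis using nonzero[of 0] closed m_pos by auto
  next
    case False
    then have "t \<in> {0..<1}" using that by simp
    then obtain k s where ks: "k < m" "s \<in> {0..<1}" "t = (real k + s) / real m"
      by (rule curve_edge_cases)
    then have "polygon v m (real m * t) = v k + s *\<^sub>R (v (Suc k) - v k)"
      using polygon_on_edge[of k m "real k + s" v] m_pos by simp
    moreover have "v k + s *\<^sub>R (v (Suc k) - v k) \<in> closed_segment (v k) (v (Suc k))"
      using ks(2) unfolding edge_segment[symmetric] by auto
    ultimately show ?thesis using nonzero[OF ks(1)] by metis
  qed
  have "continuous_on {0..1} (\<lambda>t. polygon v m (real m * t))"
    by (intro continuous_on_compose2[OF continuous_on_polygon[of UNIV]] continuous_intros) auto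
  then have cont: "path curve" unfolding path_def curve_def using nz by (intro continuous_on_sgn) auto
  have loop: "curve 1 = curve 0"
    using curve_vertex[of m] curve_vertex[of 0] m_pos closed by simp
  have injc: "t = u" if tu: "t \<in> {0..<1}" "u \<in> {0..<1}" "curve t = curve u" for t u
  proof -
    obtain k s where ks: "k < m" "s \<in> {0..<1}" "t = (real k + s) / real m"
      using curve_edge_cases[OF tu(1)] .
    obtain l r where lr: "l < m" "r \<in> {0..<1}" "u = (real l + r) / real m"
      using curve_edge_cases[OF tu(2)] .
    have "k = l \<and> s = r"
      using ks lr tu(3) curve_edge[of k s] curve_edge[of l r] by (intro inj) auto
    then show ?thesis using ks lr by simp
  qed
  have "loop_free curve" unfolding loop_free_def
  proof (intro ballI impI)
    fix x y :: real assume xy: "x \<in> {0..1}" "y \<in> {0..1}" "curve x = curve y"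
    \<comment> \<open>Parameter 1 is replaced by 0 to reach the half-open interval of
      \<open>injc\<close>.\<close>
    define x' y' where "x' = (if x = 1 then 0 else x)" and "y' = (if y = 1 then 0 else y)"
    have "x' \<in> {0..<1}" "y' \<in> {0..<1}" "curve x' = curve y'"
      using xy loop by (auto simp: x'_def y'_def)
    then have "x' = y'" using injc by blast
    then show "x = y \<or> x = 0 \<and> y = 1 \<or> x = 1 \<and> y = 0" by (auto simp: x'_def y'_def split: if_splits)
  qed
  moreover have "path_image curve \<subseteq> sphere 0 1"
    using nz by (auto simp: path_image_def curve_def norm_sgn)
  moreover have "pl_path curve"
    unfolding pl_path_def
  proof (intro exI[of _ m] exI[of _ "\<lambda>i. real i / real m"] conjI allI impI)
    fix i assume i: "i < m"
    have e: "curve (real i / real m) = sgn (v i)" "curve (real (Suc i) / real m) = sgn (v (Suc i))"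
      using curve_vertex[of i] curve_vertex[of "Suc i"] i by auto
    show "real i / real m < real (Suc i) / real m" using m_pos by (simp add: divide_strict_right_mono)
    show "0 \<notin> closed_segment (curve (real i / real m)) (curve (real (Suc i) / real m))"
      unfolding e by (rule geodesic_arc_sgn(2)[OF nonzero[OF i]])
    show "curve ` {real i / real m..real (Suc i) / real m} =
        geodesic_arc (curve (real i / real m)) (curve (real (Suc i) / real m))"
      unfolding curve_edge_image[OF i] e geodesic_arc_sgn(1)[OF nonzero[OF i]] ..
  qed (use m_pos in auto)
  ultimately show ?thesis unfolding pl_jordan_curve_def simple_path_def
    using cont loop by (simp add: pathstart_def pathfinish_def)
qed

end

section \<open>Drawing a meandric word\<close>

abbreviation pt :: "real \<Rightarrow> real \<Rightarrow> real \<Rightarrow> real^3" where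
  "pt x y z \<equiv> vector [x, y, z]"

lemma vec3_eq_iff: "u = v \<longleftrightarrow> u $ 1 = v $ 1 \<and> u $ 2 = v $ 2 \<and> u $ 3 = v $ 3" for u v :: "real^3"
  by (simp add: vec_eq_iff forall_3)

lemma sgn_eqE:
  fixes u v :: "'a::real_normed_vector"
  assumes "sgn u = sgn v" "u \<noteq> 0" "v \<noteq> 0"
  obtains c where "c > 0" "u = c *\<^sub>R v"
proof
  have "u = norm u *\<^sub>R sgn u" using assms(2) by (simp add: sgn_div_norm)
  also have "\<dots> = (norm u / norm v) *\<^sub>R v" unfolding assms(1) by (simp add: sgn_div_norm divide_inverse)
  finally show "u = (norm u / norm v) *\<^sub>R v" .
  show "norm u / norm v > 0" using assms(2,3) by simp
qed

text \<open>A triangle around the origin in the plane z = 0, so that it projects to the equator. Its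
  base on y = -1 has half-length \<open>L\<close> and will carry all crossings. The last case also
  closes the polygon at \<open>k = 3\<close>.\<close>

definition triangle_vertex :: "real \<Rightarrow> nat \<Rightarrow> real^3" where
  "triangle_vertex L k = (if k = 1 then pt L (-1) 0 else if k = 2 then pt 0 1 0 else pt (-L) (-1) 0)"

lemma triangle_edge:
  "triangle_vertex L 0 + s *\<^sub>R (triangle_vertex L (Suc 0) - triangle_vertex L 0) = pt (L * (2 * s - 1)) (-1) 0"
  "triangle_vertex L 1 + s *\<^sub>R (triangle_vertex L (Suc 1) - triangle_vertex L 1) = pt (L * (1 - s)) (2 * s - 1) 0"
  "triangle_vertex L 2 + s *\<^sub>R (triangle_vertex L (Suc 2) - triangle_vertex L 2) = pt (L * (- s)) (1 - 2 * s) 0"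
  by (simp_all add: triangle_vertex_def vec3_eq_iff algebra_simps)

lemma closed_segment_eq_edge: "closed_segment u v = (\<lambda>s. u + s *\<^sub>R (v - u)) ` {0..1}"
  for u v :: "'a::real_vector"
proof -
  have "(1 - s) *\<^sub>R u + s *\<^sub>R v = u + s *\<^sub>R (v - u)" for s by (simp add: algebra_simps)
  then show ?thesis by (auto simp: closed_segment_def)
qed

lemma spherical_polygon_triangle:
  assumes L: "L > 0"
  shows "spherical_polygon (triangle_vertex L) 3"
proof
  show "triangle_vertex L 3 = triangle_vertex L 0" by (simp add: triangle_vertex_def)
  have edge_nz: "triangle_vertex L k + s *\<^sub>R (triangle_vertex L (Suc k) - triangle_vertex L k) \<noteq> 0" if k: "k < 3" for k s
  proof -
    consider "k = 0" | "k = 1" | "k = 2" using k by linarith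
    then show ?thesis
    proof cases
      case 1 then show ?thesis unfolding 1 triangle_edge by (simp add: vec3_eq_iff)
    next
      case 2 show ?thesis unfolding 2 triangle_edge using L by (auto simp: vec3_eq_iff)
    next
      case 3 show ?thesis unfolding 3 triangle_edge using L by (auto simp: vec3_eq_iff)
    qed
  qed
  show "0 \<notin> closed_segment (triangle_vertex L k) (triangle_vertex L (Suc k))" if "k < 3" for k
  proof
    assume "0 \<in> closed_segment (triangle_vertex L k) (triangle_vertex L (Suc k))"
    then obtain s where "0 = triangle_vertex L k + s *\<^sub>R (triangle_vertex L (Suc k) - triangle_vertex L k)"
      unfolding closed_segment_eq_edge by blast
    then show False using edge_nz[OF that, of s] by simp
  qed
  \<comment> \<open>By symmetry \<open>k \<le> l\<close>. Points on a common ray agree up to one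
    factor \<open>c\<close>, and comparing coordinates settles each pair of edges.\<close>
  have key: "k = l \<and> s = r"
    if kl: "k \<le> l" "l < 3" and s: "s \<in> {0..<1}" and r: "r \<in> {0..<1}"
      and eq: "sgn (triangle_vertex L k + s *\<^sub>R (triangle_vertex L (Suc k) - triangle_vertex L k)) =
        sgn (triangle_vertex L l + r *\<^sub>R (triangle_vertex L (Suc l) - triangle_vertex L l))" for k l s r
  proof -
    obtain c where c: "c > 0" and e: "triangle_vertex L k + s *\<^sub>R (triangle_vertex L (Suc k) - triangle_vertex L k) =
        c *\<^sub>R (triangle_vertex L l + r *\<^sub>R (triangle_vertex L (Suc l) - triangle_vertex L l))"
      using sgn_eqE[OF eq edge_nz[OF le_less_trans[OF kl]] edge_nz[OF kl(2)]] .
    have L2: "L * x = c * (L * y) \<longleftrightarrow> x = c * y" for x y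
    proof -
      have "c * (L * y) = L * (c * y)" by simp
      then show ?thesis using L by simp
    qed
    have cr: "c * r \<ge> 0" "c * r < c" using c r by auto
    consider "k = 0" "l = 0" | "k = 0" "l = 1" | "k = 0" "l = 2" | "k = 1" "l = 1" | "k = 1" "l = 2" | "k = 2" "l = 2"
      using kl by linarith
    then show ?thesis
    proof cases
      case 1
      have "2 * s - 1 = c * (2 * r - 1)" "-1 = c * (-1)" using e unfolding 1 triangle_edge vec3_eq_iff by (simp_all add: L2)
      then show ?thesis using 1 by simp
    next
      case 2
      have "2 * s - 1 = c * (1 - r)" "-1 = c * (2 * r - 1)" using e unfolding 2 triangle_edge vec3_eq_iff by (simp_all add: L2)
      then show ?thesis using s cr by (simp add: algebra_simps)
    next
      case 3
      have "L * (2 * s - 1) = c * (L * (- r))" and "-1 = c * (1 - 2 * r)"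
        using e unfolding 3 triangle_edge vec3_eq_iff by simp_all
      moreover from this have "2 * s - 1 = c * (- r)" using L2 by blast
      ultimately have "2 * s - 1 = c * (- r)" "-1 = c * (1 - 2 * r)" by blast+
      then show ?thesis using s cr by (simp add: algebra_simps)
    next
      case 4
      have "1 - s = c * (1 - r)" "2 * s - 1 = c * (2 * r - 1)" using e unfolding 4 triangle_edge vec3_eq_iff by (simp_all add: L2)
      moreover from this have "c = 1" by (simp add: algebra_simps)
      ultimately show ?thesis using 4 by simp
    next
      case 5
      have "L * (1 - s) = c * (L * (- r))" using e unfolding 5 triangle_edge vec3_eq_iff by simp
      then have "1 - s = c * (- r)" using L2 by blast
      then show ?thesis using s cr by simp
    next
      case 6
      have "L * (- s) = c * (L * (- r))" and d: "1 - 2 * s = c * (1 - 2 * r)"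
        using e unfolding 6 triangle_edge vec3_eq_iff by simp_all
      then have "- s = c * (- r)" using L2 by blast
      moreover from this d have "c = 1" by (simp add: algebra_simps)
      ultimately show ?thesis using 6 by simp
    qed
  qed
  show "k = l \<and> s = r"
    if "k < 3" "l < 3" "s \<in> {0..<1}" "r \<in> {0..<1}"
      "sgn (triangle_vertex L k + s *\<^sub>R (triangle_vertex L (Suc k) - triangle_vertex L k)) =
        sgn (triangle_vertex L l + r *\<^sub>R (triangle_vertex L (Suc l) - triangle_vertex L l))" for k l s r
    using key[of k l s r] key[of l k r s] that by (metis nat_le_linear)
qed simp

text \<open>The origin is interior to the convex region above the parabola y = x^2 - 1, so along a
  ray from it the boundary point comes after every other point of the region.\<close>

lemma parabola_ray_ge:
  fixes a c x y :: real
  assumes "c > 0" "a = c * x" "a\<^sup>2 - 1 = c * y" "y \<ge> x\<^sup>2 - 1"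
  shows "c \<ge> 1"
proof -
  have "c * y \<ge> c * (x\<^sup>2 - 1)" using assms(1,4) by simp
  then have "0 \<le> (c - 1) * (c * x\<^sup>2 + 1)"
    unfolding assms(3)[symmetric] assms(2) by (simp add: power2_eq_square algebra_simps)
  moreover have "c * x\<^sup>2 + 1 > 0" using assms(1) by (simp add: add_nonneg_pos)
  ultimately show ?thesis by (simp add: zero_le_mult_iff)
qed

text \<open>The products are the heights over the parabola, at abscissa \<open>x\<close>, of the
  chords with ends \<open>p, q\<close> and \<open>p', q'\<close>; the inner chord is strictly
  lower.\<close>

lemma nested_chords_disjoint:
  fixes x p q p' q' :: real
  assumes "p < p'" "q' < q" "p' \<le> x" "x \<le> q'"
  shows "(x - p') * (q' - x) < (x - p) * (q - x)"
proof -
  have "(x - p') * (q' - x) \<le> (x - p') * (q - x)" using assms by (intro mult_left_mono) auto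
  also have "\<dots> < (x - p) * (q - x)" using assms by (intro mult_strict_right_mono) auto
  finally show ?thesis .
qed

section \<open>The closed polygon of a meandric word\<close>

locale meandric_curves =
  fixes N :: nat and w :: "nat list"
  assumes meandric: "meandric_word N w"
begin

lemma N: "even N" "N > 0" "N \<ge> 2"
proof -
  show e: "even N" "N > 0" using meandric unfolding meandric_word_def by blast+
  then show "N \<ge> 2" by presburger
qed

lemma w: "distinct w" "length w = N" "\<And>i. i < N \<Longrightarrow> w ! i < N"
  "\<And>i j. i < N \<Longrightarrow> j < N \<Longrightarrow> w ! i = w ! j \<longleftrightarrow> i = j" "\<And>j. j < N \<Longrightarrow> \<exists>i<N. w ! i = j"
proof -
  show d: "distinct w" and l: "length w = N"
    using meandric distinct_card[of w] unfolding meandric_word_def by auto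
  have "set w = {..<N}" using meandric unfolding meandric_word_def by auto
  then show "\<And>i. i < N \<Longrightarrow> w ! i < N" "\<And>j. j < N \<Longrightarrow> \<exists>i<N. w ! i = j"
    using l by (metis lessThan_iff nth_mem) (metis l \<open>set w = {..<N}\<close> in_set_conv_nth lessThan_iff)
  show "\<And>i j. i < N \<Longrightarrow> j < N \<Longrightarrow> w ! i = w ! j \<longleftrightarrow> i = j" using d l by (simp add: nth_eq_iff_index_eq)
qed

definition next_idx :: "nat \<Rightarrow> nat" where "next_idx i = Suc i mod N"

lemma next_idx: "next_idx i < N" "even (next_idx i) \<longleftrightarrow> odd i" "i < N \<Longrightarrow> j < N \<Longrightarrow> next_idx i = next_idx j \<longleftrightarrow> i = j"
proof -
  show "next_idx i < N" using N by (simp add: next_idx_def)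
  show "even (next_idx i) \<longleftrightarrow> odd i" using N(1) by (simp add: next_idx_def dvd_mod_iff)
  show "i < N \<Longrightarrow> j < N \<Longrightarrow> next_idx i = next_idx j \<longleftrightarrow> i = j"
    unfolding next_idx_def by (cases "Suc i = N"; cases "Suc j = N") auto
qed

text \<open>Treats both matchings at once: arc \<open>i\<close> joins \<open>w ! i\<close> to its
  cyclic successor, and the parity of \<open>i\<close> selects the matching.\<close>

lemma arcs_not_interleaved:
  assumes "i < N" "j < N" "even i = even j" "{a1, b1} = {w ! i, w ! next_idx i}" "{a2, b2} = {w ! j, w ! next_idx j}"
  shows "\<not> (a1 < a2 \<and> a2 < b1 \<and> b1 < b2)"
proof -
  define M where "M = (if even i then {{w ! (2 * i), w ! (2 * i + 1)} |i. i < N div 2}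
    else {{w ! (2 * i + 1), w ! ((2 * i + 2) mod N)} |i. i < N div 2})"
  have nc: "non_crossing M" using meandric unfolding meandric_word_def M_def by auto
  have "{w ! k, w ! next_idx k} \<in> M" if k: "k < N" "even k = even i" for k
  proof (cases "even i")
    case True
    then obtain l where l: "k = 2 * l" using k by (auto elim: evenE)
    have "Suc k < N" using k(1) N(1) l by (metis Suc_lessI dvd_triv_left even_Suc)
    then have "w ! next_idx k = w ! (2 * l + 1)" by (simp add: next_idx_def l)
    moreover have "l < N div 2" using l k(1) N(1) by (auto elim!: evenE)
    ultimately show ?thesis using True unfolding M_def l by auto
  next
    case False
    then obtain l where l: "k = 2 * l + 1" using k by (auto elim: oddE)
    then have "w ! next_idx k = w ! ((2 * l + 2) mod N)" by (simp add: next_idx_def)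
    moreover have "l < N div 2" using l k(1) N(1) by (auto elim!: evenE)
    ultimately show ?thesis using False unfolding M_def l by auto
  qed
  then have "{a1, b1} \<in> M" "{a2, b2} \<in> M" using assms by auto
  then show ?thesis using nc unfolding non_crossing_def by blast
qed

text \<open>Abscissae in [0,1), increasing with the label; the parabola then has y < 0 over them, so
  the posts face the base of the triangle.\<close>

definition absc :: "nat \<Rightarrow> real" where "absc j = real j / real N"

definition post :: "nat \<Rightarrow> real \<Rightarrow> real^3" where "post j z = pt (absc j) ((absc j)\<^sup>2 - 1) z"

definition level :: "nat \<Rightarrow> real" where "level i = (if even i then 1 else -1)"

lemma absc: "absc i = absc j \<longleftrightarrow> i = j" "absc i < absc j \<longleftrightarrow> i < j" "0 \<le> absc i" "i < N \<Longrightarrow> absc i < 1"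
  "absc i \<le> absc j \<longleftrightarrow> i \<le> j"
  using N by (auto simp: absc_def divide_simps)

lemma absc_sq: "i < N \<Longrightarrow> (absc i)\<^sup>2 < 1"
  using absc(3)[of i] absc(4)[of i] by (simp add: power_less_one_iff abs_square_less_1)

lemma level: "level i \<noteq> 0" "\<bar>level i\<bar> = 1" "level i = level j \<longleftrightarrow> even i = even j" "level (Suc i) = - level i"
  by (auto simp: level_def)

text \<open>Each crossing is a vertical segment on the cylinder over a parabola; consecutive ones are joined
  by chords of the parabola, alternately in the top and the bottom plane.\<close>

definition meander_vertex :: "nat \<Rightarrow> real^3" where
  "meander_vertex k = post (w ! (k div 2 mod N)) (if even k then - level (k div 2) else level (k div 2))"

definition chord :: "nat \<Rightarrow> real \<Rightarrow> real^3" where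
  "chord i s = pt ((1 - s) * absc (w ! i) + s * absc (w ! next_idx i))
     ((1 - s) * (absc (w ! i))\<^sup>2 + s * (absc (w ! next_idx i))\<^sup>2 - 1) (level i)"

text \<open>Levels alternate, so each post runs from the plane of the previous chord to that of the
  next.\<close>

lemma meander_edge:
  assumes "i < N"
  shows "meander_vertex (2 * i) + s *\<^sub>R (meander_vertex (Suc (2 * i)) - meander_vertex (2 * i)) =
      post (w ! i) (level i * (2 * s - 1))"
    "meander_vertex (2 * i + 1) + s *\<^sub>R (meander_vertex (Suc (2 * i + 1)) - meander_vertex (2 * i + 1)) = chord i s"
proof -
  have v: "meander_vertex (2 * i) = post (w ! i) (- level i)" "meander_vertex (Suc (2 * i)) = post (w ! i) (level i)"
    "meander_vertex (Suc (Suc (2 * i))) = post (w ! next_idx i) (level i)"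
    using assms by (simp_all add: meander_vertex_def next_idx_def level(4))
  show "meander_vertex (2 * i) + s *\<^sub>R (meander_vertex (Suc (2 * i)) - meander_vertex (2 * i)) =
      post (w ! i) (level i * (2 * s - 1))"
    unfolding v by (simp add: post_def vec3_eq_iff algebra_simps)
  show "meander_vertex (2 * i + 1) + s *\<^sub>R (meander_vertex (Suc (2 * i + 1)) - meander_vertex (2 * i + 1)) = chord i s"
    unfolding Suc_eq_plus1[symmetric] v by (simp add: post_def chord_def vec3_eq_iff algebra_simps)
qed

text \<open>The height of a chord over the parabola in two forms: the first shows that it is
  nonnegative and vanishes only at the ends, the second depends on the abscissa alone and compares
  two chords at a common point.\<close>

lemma chord_parabola:
  "chord i s $ 2 - (chord i s $ 1)\<^sup>2 + 1 = s * (1 - s) * (absc (w ! next_idx i) - absc (w ! i))\<^sup>2"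
  "chord i s $ 2 - (chord i s $ 1)\<^sup>2 + 1 = (chord i s $ 1 - absc (w ! i)) * (absc (w ! next_idx i) - chord i s $ 1)"
  by (simp_all add: chord_def power2_eq_square algebra_simps)

lemma chord_above: "0 \<le> s \<Longrightarrow> s \<le> 1 \<Longrightarrow> chord i s $ 2 \<ge> (chord i s $ 1)\<^sup>2 - 1"
proof -
  assume "0 \<le> s" "s \<le> 1"
  then have "0 \<le> s * (1 - s) * (absc (w ! next_idx i) - absc (w ! i))\<^sup>2" by simp
  then show ?thesis using chord_parabola(1)[of i s] by linarith
qed

lemma ends_distinct: "i < N \<Longrightarrow> w ! i \<noteq> w ! next_idx i"
  using w(4)[of i "next_idx i"] next_idx(1,2)[of i] by auto

lemma chord_between:
  assumes "0 \<le> s" "s \<le> 1"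
  shows "absc (min (w ! i) (w ! next_idx i)) \<le> chord i s $ 1" "chord i s $ 1 \<le> absc (max (w ! i) (w ! next_idx i))"
proof -
  let ?a = "absc (w ! i)" and ?b = "absc (w ! next_idx i)"
  have m: "absc (min (w ! i) (w ! next_idx i)) = min ?a ?b" "absc (max (w ! i) (w ! next_idx i)) = max ?a ?b"
    by (auto simp: min_def max_def absc)
  have X: "chord i s $ 1 = (1 - s) * ?a + s * ?b" by (simp add: chord_def)
  have "(1 - s) * min ?a ?b + s * min ?a ?b \<le> (1 - s) * ?a + s * ?b"
    using assms by (intro add_mono mult_left_mono) auto
  then show "absc (min (w ! i) (w ! next_idx i)) \<le> chord i s $ 1" unfolding m X by (simp add: algebra_simps)
  have "(1 - s) * ?a + s * ?b \<le> (1 - s) * max ?a ?b + s * max ?a ?b"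
    using assms by (intro add_mono mult_left_mono) auto
  then show "chord i s $ 1 \<le> absc (max (w ! i) (w ! next_idx i))" unfolding m X by (simp add: algebra_simps)
qed

text \<open>Equal heights z force equal parity, and distinct arcs of one matching have four
  different ends. Disjoint label intervals have no common abscissa, interleaved ones are excluded by
  the word, and nested ones differ in height over the parabola.\<close>

lemma chord_inj:
  assumes ij: "i < N" "j < N" and s: "s \<in> {0..<1}" "r \<in> {0..<1}" and eq: "chord i s = chord j r"
  shows "i = j \<and> s = r"
proof (cases "i = j")
  case True
  have "absc (w ! i) + s * (absc (w ! next_idx i) - absc (w ! i)) = absc (w ! i) + r * (absc (w ! next_idx i) - absc (w ! i))"
    using arg_cong[OF eq, of "\<lambda>v. v $ 1"] True by (simp add: chord_def algebra_simps)
  then show ?thesis using True absc(1) ends_distinct[OF ij(1)] by auto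
next
  case False
  have par: "even i = even j" using arg_cong[OF eq, of "\<lambda>v. v $ 3"] level(3)[of i j] by (simp add: chord_def)
  define a b c d where "a = min (w ! i) (w ! next_idx i)" and "b = max (w ! i) (w ! next_idx i)"
    and "c = min (w ! j) (w ! next_idx j)" and "d = max (w ! j) (w ! next_idx j)"
  have sets: "{a, b} = {w ! i, w ! next_idx i}" "{c, d} = {w ! j, w ! next_idx j}"
    by (auto simp: a_def b_def c_def d_def min_def max_def)
  have lt: "a < b" "c < d" using ends_distinct[OF ij(1)] ends_distinct[OF ij(2)]
    by (auto simp: a_def b_def c_def d_def min_def max_def)
  have dis: "{a, b} \<inter> {c, d} = {}"
    unfolding sets using w(4) next_idx(1) next_idx(3)[OF ij] ij False par next_idx(2)[of i] next_idx(2)[of j] by auto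
  have n1: "\<not> (a < c \<and> c < b \<and> b < d)" by (rule arcs_not_interleaved[OF ij par sets])
  have n2: "\<not> (c < a \<and> a < d \<and> d < b)" by (rule arcs_not_interleaved[OF ij(2,1) par[symmetric] sets(2,1)])
  define X where "X = chord i s $ 1"
  have "(X - absc (w ! i)) * (absc (w ! next_idx i) - X) = (X - absc (w ! j)) * (absc (w ! next_idx j) - X)"
    using chord_parabola(2)[of i s] chord_parabola(2)[of j r] unfolding X_def eq by simp
  moreover have "(X - absc (w ! i)) * (absc (w ! next_idx i) - X) = (X - absc a) * (absc b - X)"
    "(X - absc (w ! j)) * (absc (w ! next_idx j) - X) = (X - absc c) * (absc d - X)"
    by (simp_all add: a_def b_def c_def d_def min_def max_def algebra_simps)
  ultimately have prod: "(X - absc a) * (absc b - X) = (X - absc c) * (absc d - X)" by simp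
  have bet: "absc a \<le> X" "X \<le> absc b" "absc c \<le> X" "X \<le> absc d"
    using chord_between[of s i] chord_between[of r j] s eq by (auto simp: X_def a_def b_def c_def d_def)
  have "\<not> b < c" using bet absc(2)[of b c] by linarith
  moreover have "\<not> d < a" using bet absc(2)[of d a] by linarith
  moreover have "a \<noteq> c" "a \<noteq> d" "b \<noteq> c" "b \<noteq> d" using dis by auto
  ultimately consider "a < c" "d < b" | "c < a" "b < d" using n1 n2 lt by linarith
  then show ?thesis
  proof cases
    case 1
    then have "(X - absc c) * (absc d - X) < (X - absc a) * (absc b - X)"
      using absc(2) bet by (intro nested_chords_disjoint) auto
    then show ?thesis using prod by simp
  next
    case 2
    then have "(X - absc a) * (absc b - X) < (X - absc c) * (absc d - X)"
      using absc(2) bet by (intro nested_chords_disjoint) auto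
    then show ?thesis using prod by simp
  qed
qed

lemma edge_cases:
  assumes "k < 2 * N"
  obtains i where "i < N" "k = 2 * i" | i where "i < N" "k = 2 * i + 1"
  using assms by (cases "even k") (auto elim!: evenE oddE)

lemma post_chord_nonzero: "i < N \<Longrightarrow> post i z \<noteq> 0" "chord i s \<noteq> 0"
  using absc_sq[of i] level(1)[of i] by (auto simp: post_def chord_def vec3_eq_iff)

text \<open>A ray from inside the parabola meets it only once, so the factor \<open>c\<close> is
  1.\<close>

lemma post_inj:
  assumes "i < N" "j < N" "c > 0" "post i z = c *\<^sub>R post j z'"
  shows "i = j \<and> z = z'"
proof -
  have e: "absc i = c * absc j" "(absc i)\<^sup>2 - 1 = c * ((absc j)\<^sup>2 - 1)" "z = c * z'"
    using assms(4) by (auto simp: post_def vec3_eq_iff)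
  have "(c - 1) * (c * (absc j)\<^sup>2 + 1) = 0" using e(2) unfolding e(1) by (simp add: power2_eq_square algebra_simps)
  moreover have "c * (absc j)\<^sup>2 + 1 > 0" using assms(3) by (simp add: add_nonneg_pos)
  ultimately have "c = 1" by auto
  then show ?thesis using e absc(1) by simp
qed

text \<open>The third coordinates give \<open>c = \<bar>2 * s - 1\<bar> \<le> 1\<close> and the
  parabola gives \<open>c \<ge> 1\<close>. So both points are starting points, \<open>s = 0\<close>
  and \<open>r = 0\<close>, over the same label; but post \<open>i\<close> and chord
  \<open>i\<close> start at opposite levels.\<close>

lemma post_chord:
  assumes ij: "i < N" "j < N" and s: "s \<in> {0..<1}" "r \<in> {0..<1}"
    and c: "c > 0" "post (w ! i) (level i * (2 * s - 1)) = c *\<^sub>R chord j r"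
  shows False
proof -
  have e: "absc (w ! i) = c * chord j r $ 1" "(absc (w ! i))\<^sup>2 - 1 = c * chord j r $ 2"
    "level i * (2 * s - 1) = c * level j"
    using c(2) by (auto simp: post_def vec3_eq_iff chord_def)
  have "c = \<bar>2 * s - 1\<bar>" using arg_cong[OF e(3), of abs] level(2) c(1) by (simp add: abs_mult)
  then have "c \<le> 1" using s by auto
  moreover have "c \<ge> 1"
    using parabola_ray_ge[OF c(1) e(1,2)] chord_above[of r j] s by simp
  ultimately have c1: "c = 1" by simp
  then have "s = 0" using \<open>c = \<bar>2 * s - 1\<bar>\<close> s by auto
  then have lev: "level j = - level i" using e(3) c1 by simp
  have "r * (1 - r) * (absc (w ! next_idx j) - absc (w ! j))\<^sup>2 = 0"
  proof -
    have "(chord j r $ 1)\<^sup>2 - 1 = chord j r $ 2" using e(1,2) c1 by simp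
    then show ?thesis unfolding chord_parabola(1)[symmetric] by linarith
  qed
  moreover have "absc (w ! next_idx j) \<noteq> absc (w ! j)" using absc(1) ends_distinct[OF ij(2)] by auto
  ultimately have "r = 0" using s by auto
  then have "absc (w ! i) = absc (w ! j)" using e(1) c1 by (simp add: chord_def)
  then have "i = j" using absc(1) w(4) ij by simp
  then show False using lev level(1)[of i] by simp
qed

lemma spherical_polygon_meander: "spherical_polygon meander_vertex (2 * N)"
proof
  show "2 * N > 0" using N by simp
  show "meander_vertex (2 * N) = meander_vertex 0" using N by (simp add: meander_vertex_def level_def)
  have edge_nz: "meander_vertex k + s *\<^sub>R (meander_vertex (Suc k) - meander_vertex k) \<noteq> 0" if k: "k < 2 * N" for k s
    using k by (rule edge_cases) (use meander_edge post_chord_nonzero w(3) in auto)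
  show "0 \<notin> closed_segment (meander_vertex k) (meander_vertex (Suc k))" if "k < 2 * N" for k
  proof
    assume "0 \<in> closed_segment (meander_vertex k) (meander_vertex (Suc k))"
    then obtain s where "0 = meander_vertex k + s *\<^sub>R (meander_vertex (Suc k) - meander_vertex k)"
      unfolding closed_segment_eq_edge by blast
    then show False using edge_nz[OF that, of s] by simp
  qed
  fix k l s r
  assume k: "k < 2 * N" and l: "l < 2 * N" and s: "s \<in> {0..<1::real}" and r: "r \<in> {0..<1::real}"
    and eq: "sgn (meander_vertex k + s *\<^sub>R (meander_vertex (Suc k) - meander_vertex k)) =
      sgn (meander_vertex l + r *\<^sub>R (meander_vertex (Suc l) - meander_vertex l))"
  obtain c where c: "c > 0" and e: "meander_vertex k + s *\<^sub>R (meander_vertex (Suc k) - meander_vertex k) =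
      c *\<^sub>R (meander_vertex l + r *\<^sub>R (meander_vertex (Suc l) - meander_vertex l))"
    using sgn_eqE[OF eq edge_nz[OF k] edge_nz[OF l]] .
  \<comment> \<open>The equation solved for the other point, so that a chord against a post also
    reduces to \<open>post_chord\<close>.\<close>
  have e': "meander_vertex l + r *\<^sub>R (meander_vertex (Suc l) - meander_vertex l) =
      inverse c *\<^sub>R (meander_vertex k + s *\<^sub>R (meander_vertex (Suc k) - meander_vertex k))"
    unfolding e using c by simp
  have c': "inverse c > 0" using c by simp
  from k show "k = l \<and> s = r"
  proof (rule edge_cases)
    fix i assume i: "i < N" "k = 2 * i"
    from l show ?thesis
    proof (rule edge_cases)
      fix j assume j: "j < N" "l = 2 * j"
      have "w ! i = w ! j \<and> level i * (2 * s - 1) = level j * (2 * r - 1)"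
        using e unfolding i(2) j(2) meander_edge[OF i(1)] meander_edge[OF j(1)]
        by (rule post_inj[OF w(3)[OF i(1)] w(3)[OF j(1)] c])
      then show ?thesis using w(4)[OF i(1) j(1)] i j level(1)[of j] by auto
    next
      fix j assume j: "j < N" "l = 2 * j + 1"
      have False using e unfolding i(2) j(2) meander_edge[OF i(1)] meander_edge[OF j(1)]
        by (rule post_chord[OF i(1) j(1) s r c])
      then show ?thesis ..
    qed
  next
    fix i assume i: "i < N" "k = 2 * i + 1"
    from l show ?thesis
    proof (rule edge_cases)
      fix j assume j: "j < N" "l = 2 * j"
      have False using e' unfolding i(2) j(2) meander_edge[OF i(1)] meander_edge[OF j(1)]
        by (rule post_chord[OF j(1) i(1) r s c'])
      then show ?thesis ..
    next
      fix j assume j: "j < N" "l = 2 * j + 1"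
      have ee: "chord i s = c *\<^sub>R chord j r"
        using e unfolding i(2) j(2) meander_edge[OF i(1)] meander_edge[OF j(1)] .
      \<comment> \<open>Both chords lie at height 1 or -1, so the positive factor must be 1.\<close>
      have "level i = c * level j" using arg_cong[OF ee, of "\<lambda>v. v $ 3"] by (simp add: chord_def)
      then have "c = 1" using arg_cong[of _ _ abs] level(2) c by (metis abs_mult abs_of_pos mult.right_neutral)
      then show ?thesis using chord_inj[OF i(1) j(1) s r] ee i j by simp
    qed
  qed
qed

end

section \<open>Crossings and local charts of the drawing\<close>

lemma double_half: "2 * ((a + 1) / 2) - 1 = (a :: real)" by (simp add: field_simps)

text \<open>Ratios and signs of coordinates survive normalisation, so the central projection to y =
  -1 can be computed before applying \<open>sgn\<close>.\<close>

lemma sgn_coordinate_ratio: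
  fixes v :: "real^3"
  assumes "v \<noteq> 0"
  shows "sgn v $ i / - (sgn v $ j) = v $ i / - (v $ j)" "sgn v $ j < 0 \<longleftrightarrow> v $ j < 0" "sgn v $ j = 0 \<longleftrightarrow> v $ j = 0"
  using assms by (simp_all add: sgn_div_norm mult_less_0_iff)

context meandric_curves
begin

text \<open>With half-length \<open>N + 2\<close> the base holds all slopes, which are at most
  \<open>N\<close>, together with a neighbourhood of radius 1 around each.\<close>

sublocale equator: spherical_polygon "triangle_vertex (real N + 2)" 3
  by (rule spherical_polygon_triangle) simp

sublocale loop: spherical_polygon meander_vertex "2 * N"
  by (rule spherical_polygon_meander)

text \<open>The x-coordinate at which the rays through the post meet the plane y = -1.\<close>

definition slope :: "nat \<Rightarrow> real" where "slope j = absc j / (1 - (absc j)\<^sup>2)"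

definition crossing :: "nat \<Rightarrow> real^3" where "crossing j = sgn (post j 0)"

lemma post_scale:
  assumes "j < N"
  shows "post j z = (1 - (absc j)\<^sup>2) *\<^sub>R pt (slope j) (-1) (z / (1 - (absc j)\<^sup>2))" "1 - (absc j)\<^sup>2 > 0"
    "sgn (post j z) = sgn (pt (slope j) (-1) (z / (1 - (absc j)\<^sup>2)))"
proof -
  show p: "1 - (absc j)\<^sup>2 > 0" using absc_sq[OF assms] by simp
  show e: "post j z = (1 - (absc j)\<^sup>2) *\<^sub>R pt (slope j) (-1) (z / (1 - (absc j)\<^sup>2))"
    using p by (simp add: post_def slope_def vec3_eq_iff)
  show "sgn (post j z) = sgn (pt (slope j) (-1) (z / (1 - (absc j)\<^sup>2)))"
    unfolding e sgn_scaleR using p by simp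
qed

lemma crossing_eq: "j < N \<Longrightarrow> crossing j = sgn (pt (slope j) (-1) 0)"
  using post_scale(3)[of j 0] by (simp add: crossing_def)

text \<open>Abscissae are at least \<open>1 / N\<close> apart, and dividing by
  \<open>1 - x^2\<close>, which lies in (0,1] and decreases, only widens gaps. The bound will be the
  radius of the charts.\<close>

lemma slope_gap:
  assumes "i < j" "j < N"
  shows "slope i + 1 / real N \<le> slope j"
proof -
  have p: "1 - (absc i)\<^sup>2 > 0" "1 - (absc j)\<^sup>2 > 0" using post_scale(2) assms by auto
  have sq: "(absc i)\<^sup>2 \<le> (absc j)\<^sup>2" using absc(3,5) assms by (intro power_mono) auto
  have "absc i / (1 - (absc i)\<^sup>2) \<le> absc i / (1 - (absc j)\<^sup>2)"
    using p sq absc(3)[of i] by (intro divide_left_mono) auto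
  moreover have "absc j / (1 - (absc j)\<^sup>2) - absc i / (1 - (absc j)\<^sup>2) = (absc j - absc i) / (1 - (absc j)\<^sup>2)"
    by (simp add: diff_divide_distrib)
  moreover have "absc j - absc i \<le> (absc j - absc i) / (1 - (absc j)\<^sup>2)"
  proof -
    have "(absc j - absc i) * (1 - (absc j)\<^sup>2) \<le> (absc j - absc i) * 1"
      using absc(5)[of i j] assms by (intro mult_left_mono) auto
    then show ?thesis using p(2) by (simp add: pos_le_divide_eq)
  qed
  moreover have "1 / real N \<le> absc j - absc i"
    using assms N by (simp add: absc_def divide_right_mono flip: diff_divide_distrib)
  ultimately show ?thesis unfolding slope_def by linarith
qed

lemma slope_mono: "i < j \<Longrightarrow> j < N \<Longrightarrow> slope i < slope j"
  using slope_gap[of i j] N by (smt (verit) divide_pos_pos of_nat_0_less_iff)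

text \<open>\<open>absc j\<close> is at most \<open>1 - 1 / N\<close>, so the denominator of the
  slope is at least \<open>1 / N\<close>.\<close>

lemma slope_bound:
  assumes "j < N"
  shows "0 \<le> slope j" "slope j \<le> real N"
proof -
  have p: "1 - (absc j)\<^sup>2 > 0" using post_scale(2) assms by auto
  show "0 \<le> slope j" unfolding slope_def using p absc(3)[of j] by simp
  have "real j + 1 \<le> real N" using assms by simp
  then have "1 / real N \<le> 1 - absc j" using N by (simp add: absc_def field_simps)
  also have "\<dots> \<le> 1 - (absc j)\<^sup>2"
    using absc(3)[of j] absc(4)[OF assms] by (simp add: power2_eq_square mult_left_le)
  finally have "1 \<le> (1 - (absc j)\<^sup>2) * real N" using N by (simp add: field_simps)
  then have "absc j \<le> (1 - (absc j)\<^sup>2) * real N" using absc(4)[OF assms] by linarith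
  then show "slope j \<le> real N" unfolding slope_def using p by (simp add: field_simps)
qed

text \<open>Inverts the parametrisation of the base: halving gives the position on edge 0, and this
  is the first of three edges, hence the 6.\<close>

definition equator_param :: "real \<Rightarrow> real" where
  "equator_param x = (x / (real N + 2) + 1) / 6"

lemma equator_param:
  assumes "\<bar>x\<bar> < real N + 2"
  shows "equator_param x \<in> {0..<1}" "equator.curve (equator_param x) = sgn (pt x (-1) 0)"
proof -
  define s where "s = (x / (real N + 2) + 1) / 2"
  have "-1 < x / (real N + 2)" "x / (real N + 2) < 1"
    using assms by (simp_all add: abs_less_iff field_simps)
  then have s: "0 < s" "s < 1" by (auto simp: s_def)
  have e: "equator_param x = (real 0 + s) / real 3" by (simp add: equator_param_def s_def)
  show "equator_param x \<in> {0..<1}" unfolding e using s by simp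
  have "2 * s - 1 = x / (real N + 2)" unfolding s_def by (rule double_half)
  then have "(real N + 2) * (2 * s - 1) = x" by simp
  then show "equator.curve (equator_param x) = sgn (pt x (-1) 0)"
    unfolding e using equator.curve_edge[of 0 s] s triangle_edge(1)[of "real N + 2" s] by simp
qed

lemma equator_param_mono: "x < y \<Longrightarrow> equator_param x < equator_param y"
  unfolding equator_param_def by (simp add: divide_strict_right_mono)

lemma path_image_equator: "u \<in> path_image equator.curve \<Longrightarrow> u $ 3 = 0"
proof -
  assume "u \<in> path_image equator.curve"
  then obtain k y where k: "k < 3" "y \<in> closed_segment (triangle_vertex (real N + 2) k) (triangle_vertex (real N + 2) (Suc k))" "u = sgn y"
    unfolding equator.path_image_curve by auto
  then obtain s where s: "y = triangle_vertex (real N + 2) k + s *\<^sub>R (triangle_vertex (real N + 2) (Suc k) - triangle_vertex (real N + 2) k)"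
    unfolding closed_segment_eq_edge by blast
  have "triangle_vertex (real N + 2) l $ 3 = 0" for l by (simp add: triangle_vertex_def)
  then have "y $ 3 = 0" unfolding s by simp
  then show ?thesis using k(3) by (simp add: sgn_div_norm)
qed

lemma path_image_loop_cases:
  assumes "u \<in> path_image loop.curve"
  obtains (post) j z where "j < N" "\<bar>z\<bar> \<le> 1" "u = sgn (post j z)"
    | (chord) i s where "i < N" "0 \<le> s" "s \<le> 1" "u = sgn (chord i s)"
proof -
  obtain k y where k: "k < 2 * N" "y \<in> closed_segment (meander_vertex k) (meander_vertex (Suc k))" "u = sgn y"
    using assms unfolding loop.path_image_curve by auto
  then obtain s where s: "s \<in> {0..1}" "y = meander_vertex k + s *\<^sub>R (meander_vertex (Suc k) - meander_vertex k)"
    unfolding closed_segment_eq_edge by blast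
  from k(1) show thesis
  proof (rule edge_cases)
    fix i assume i: "i < N" "k = 2 * i"
    have "\<bar>2 * s - 1\<bar> \<le> 1" using s(1) by auto
    then have "\<bar>level i * (2 * s - 1)\<bar> \<le> 1" by (simp add: abs_mult level(2))
    then show thesis using post[of "w ! i"] w(3)[OF i(1)] meander_edge(1)[OF i(1), of s] s(2) k(3) i(2) by metis
  next
    fix i assume i: "i < N" "k = 2 * i + 1"
    then show thesis using chord[of i s] meander_edge(2)[OF i(1), of s] s k(3) by simp
  qed
qed

text \<open>The midpoint, at height 0, of edge \<open>2 * i\<close>, the post of
  \<open>w ! i\<close>, among \<open>2 * N\<close> edges.\<close>

definition loop_param :: "nat \<Rightarrow> real" where
  "loop_param i = (real (2 * i) + 1 / 2) / real (2 * N)"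

lemma loop_param:
  assumes "i < N"
  shows "loop_param i \<in> {0..<1}" "loop.curve (loop_param i) = crossing (w ! i)"
proof -
  have "real (2 * i) + 1 / 2 < real (2 * N)" using assms by (simp flip: of_nat_Suc)
  then show "loop_param i \<in> {0..<1}" using N by (simp add: loop_param_def)
  show "loop.curve (loop_param i) = crossing (w ! i)"
    using loop.curve_edge[of "2 * i" "1/2"] meander_edge(1)[OF assms, of "1/2"] assms
    by (simp add: loop_param_def crossing_def)
qed

lemma loop_param_mono: "i < j \<Longrightarrow> loop_param i < loop_param j"
  using N unfolding loop_param_def by (intro divide_strict_right_mono) auto

lemma post_in_loop:
  assumes "j < N" "\<bar>z\<bar> \<le> 1"
  shows "sgn (post j z) \<in> path_image loop.curve"
proof -
  obtain i where i: "i < N" "w ! i = j" using w(5)[OF assms(1)] by blast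
  \<comment> \<open>Solves \<open>level i * (2 * s - 1) = z\<close>, as the square of a level is
    1.\<close>
  define s where "s = (level i * z + 1) / 2"
  have "\<bar>level i * z\<bar> \<le> 1" using assms(2) by (simp add: abs_mult level(2))
  then have s: "s \<in> {0..1}" by (auto simp: s_def)
  have "2 * s - 1 = level i * z" unfolding s_def by (rule double_half)
  then have "level i * (2 * s - 1) = (level i * level i) * z" by simp
  also have "level i * level i = 1" by (simp add: level_def)
  finally have "meander_vertex (2 * i) + s *\<^sub>R (meander_vertex (Suc (2 * i)) - meander_vertex (2 * i)) = post j z"
    using meander_edge(1)[OF i(1), of s] i(2) by simp
  then have "post j z \<in> closed_segment (meander_vertex (2 * i)) (meander_vertex (Suc (2 * i)))"
    using s unfolding closed_segment_eq_edge by (metis imageI)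
  moreover have "2 * i < 2 * N" using i(1) by simp
  ultimately show ?thesis unfolding loop.path_image_curve by blast
qed

lemma crossing_inj: "i < N \<Longrightarrow> j < N \<Longrightarrow> crossing i = crossing j \<longleftrightarrow> i = j"
proof
  assume ij: "i < N" "j < N" and e: "crossing i = crossing j"
  obtain c where c: "c > 0" "post i 0 = c *\<^sub>R post j 0"
    using sgn_eqE[OF e[unfolded crossing_def] post_chord_nonzero(1)[OF ij(1)] post_chord_nonzero(1)[OF ij(2)]] .
  then show "i = j" using post_inj[OF ij c] by simp
qed simp

lemma crossings: "path_image equator.curve \<inter> path_image loop.curve = crossing ` {..<N}"
proof
  show "path_image equator.curve \<inter> path_image loop.curve \<subseteq> crossing ` {..<N}"
  proof
    fix u assume u: "u \<in> path_image equator.curve \<inter> path_image loop.curve"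
    then have u3: "u $ 3 = 0" using path_image_equator by blast
    have ul: "u \<in> path_image loop.curve" using u by blast
    then show "u \<in> crossing ` {..<N}"
    proof (cases rule: path_image_loop_cases)
      case (post j z)
      then have "post j z $ 3 = 0" using u3 sgn_coordinate_ratio(3)[OF post_chord_nonzero(1)] by simp
      then have "z = 0" by (simp add: post_def)
      then show ?thesis using post by (auto simp: crossing_def)
    next
      case (chord i s)
      then have "chord i s $ 3 = 0" using u3 sgn_coordinate_ratio(3)[OF post_chord_nonzero(2)] by simp
      then show ?thesis using level(1)[of i] by (simp add: chord_def)
    qed
  qed
  show "crossing ` {..<N} \<subseteq> path_image equator.curve \<inter> path_image loop.curve"
  proof clarify
    fix j assume j: "j < N"
    have b: "\<bar>slope j\<bar> < real N + 2" using slope_bound[OF j] by simp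
    have "crossing j = equator.curve (equator_param (slope j))"
      using equator_param(2)[OF b] crossing_eq[OF j] by simp
    then have "crossing j \<in> path_image equator.curve"
      using equator_param(1)[OF b] by (auto simp: path_image_def)
    moreover have "crossing j \<in> path_image loop.curve"
      unfolding crossing_def using post_in_loop[OF j, of 0] by simp
    ultimately show "crossing j \<in> path_image equator.curve \<inter> path_image loop.curve" by blast
  qed
qed

text \<open>Central projection to y = -1, centred at the crossing, is the chart: the equator becomes
  the horizontal axis and every post part of a vertical line. It remains to keep the other posts and
  all chords out.\<close>

lemma transverse_at_crossing:
  assumes j: "j < N"
  shows "transverse_at (path_image equator.curve) (path_image loop.curve) (crossing j)"
proof -
  define f :: "real^3 \<Rightarrow> real \<times> real" where "f u = (u $ 1 / - (u $ 2) - slope j, u $ 3 / - (u $ 2))" for u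
  define k :: "real \<times> real \<Rightarrow> real^3" where "k v = sgn (pt (fst v + slope j) (-1) (snd v))" for v
  \<comment> \<open>Radius \<open>1 / N\<close>, the gap between slopes, excludes the other posts;
    being at most 1, it also excludes the chords.\<close>
  define V :: "(real \<times> real) set" where "V = ball 0 (1 / real N)"
  define O' where "O' = {u :: real^3. u $ 2 < 0}"
  define U where "U = sphere 0 1 \<inter> (O' \<inter> f -` V)"
  have rpos: "1 / real N > 0" "1 / real N \<le> 1" using N by auto
  have Vsmall: "\<bar>fst v\<bar> < 1 / real N \<and> \<bar>snd v\<bar> < 1 / real N" if "v \<in> V" for v
    using that norm_fst_le[of "fst v" "snd v"] norm_snd_le[of "snd v" "fst v"] by (auto simp: V_def)
  have openO: "open O'" unfolding O'_def by (intro open_Collect_less continuous_intros)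
  have contf: "continuous_on O' f" unfolding f_def O'_def by (intro continuous_intros) auto
  have "open (O' \<inter> f -` V)" by (rule continuous_open_preimage[OF contf openO]) (simp add: V_def)
  then have opU: "openin (top_of_set (sphere 0 1)) U" unfolding U_def by (rule openin_open_Int)
  have pnz: "pt a (-1) b \<noteq> 0" for a b by (simp add: vec3_eq_iff)
  have fk: "f (k v) = v" and kU: "k v $ 2 < 0" "norm (k v) = 1" for v
    unfolding f_def k_def using sgn_coordinate_ratio(1,2)[OF pnz] pnz by (simp_all add: norm_sgn)
  have kf: "k (f u) = u" if "u \<in> U" for u
  proof -
    have u: "norm u = 1" "u $ 2 < 0" using that by (auto simp: U_def O'_def)
    have "pt (fst (f u) + slope j) (-1) (snd (f u)) = (1 / - (u $ 2)) *\<^sub>R u"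
      using u(2) by (simp add: f_def vec3_eq_iff field_simps)
    then have "k (f u) = sgn u" unfolding k_def using u(2) by (simp add: sgn_scaleR divide_less_0_iff sgn_minus)
    then show ?thesis using u(1) by (simp add: sgn_div_norm)
  qed
  have kVU: "k v \<in> U" if "v \<in> V" for v using that kU fk by (simp add: U_def O'_def)
  have contk: "continuous_on V k"
  proof -
    have "continuous_on V (\<lambda>v :: real \<times> real. pt (fst v + slope j) (-1) (snd v))"
    proof -
      have "pt a b c = a *\<^sub>R axis 1 1 + b *\<^sub>R axis 2 1 + c *\<^sub>R axis 3 1" for a b c
        by (simp add: vec3_eq_iff axis_def)
      then show ?thesis by (simp only:) (intro continuous_intros)
    qed
    then show ?thesis unfolding k_def using pnz by (intro continuous_on_sgn) auto
  qed
  have hom: "homeomorphism U V f k"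
  proof (rule homeomorphismI)
    show "continuous_on U f" by (rule continuous_on_subset[OF contf]) (auto simp: U_def)
    show "f ` U \<subseteq> V" by (auto simp: U_def)
    show "k ` V \<subseteq> U" using kVU by blast
  qed (use contk fk kf in auto)
  have pk: "crossing j = k 0" using crossing_eq[OF j] by (simp add: k_def)
  have "0 \<in> V" using rpos by (simp add: V_def)
  then have pU: "crossing j \<in> U" "f (crossing j) = 0" unfolding pk using kVU fk by auto
  have fA: "f ` (U \<inter> path_image equator.curve) = {v \<in> V. snd v = 0}"
  proof
    show "f ` (U \<inter> path_image equator.curve) \<subseteq> {v \<in> V. snd v = 0}"
      using path_image_equator by (auto simp: U_def f_def)
    show "{v \<in> V. snd v = 0} \<subseteq> f ` (U \<inter> path_image equator.curve)"
    proof clarify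
      fix v assume v: "v \<in> V" "snd v = 0"
      have b: "\<bar>fst v + slope j\<bar> < real N + 2" using Vsmall[OF v(1)] slope_bound[OF j] rpos by linarith
      have "k v = equator.curve (equator_param (fst v + slope j))"
        unfolding equator_param(2)[OF b] k_def v(2) ..
      then have "k v \<in> path_image equator.curve" using equator_param(1)[OF b] by (auto simp: path_image_def)
      then show "v \<in> f ` (U \<inter> path_image equator.curve)" using kVU[OF v(1)] fk[of v] by (metis IntI imageI)
    qed
  qed
  have fB: "f ` (U \<inter> path_image loop.curve) = {v \<in> V. fst v = 0}"
  proof
    show "f ` (U \<inter> path_image loop.curve) \<subseteq> {v \<in> V. fst v = 0}"
    proof
      fix v assume "v \<in> f ` (U \<inter> path_image loop.curve)"
      then obtain u where u: "u \<in> U" "u \<in> path_image loop.curve" "v = f u" by blast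
      have vV: "v \<in> V" and u2: "u $ 2 < 0" using u by (auto simp: U_def O'_def)
      from u(2) have "fst v = 0"
      proof (cases rule: path_image_loop_cases)
        case (post i z)
        have "fst v = slope i - slope j"
          unfolding u(3) post(3) post_scale(3)[OF post(1)] f_def
          using sgn_coordinate_ratio(1)[OF pnz[of "slope i" "z / (1 - (absc i)\<^sup>2)"], of 1 2] by simp
        moreover have "\<bar>fst v\<bar> < 1 / real N" using Vsmall[OF vV] by blast
        ultimately have "\<not> i < j" "\<not> j < i" using slope_gap[of i j] slope_gap[of j i] j post(1) by auto
        then show ?thesis using \<open>fst v = slope i - slope j\<close> by simp
      next
        case (chord i s)
        have c2: "chord i s $ 2 < 0"
          using u2 sgn_coordinate_ratio(2)[OF post_chord_nonzero(2)] unfolding chord(4) by simp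
        \<comment> \<open>A chord has height 1 or -1 and depth at most 1, so its second chart
          coordinate is at least 1 in absolute value.\<close>
        have "chord i s $ 2 \<ge> -1" using chord_above[OF chord(2,3), of i] zero_le_power2[of "chord i s $ 1"] by linarith
        then have "1 \<le> 1 / - (chord i s $ 2)" using c2 by (simp add: field_simps)
        moreover have "snd v = chord i s $ 3 / - (chord i s $ 2)"
          unfolding u(3) chord(4) f_def using sgn_coordinate_ratio(1)[OF post_chord_nonzero(2)] by simp
        then have "\<bar>snd v\<bar> = 1 / - (chord i s $ 2)" using c2 level(2)[of i] by (simp add: chord_def abs_divide)
        ultimately show ?thesis using Vsmall[OF vV] rpos by linarith
      qed
      then show "v \<in> {v \<in> V. fst v = 0}" using vV by simp
    qed
    show "{v \<in> V. fst v = 0} \<subseteq> f ` (U \<inter> path_image loop.curve)"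
    proof clarify
      fix v assume v: "v \<in> V" "fst v = 0"
      \<comment> \<open>The height on the post that the chart sends to \<open>snd v\<close>; it
        stays within the post because \<open>snd v\<close> is at most 1 in absolute value.\<close>
      define z where "z = snd v * (1 - (absc j)\<^sup>2)"
      have p: "0 < 1 - (absc j)\<^sup>2" "1 - (absc j)\<^sup>2 \<le> 1" using post_scale(2)[OF j] by auto
      have "\<bar>snd v\<bar> \<le> 1" using Vsmall[OF v(1)] rpos by linarith
      then have "\<bar>z\<bar> \<le> 1" unfolding z_def using p by (simp add: abs_mult mult_le_one)
      then have "sgn (post j z) \<in> path_image loop.curve" by (rule post_in_loop[OF j])
      moreover have "sgn (post j z) = k v" unfolding post_scale(3)[OF j] k_def z_def using v(2) p by simp
      ultimately show "v \<in> f ` (U \<inter> path_image loop.curve)" using kVU[OF v(1)] fk[of v] by (metis IntI imageI)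
    qed
  qed
  show ?thesis unfolding transverse_at_def
    using opU pU hom fA fB by (intro exI[of _ U] exI[of _ V] exI[of _ f] exI[of _ k]) (auto simp: V_def)
qed

end


section \<open>Realizing a first-return permutation\<close>

lemma in_cyclic_orderI:
  assumes "sorted_wrt (<) ts" "set ts \<subseteq> {0..<1}" "rotate r xs = map g ts"
  shows "in_cyclic_order g xs"
  using assms unfolding in_cyclic_order_def by blast

text \<open>\<open>x i\<close> is the crossing of the \<open>i\<close>-th smallest marked label.
  Slopes increase with labels, which gives the order along A; along B the posts are passed in the
  order of \<open>w\<close>, so the marked ones read \<open>l\<close>, a rotation of
  \<open>cycle_word n \<sigma>\<close>.\<close>

lemma meandric_pl_jordan_realization:
  assumes \<tau>: "cyclic_meandric N \<tau>" and S: "S \<subseteq> {..<N}" "card S = n" and n: "n > 0"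
    and fr: "first_return N \<tau> S = \<sigma>"
  shows "\<exists>a b X. pl_jordan_realization n \<sigma> a b X \<and> card (path_image a \<inter> path_image b) = N"
proof -
  define w where "w = cycle_word N \<tau>"
  interpret meandric_curves N w
    by unfold_locales (simp add: w_def meandric_word_cycle_word[OF \<tau>])
  have finS: "finite S" using S(1) finite_subset by blast
  define e where "e = sorted_list_of_set S"
  have e: "sorted_wrt (<) e" "set e = S" "length e = n" "distinct e"
    using finS S(2) by (simp_all add: e_def)
  have eN: "e ! i < N" if "i < n" for i using that e(2,3) S(1) by (metis lessThan_iff nth_mem subsetD)
  define rank where "rank y = card {z \<in> S. z < y}" for y
  have rank_e: "rank (e ! i) = i" if i: "i < n" for i
  proof -
    have "{z \<in> S. z < e ! i} = (!) e ` {..<i}"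
    proof
      show "{z \<in> S. z < e ! i} \<subseteq> (!) e ` {..<i}"
      proof
        fix z assume z: "z \<in> {z \<in> S. z < e ! i}"
        then obtain k where k: "k < n" "z = e ! k" using e(2,3) by (metis (no_types, lifting) in_set_conv_nth mem_Collect_eq)
        have "\<not> i < k" using sorted_wrt_nth_less[OF e(1), of i k] k e(3) z by auto
        moreover have "k \<noteq> i" using k z by auto
        ultimately show "z \<in> (!) e ` {..<i}" using k by auto
      qed
      show "(!) e ` {..<i} \<subseteq> {z \<in> S. z < e ! i}"
        using sorted_wrt_nth_less[OF e(1)] e(2,3) i by (auto intro: nth_mem)
    qed
    moreover have "inj_on ((!) e) {..<i}" using e(3,4) i by (auto simp: inj_on_def nth_eq_iff_index_eq)
    ultimately show ?thesis by (simp add: rank_def card_image)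
  qed
  have e_rank: "e ! rank y = y" "rank y < n" if "y \<in> S" for y
  proof -
    have "y \<in> set e" using that e(2) by simp
    then obtain i where i: "i < n" "e ! i = y" using e(3) unfolding in_set_conv_nth by blast
    then have "rank y = i" using rank_e by blast
    then show "e ! rank y = y" "rank y < n" using i by simp_all
  qed
  define l where "l = map rank (filter (\<lambda>y. y \<in> S) w)"
  have setw: "set w = {..<N}" using meandric by (simp add: meandric_word_def)
  have filt: "set (filter (\<lambda>y. y \<in> S) w) = S" using setw S(1) by auto
  have inj: "inj_on rank S" by (rule inj_on_inverseI[where g = "(!) e"]) (rule e_rank(1))
  have dl: "distinct l" unfolding l_def distinct_map filt using w(1) inj by simp
  have "set l = rank ` S" unfolding l_def using filt by simp
  also have "\<dots> = {..<n}"
  proof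
    show "{..<n} \<subseteq> rank ` S" using rank_e e(2,3) by (metis image_eqI lessThan_iff nth_mem subsetI)
  qed (use e_rank(2) in blast)
  finally have sl: "set l = {..<n}" .
  have "\<sigma> = cycle_of_list l" using fr unfolding first_return_def l_def rank_def w_def by simp
  then obtain r where r: "rotate r (cycle_word n \<sigma>) = l" using rotate_cycle_word[OF dl sl n] by blast
  define x where "x i = crossing (e ! i)" for i
  have bij: "bij_betw x {..<n} (crossing ` S)"
    unfolding bij_betw_def
  proof
    show "inj_on x {..<n}"
      by (rule inj_onI) (metis crossing_inj eN lessThan_iff rank_e x_def)
    show "x ` {..<n} = crossing ` S" unfolding x_def e(2)[symmetric] set_conv_nth e(3) by auto
  qed
  have bound: "\<bar>slope j\<bar> < real N + 2" if "j < N" for j using slope_bound[OF that] by simp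
  have oa: "in_cyclic_order equator.curve (map x [0..<n])"
  proof (rule in_cyclic_orderI[where r = 0])
    show "sorted_wrt (<) (map (\<lambda>i. equator_param (slope (e ! i))) [0..<n])"
      using equator_param_mono slope_mono sorted_wrt_nth_less[OF e(1)] e(3) eN
      by (auto simp: sorted_wrt_iff_nth_less)
    show "set (map (\<lambda>i. equator_param (slope (e ! i))) [0..<n]) \<subseteq> {0..<1}"
      using equator_param(1)[OF bound[OF eN]] by auto
    show "rotate 0 (map x [0..<n]) = map equator.curve (map (\<lambda>i. equator_param (slope (e ! i))) [0..<n])"
      using equator_param(2)[OF bound[OF eN]] crossing_eq[OF eN] by (simp add: x_def)
  qed
  have ob: "in_cyclic_order loop.curve (map x (cycle_word n \<sigma>))"
  proof (rule in_cyclic_orderI[where r = r])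
    let ?I = "filter (\<lambda>i. w ! i \<in> S) [0..<N]"
    have "sorted_wrt (<) ?I" by (intro sorted_wrt_filter) simp
    then show "sorted_wrt (<) (map loop_param ?I)"
      unfolding sorted_wrt_map by (rule sorted_wrt_mono_rel[rotated]) (auto intro: loop_param_mono)
    show "set (map loop_param ?I) \<subseteq> {0..<1}" using loop_param(1) by auto
    have wm: "map ((!) w) [0..<N] = w" using w(2) map_nth[of w] by simp
    have fw: "filter (\<lambda>y. y \<in> S) w = map ((!) w) ?I"
      using filter_map[of "\<lambda>y. y \<in> S" "(!) w" "[0..<N]"] unfolding wm by (simp add: o_def)
    have "rotate r (map x (cycle_word n \<sigma>)) = map x l" by (simp add: rotate_map r)
    also have "\<dots> = map crossing (filter (\<lambda>y. y \<in> S) w)"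
      unfolding l_def using e_rank(1) by (simp add: x_def)
    also have "\<dots> = map loop.curve (map loop_param ?I)"
      unfolding fw using loop_param(2) by simp
    finally show "rotate r (map x (cycle_word n \<sigma>)) = map loop.curve (map loop_param ?I)" .
  qed
  have injc: "inj_on crossing {..<N}" by (rule inj_onI) (simp add: crossing_inj)
  have cS: "card (crossing ` S) = n" using card_image[OF inj_on_subset[OF injc S(1)]] S(2) by simp
  have "pl_jordan_realization n \<sigma> equator.curve loop.curve (crossing ` S)"
    unfolding pl_jordan_realization_def crossings
    using equator.pl_jordan_curve_curve loop.pl_jordan_curve_curve transverse_at_crossing S(1) cS bij oa ob
    by blast
  moreover have "card (path_image equator.curve \<inter> path_image loop.curve) = N"
    unfolding crossings using card_image[OF injc] by simp
  ultimately show ?thesis by blast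
qed

section \<open>The meander number and the Jordan crossing number\<close>

theorem lemmaA:
  fixes n :: nat and \<sigma> :: "nat \<Rightarrow> nat"
  assumes "n > 0" and "cyclic_permutation n \<sigma>"
  shows "meander_number n \<sigma> = n + jordan_crossing_number n \<sigma>"
proof -
  define P where "P N \<longleftrightarrow> (\<exists>\<tau> S. cyclic_meandric N \<tau> \<and> S \<subseteq> {..<N} \<and> card S = n \<and> first_return N \<tau> S = \<sigma>)" for N
  define Q where "Q k \<longleftrightarrow> (\<exists>a b S. pl_jordan_realization n \<sigma> a b S \<and> k = card (path_image a \<inter> path_image b) - n)" for k
  have PQ: "Q (N - n)" "n \<le> N" if PN: "P N" for N
  proof -
    obtain \<tau> S where \<tau>: "cyclic_meandric N \<tau>" "S \<subseteq> {..<N}" "card S = n" "first_return N \<tau> S = \<sigma>"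
      using PN unfolding P_def by blast
    show "Q (N - n)"
      using meandric_pl_jordan_realization[OF \<tau>(1-3) assms(1) \<tau>(4)] unfolding Q_def by metis
    show "n \<le> N" using card_mono[OF _ \<tau>(2)] \<tau>(3) by simp
  qed
  have QP: "P (n + k)" if Qk: "Q k" for k
  proof -
    obtain a b S where real: "pl_jordan_realization n \<sigma> a b S" and k: "k = card (path_image a \<inter> path_image b) - n"
      using Qk unfolding Q_def by blast
    have "finite (path_image a \<inter> path_image b)" "S \<subseteq> path_image a \<inter> path_image b" "card S = n"
      using real unfolding pl_jordan_realization_def by blast+
    \<comment> \<open>\<open>S\<close> lies in the finite intersection, so the subtraction is not
      truncated.\<close>
    then have "n + k = card (path_image a \<inter> path_image b)"
      using card_mono[of "path_image a \<inter> path_image b" S] k by simp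
    then show ?thesis
      using pl_jordan_realization_meandric[OF real assms] unfolding P_def by simp
  qed
  \<comment> \<open>Existence makes this minimum attained; through \<open>PQ\<close> it also
    supplies the witness for the minimum over \<open>Q\<close>.\<close>
  have "P (LEAST N. P N)"
    using exists_meandric_first_return[OF assms(2,1)] unfolding P_def[symmetric] by (rule LeastI_ex)
  note L = PQ[OF this]
  have "(LEAST k. Q k) \<le> (LEAST N. P N) - n" by (rule Least_le[of Q, OF L(1)])
  moreover have "(LEAST N. P N) \<le> n + (LEAST k. Q k)" by (rule Least_le[of P, OF QP[OF LeastI[of Q, OF L(1)]]])
  ultimately have "(LEAST N. P N) = n + (LEAST k. Q k)" using L(2) by linarith
  then show ?thesis unfolding meander_number_def jordan_crossing_number_def P_def Q_def .
qed

end
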